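(* Let $\kappa=\frac12$. For every probability measure $\mu$ on $(-1,1)$, every $s\ge0$ and every measurable set $S\subset(-1,1)$, $$\lim_{t\to\infty}\frac1t\int_s^t\mathbb{P}_{\mu,s}(X_u\in S\mid\tau_X>t)\,du=\int_S\mathbb{E}^Z_x(\tau_Z)\,\alpha_{OU}(dx).$$
   Context: For $s\ge 0$ and $x\in\mathbb{R}$, let $\mathbb{P}_{x,s}$ be a probability measure under which $(X_t)_{t\ge s}$ is given by $X_t=\frac{x\sqrt{s+1}+W_{t-s}}{\sqrt{t+1}}$, with $W$ a standard Brownian motion started at $0$. Let $\tau_X:=\inf\{t\ge s:|X_t|=1\}$ and $\mathbb{P}_{\mu,s}=\int\mathbb{P}_{x,s}\mu(dx)$. $Z$ is the Ornstein–Uhlenbeck process with generator $Lf(x)=\frac12f''(x)-\frac12xf'(x)$, $\mathbb{E}^Z_x$ denotes expectation for $Z$ started at $x$, and $\tau_Z:=\inf\{t\ge0:|Z_t|=1\}$. $\alpha_{OU}$ is the unique quasi-stationary distribution of $Z$ absorbed at $(-1,1)^c$, i.e. $\alpha_{OU}(dx)=K(1-x^2)e^{-x^2/2}dx$ on $(-1,1)$ with $K$ normalizing. *)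

theory Defs
  imports "HOL-Probability.Probability"
begin

definition std_BM :: "'a measure \<Rightarrow> (real \<Rightarrow> 'a \<Rightarrow> real) \<Rightarrow> bool" where
  "std_BM M W \<longleftrightarrow> prob_space M
     \<and> (\<forall>t\<ge>0. W t \<in> borel_measurable M)
     \<and> (\<forall>\<omega>\<in>space M. W 0 \<omega> = 0 \<and> continuous_on {0..} (\<lambda>t. W t \<omega>))
     \<and> (\<forall>s t. 0 \<le> s \<and> s < t \<longrightarrow>
          distributed M lborel (\<lambda>\<omega>. W t \<omega> - W s \<omega>) (normal_density 0 (sqrt (t - s))))
     \<and> (\<forall>(ts :: nat \<Rightarrow> real) n. 0 \<le> ts 0 \<and> (\<forall>i<n. ts i < ts (Suc i)) \<longrightarrow>
          prob_space.indep_vars M (\<lambda>_. borel) (\<lambda>i \<omega>. W (ts (Suc i)) \<omega> - W (ts i) \<omega>) {..<n})"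

definition Xproc :: "(real \<Rightarrow> 'a \<Rightarrow> real) \<Rightarrow> real \<Rightarrow> real \<Rightarrow> real \<Rightarrow> 'a \<Rightarrow> real" where
  "Xproc W x s t \<omega> = (x * sqrt (s + 1) + W (t - s) \<omega>) / sqrt (t + 1)"

text \<open>tau_X = inf {t \<ge> s. |X_t| = 1} (infimum of the empty set is +infinity).\<close>
definition tauX :: "(real \<Rightarrow> 'a \<Rightarrow> real) \<Rightarrow> real \<Rightarrow> real \<Rightarrow> 'a \<Rightarrow> ereal" where
  "tauX W x s \<omega> = Inf {ereal t | t. t \<ge> s \<and> \<bar>Xproc W x s t \<omega>\<bar> = 1}"

definition Pmu :: "'a measure \<Rightarrow> real measure \<Rightarrow> (real \<Rightarrow> 'a \<Rightarrow> bool) \<Rightarrow> real" where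
  "Pmu M \<mu> A = (\<integral>x. measure M {\<omega> \<in> space M. A x \<omega>} \<partial>\<mu>)"

text \<open>Ornstein-Uhlenbeck process with generator f''/2 - x f'/2 started at x, realised from the
  Brownian motion W via the Doob representation Z_r = e^{-r/2} (x + W_{e^r - 1}).\<close>
definition OUproc :: "(real \<Rightarrow> 'a \<Rightarrow> real) \<Rightarrow> real \<Rightarrow> real \<Rightarrow> 'a \<Rightarrow> real" where
  "OUproc W x r \<omega> = exp (- r / 2) * (x + W (exp r - 1) \<omega>)"

text \<open>tau_Z = inf {t \<ge> 0. |Z_t| = 1} (infimum of the empty set is +infinity).\<close>
definition tauZ :: "(real \<Rightarrow> 'a \<Rightarrow> real) \<Rightarrow> real \<Rightarrow> 'a \<Rightarrow> ennreal" where
  "tauZ W x \<omega> = Inf {ennreal t | t. t \<ge> 0 \<and> \<bar>OUproc W x t \<omega>\<bar> = 1}"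

definition EtauZ :: "'a measure \<Rightarrow> (real \<Rightarrow> 'a \<Rightarrow> real) \<Rightarrow> real \<Rightarrow> ennreal" where
  "EtauZ M W x = (\<integral>\<^sup>+\<omega>. tauZ W x \<omega> \<partial>M)"

text \<open>The quasi-stationary distribution alpha_OU(dx) = K (1 - x^2) e^{-x^2/2} dx on (-1,1).\<close>
definition K_OU :: real where
  "K_OU = 1 / (LINT x:{-1<..<1}|lborel. (1 - x\<^sup>2) * exp (- x\<^sup>2 / 2))"

definition alpha_OU :: "real measure" where
  "alpha_OU = density lborel
     (\<lambda>x. ennreal (indicator {-1<..<1} x * K_OU * (1 - x\<^sup>2) * exp (- x\<^sup>2 / 2)))"

end

theory Submission
  imports Defs
begin

text \<open>
  On the time scale \<open>t + 1 = (s + 1) exp r\<close> the process \<open>X\<close> becomes the Ornstein-Uhlenbeck process \<open>Z\<close>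
  killed on leaving \<open>(-1, 1)\<close>. Its principal eigenfunction \<open>1 - x\<^sup>2\<close> has eigenvalue 1, and the killed
  semigroup \<open>P\<close> is symmetric with respect to \<open>exp (- x\<^sup>2 / 2) dx\<close>. A Doeblin minorization, obtained from
  the reflection principle in the interior and from the barrier \<open>(1 - x\<^sup>2) (2 + x\<^sup>2)\<close> at the boundary,
  gives \<open>exp r * P\<^sub>r g \<rightarrow> c(g) (1 - x\<^sup>2)\<close>, uniformly relative to \<open>1 - x\<^sup>2\<close>. By the Markov property the
  conditional law at time \<open>u\<close> with \<open>u + 1 = v (t + 1)\<close> then tends to
  \<open>(1 / v) P\<^sub>x(\<tau> > - ln v) \<alpha>(dx)\<close>, and integrating over \<open>v \<in> (0, 1)\<close> turns the survival probability
  into the expected hitting time.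
\<close>

section \<open>The Ornstein-Uhlenbeck transition operator\<close>

text \<open>\<open>std_BM\<close> gives independent increments at finitely many times and no
  filtration, so the Markov property is available only along finite grids. Killing is therefore
  tested on grids, and two limits are taken. The mesh tends to zero for a closed interval inside
  \<open>(-1, 1)\<close>: leaving a closed set is an open condition and is seen on fine grids,
  whereas touching the boundary of an open set at one instant may be missed by all of them. Then the
  closed intervals exhaust \<open>(-1, 1)\<close>. No stochastic calculus enters; eigenvalue,
  barrier and reflection are inequalities for a single Gaussian step, iterated and passed to the
  limit.

  The constant 1, whose image is the survival probability, does not vanish at the boundary and so is
  not dominated by the eigenfunction. The barrier repairs this after any positive time. Measuring
  convergence relative to the eigenfunction then covers initial laws with mass arbitrarily near the
  endpoints.

  \<open>X\<close> is driven by a rescaled copy of the motion that drives \<open>Z\<close>, so the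
  two sides of the theorem can meet only in quantities that depend on the law alone.\<close>

definition bounded_borel :: "(real \<Rightarrow> real) \<Rightarrow> bool" where
  "bounded_borel f \<longleftrightarrow> f \<in> borel_measurable borel \<and> (\<exists>C. \<forall>x. \<bar>f x\<bar> \<le> C)"

text \<open>The Mehler kernel: at time \<open>q\<close> the process \<open>Z\<close> started at
  \<open>x\<close> is Gaussian with mean \<open>exp (- q / 2) * x\<close> and variance
  \<open>1 - exp (- q)\<close>; \<open>normal_density\<close> takes the standard deviation.\<close>

definition ou_density :: "real \<Rightarrow> real \<Rightarrow> real \<Rightarrow> real" where
  "ou_density q x = normal_density (exp (- q / 2) * x) (sqrt (1 - exp (- q)))"

definition ou_op :: "real \<Rightarrow> (real \<Rightarrow> real) \<Rightarrow> real \<Rightarrow> real" where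
  "ou_op q f x = (\<integral>y. ou_density q x y * f y \<partial>lborel)"

text \<open>One grid step with killing: only the end point of the step is tested, neither the
  starting point nor the path in between.\<close>

definition killed_op :: "real set \<Rightarrow> real \<Rightarrow> (real \<Rightarrow> real) \<Rightarrow> real \<Rightarrow> real" where
  "killed_op B q f = ou_op q (\<lambda>y. indicator B y * f y)"

lemma bounded_borelI:
  assumes "f \<in> borel_measurable borel" "\<And>x. \<bar>f x\<bar> \<le> C"
  shows "bounded_borel f"
  using assms unfolding bounded_borel_def by auto

lemma bounded_borel_measurable: "bounded_borel f \<Longrightarrow> f \<in> borel_measurable borel"
  unfolding bounded_borel_def by auto

lemma bounded_borelE:
  assumes "bounded_borel f"
  obtains C where "C > 0" "\<And>x. \<bar>f x\<bar> \<le> C"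
proof -
  obtain C where "\<And>x. \<bar>f x\<bar> \<le> C" using assms unfolding bounded_borel_def by auto
  then have "\<bar>f x\<bar> \<le> max C 1" for x by (meson max.coboundedI1)
  then show ?thesis by (intro that[of "max C 1"]) auto
qed

lemma bounded_borel_const[simp]: "bounded_borel (\<lambda>x. c)"
  by (rule bounded_borelI[where C="\<bar>c\<bar>"]) auto

lemma bounded_borel_mult:
  assumes "bounded_borel f" "bounded_borel g"
  shows "bounded_borel (\<lambda>x. f x * g x)"
proof -
  have [measurable]: "f \<in> borel_measurable borel" "g \<in> borel_measurable borel"
    using assms bounded_borel_measurable by auto
  obtain C where C: "C > 0" "\<And>x. \<bar>f x\<bar> \<le> C" using assms bounded_borelE by blast
  obtain D where D: "D > 0" "\<And>x. \<bar>g x\<bar> \<le> D" using assms bounded_borelE by blast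
  show ?thesis
    by (rule bounded_borelI[where C="C * D"], measurable) (simp add: abs_mult mult_mono' C D)
qed

lemma bounded_borel_add:
  assumes "bounded_borel f" "bounded_borel g"
  shows "bounded_borel (\<lambda>x. f x + g x)"
proof -
  have [measurable]: "f \<in> borel_measurable borel" "g \<in> borel_measurable borel"
    using assms bounded_borel_measurable by auto
  obtain C where C: "C > 0" "\<And>x. \<bar>f x\<bar> \<le> C" using assms bounded_borelE by blast
  obtain D where D: "D > 0" "\<And>x. \<bar>g x\<bar> \<le> D" using assms bounded_borelE by blast
  show ?thesis
    by (rule bounded_borelI[where C="C + D"], measurable)
      (rule order_trans[OF abs_triangle_ineq add_mono[OF C(2) D(2)]])
qed

lemma bounded_borel_diff:
  assumes "bounded_borel f" "bounded_borel g"
  shows "bounded_borel (\<lambda>x. f x - g x)"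
  using bounded_borel_add[OF assms(1) bounded_borel_mult[OF bounded_borel_const[of "-1"] assms(2)]] by simp

lemma bounded_borel_indicator: "B \<in> sets borel \<Longrightarrow> bounded_borel (indicator B)"
  by (rule bounded_borelI[where C=1]) (auto simp: indicator_def)

lemmas bounded_borel_intros = bounded_borel_const bounded_borel_add bounded_borel_diff
  bounded_borel_mult bounded_borel_indicator

lemma bounded_borel_reflect:
  assumes "bounded_borel f"
  shows "bounded_borel (\<lambda>x. f (c - x))"
  using assms unfolding bounded_borel_def by auto

lemma borel_measurable_ou_density[measurable]:
  "(\<lambda>(x, y). ou_density q x y) \<in> borel_measurable (borel \<Otimes>\<^sub>M borel)"
  unfolding ou_density_def normal_density_def by measurable

lemma borel_measurable_ou_density'[measurable]: "ou_density q x \<in> borel_measurable borel"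
  unfolding ou_density_def by measurable

lemma ou_density_nonneg[simp]: "0 \<le> ou_density q x y"
  unfolding ou_density_def by simp

lemma integrable_ou_density[simp]:
  assumes "q > 0" shows "integrable lborel (ou_density q x)"
  unfolding ou_density_def using assms by (intro integrable_normal_density) auto

lemma integral_ou_density[simp]:
  assumes "q > 0" shows "integral\<^sup>L lborel (ou_density q x) = 1"
  unfolding ou_density_def using assms by (subst integral_normal_density) auto

lemma integrable_ou_density_mult:
  assumes "q > 0" "bounded_borel f"
  shows "integrable lborel (\<lambda>y. ou_density q x y * f y)"
proof -
  have [measurable]: "f \<in> borel_measurable borel" using assms(2) by (rule bounded_borel_measurable)
  obtain C where C: "C > 0" "\<And>x. \<bar>f x\<bar> \<le> C" using assms bounded_borelE by blast
  show ?thesis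
  proof (rule Bochner_Integration.integrable_bound)
    show "integrable lborel (\<lambda>y. ou_density q x y * C)" using assms by simp
    show "AE y in lborel. norm (ou_density q x y * f y) \<le> norm (ou_density q x y * C)"
      using C by (intro AE_I2) (simp add: abs_mult mult_left_mono)
  qed measurable
qed

lemma ou_op_mono:
  assumes "q > 0" "bounded_borel f" "bounded_borel g" "\<And>y. f y \<le> g y"
  shows "ou_op q f x \<le> ou_op q g x"
  unfolding ou_op_def using assms
  by (intro integral_mono integrable_ou_density_mult) (auto intro: mult_left_mono)

lemma ou_op_const[simp]: "q > 0 \<Longrightarrow> ou_op q (\<lambda>_. c) x = c"
  unfolding ou_op_def by simp

lemma ou_op_add:
  assumes "q > 0" "bounded_borel f" "bounded_borel g"
  shows "ou_op q (\<lambda>y. f y + g y) x = ou_op q f x + ou_op q g x"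
  unfolding ou_op_def using assms
  by (simp add: distrib_left integrable_ou_density_mult Bochner_Integration.integral_add)

lemma ou_op_cmult:
  "ou_op q (\<lambda>y. c * f y) x = c * ou_op q f x"
  unfolding ou_op_def by (simp add: mult.left_commute)

lemma bounded_borel_ou_op:
  assumes "q > 0" "bounded_borel f"
  shows "bounded_borel (ou_op q f)"
proof -
  have [measurable]: "f \<in> borel_measurable borel" using assms(2) by (rule bounded_borel_measurable)
  obtain C where C: "C > 0" "\<And>x. \<bar>f x\<bar> \<le> C" using assms bounded_borelE by blast
  have m: "(\<lambda>x. ou_op q f x) \<in> borel_measurable borel"
    unfolding ou_op_def by measurable
  have C': "f y \<le> C" "- C \<le> f y" for y using C(2)[of y] by (auto simp: abs_le_iff)
  have "ou_op q f x \<le> C" for x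
    using ou_op_mono[OF assms(1,2) bounded_borel_const C'(1)] assms(1) by simp
  moreover have "-C \<le> ou_op q f x" for x
    using ou_op_mono[OF assms(1) bounded_borel_const assms(2) C'(2)] assms(1) by simp
  ultimately show ?thesis using m by (intro bounded_borelI[where C=C]) (auto simp: abs_le_iff minus_le_iff)
qed

lemma normal_density_scale:
  assumes "c > 0" "s > 0"
  shows "c * normal_density m (c * s) (m + c * w) = normal_density 0 s w"
proof -
  have "sqrt (2 * pi * (c * s)\<^sup>2) = c * sqrt (2 * pi * s\<^sup>2)"
    using assms by (simp add: power_mult_distrib real_sqrt_mult)
  then show ?thesis
    unfolding normal_density_def using assms by (simp add: power_mult_distrib)
qed

text \<open>The Brownian increment behind a step of \<open>Z\<close> has a standard deviation
  \<open>s\<close> that depends on absolute time, and the factor \<open>c\<close> from the Doob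
  representation compensates it. Only the product \<open>c * s\<close> enters the result, which is
  the time homogeneity of \<open>Z\<close>.\<close>

lemma ou_op_eq_std:
  assumes "q > 0" "c > 0" "s > 0" "c * s = sqrt (1 - exp (- q))"
  shows "ou_op q f z = (\<integral>w. normal_density 0 s w * f (exp (- q / 2) * z + c * w) \<partial>lborel)"
proof -
  have "ou_op q f z = \<bar>c\<bar> *\<^sub>R (\<integral>w. ou_density q z (exp (- q / 2) * z + c * w) * f (exp (- q / 2) * z + c * w) \<partial>lborel)"
    unfolding ou_op_def using assms by (intro lborel_integral_real_affine) auto
  also have "\<dots> = (\<integral>w. (c * normal_density (exp (- q / 2) * z) (c * s) (exp (- q / 2) * z + c * w)) * f (exp (- q / 2) * z + c * w) \<partial>lborel)"
    unfolding ou_density_def assms(4) using assms(2) by (simp add: mult.assoc)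
  also have "\<dots> = (\<integral>w. normal_density 0 s w * f (exp (- q / 2) * z + c * w) \<partial>lborel)"
    using assms(2,3) by (simp only: normal_density_scale)
  finally show ?thesis .
qed

section \<open>The Markov property from independent increments\<close>

locale brownian =
  fixes M :: "'a measure" and W :: "real \<Rightarrow> 'a \<Rightarrow> real"
  assumes BM: "std_BM M W"
begin

sublocale prob_space M
  using BM unfolding std_BM_def by blast

lemma W_measurable: "t \<ge> 0 \<Longrightarrow> W t \<in> borel_measurable M"
  using BM unfolding std_BM_def by blast

lemma W_0: "\<omega> \<in> space M \<Longrightarrow> W 0 \<omega> = 0"
  using BM unfolding std_BM_def by blast

lemma W_continuous: "\<omega> \<in> space M \<Longrightarrow> continuous_on {0..} (\<lambda>t. W t \<omega>)"
  using BM unfolding std_BM_def by blast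

lemma W_increment:
  "0 \<le> s \<Longrightarrow> s < t \<Longrightarrow>
    distributed M lborel (\<lambda>\<omega>. W t \<omega> - W s \<omega>) (normal_density 0 (sqrt (t - s)))"
  using BM unfolding std_BM_def by blast

lemma W_indep:
  fixes ts :: "nat \<Rightarrow> real"
  shows "0 \<le> ts 0 \<Longrightarrow> (\<And>i. i < n \<Longrightarrow> ts i < ts (Suc i)) \<Longrightarrow>
    indep_vars (\<lambda>_. borel) (\<lambda>i \<omega>. W (ts (Suc i)) \<omega> - W (ts i) \<omega>) {..<n}"
  using BM unfolding std_BM_def by blast

lemma OU_measurable[measurable]: "r \<ge> 0 \<Longrightarrow> OUproc W x r \<in> borel_measurable M"
  unfolding OUproc_def using W_measurable[of "exp r - 1"] by measurable

lemma OU_0: "\<omega> \<in> space M \<Longrightarrow> OUproc W x 0 \<omega> = x"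
  unfolding OUproc_def using W_0 by simp

lemma OU_continuous:
  assumes "\<omega> \<in> space M" shows "continuous_on {0..} (\<lambda>r. OUproc W x r \<omega>)"
proof -
  have "continuous_on {0..} (\<lambda>r::real. W (exp r - 1) \<omega>)"
    by (rule continuous_on_compose2[OF W_continuous[OF assms]]) (auto intro!: continuous_intros)
  then show ?thesis unfolding OUproc_def by (intro continuous_intros) auto
qed

lemma integrable_bounded_comp:
  assumes "X \<in> borel_measurable M" "\<And>\<omega>. \<bar>X \<omega>\<bar> \<le> (C::real)"
  shows "integrable M X"
  using assms by (intro integrable_const_bound[where B=C]) auto

text \<open>On the Brownian clock \<open>exp (\<sigma> i) - 1\<close> the past of the path is a
  function of the first \<open>n\<close> increments, and the last increment is independent of them.
  Fubini integrates the last one out, and the scaled Gaussian that remains is the kernel of the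
  step.\<close>

lemma markov_step:
  fixes \<sigma> :: "nat \<Rightarrow> real"
  assumes \<sigma>0: "\<sigma> 0 = 0" and \<sigma>: "\<And>i. i \<le> n \<Longrightarrow> \<sigma> i < \<sigma> (Suc i)"
    and \<phi>: "\<And>i. i \<le> n \<Longrightarrow> bounded_borel (\<phi> i)" and \<psi>: "bounded_borel \<psi>"
  shows "(\<integral>\<omega>. (\<Prod>i\<le>n. \<phi> i (OUproc W x (\<sigma> i) \<omega>)) * \<psi> (OUproc W x (\<sigma> (Suc n)) \<omega>) \<partial>M) =
    (\<integral>\<omega>. (\<Prod>i\<le>n. \<phi> i (OUproc W x (\<sigma> i) \<omega>)) * ou_op (\<sigma> (Suc n) - \<sigma> n) \<psi> (OUproc W x (\<sigma> n) \<omega>) \<partial>M)"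
proof -
  define ts where "ts i = exp (\<sigma> i) - 1" for i
  define inc where "inc i \<omega> = W (ts (Suc i)) \<omega> - W (ts i) \<omega>" for i \<omega>
  define q where "q = \<sigma> (Suc n) - \<sigma> n"
  have q: "q > 0" using \<sigma>[of n] by (simp add: q_def)
  have [measurable]: "i \<le> n \<Longrightarrow> \<phi> i \<in> borel_measurable borel" "\<psi> \<in> borel_measurable borel" for i
    using \<phi> \<psi> bounded_borel_measurable by auto
  have Gb: "bounded_borel (ou_op q \<psi>)" using q \<psi> by (rule bounded_borel_ou_op)
  have [measurable]: "ou_op q \<psi> \<in> borel_measurable borel"
    using Gb bounded_borel_measurable by auto
  have ts0: "ts 0 = 0" using \<sigma>0 by (simp add: ts_def)
  have tsS: "ts i < ts (Suc i)" if "i < Suc n" for i using \<sigma>[of i] that by (simp add: ts_def)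
  have tspos: "0 \<le> ts i" if "i \<le> Suc n" for i
    using that by (induction i) (use ts0 tsS in \<open>auto simp: less_eq_Suc_le intro: order.trans less_imp_le\<close>)
  let ?P = "PiM {..<n} (\<lambda>_. borel :: real measure)"
  define Y where "Y \<omega> = restrict (\<lambda>i. inc i \<omega>) {..<n}" for \<omega>
  have ind: "indep_vars (\<lambda>_. borel) inc {..<Suc n}"
    unfolding inc_def using W_indep[of ts "Suc n"] ts0 tsS by auto
  \<comment> \<open>\<open>indep_var_restrict\<close> yields function-valued variables, so the
    single last increment is carried as a function on \<open>{n}\<close> and evaluated at
    \<open>n\<close> afterwards.\<close>
  let ?Q = "PiM {n} (\<lambda>_. borel :: real measure)"
  define D where "D \<omega> = restrict (\<lambda>i. inc i \<omega>) {n}" for \<omega>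
  have indY: "indep_var ?P Y ?Q D"
    unfolding Y_def D_def by (rule indep_var_restrict[OF ind]) auto
  have Ym[measurable]: "Y \<in> M \<rightarrow>\<^sub>M ?P" and Dm[measurable]: "D \<in> M \<rightarrow>\<^sub>M ?Q"
    using indep_var_rv1[OF indY] indep_var_rv2[OF indY] by auto
  have Dn: "D \<omega> n = inc n \<omega>" for \<omega> by (simp add: D_def)
  have nm[measurable]: "(\<lambda>e. e n) \<in> borel_measurable ?Q" by (rule measurable_component_singleton) simp
  have incm[measurable]: "inc n \<in> borel_measurable M"
    using measurable_compose[OF Dm nm] by (simp add: Dn)
  define s where "s = sqrt (ts (Suc n) - ts n)"
  have s: "s > 0" using tsS[of n] by (simp add: s_def)
  have dD: "distr M borel (inc n) = density lborel (normal_density 0 s)"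
    using W_increment[OF tspos[of n] tsS[of n]] unfolding distributed_def s_def inc_def
    by (simp cong: distr_cong)
  have J: "distr M (?P \<Otimes>\<^sub>M ?Q) (\<lambda>\<omega>. (Y \<omega>, D \<omega>)) = distr M ?P Y \<Otimes>\<^sub>M distr M ?Q D"
    using indY unfolding indep_var_distribution_eq by simp
  define c where "c = exp (- \<sigma> (Suc n) / 2)"
  define zz where "zz i d = exp (- \<sigma> i / 2) * (x + (\<Sum>j<i. d j))" for i and d :: "nat \<Rightarrow> real"
  have W_sum: "W (ts i) \<omega> = (\<Sum>j<i. inc j \<omega>)" if "\<omega> \<in> space M" for i \<omega>
    unfolding inc_def using sum_lessThan_telescope[of "\<lambda>j. W (ts j) \<omega>" i] ts0 W_0[OF that] by simp
  have Zi: "OUproc W x (\<sigma> i) \<omega> = zz i (Y \<omega>)" if "\<omega> \<in> space M" "i \<le> n" for i \<omega>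
    using W_sum[OF that(1), of i] that(2) unfolding OUproc_def zz_def ts_def Y_def by simp
  have c: "c = exp (- q / 2) * exp (- \<sigma> n / 2)"
    unfolding c_def q_def by (simp add: field_simps flip: exp_add)
  have ZS: "OUproc W x (\<sigma> (Suc n)) \<omega> = exp (- q / 2) * zz n (Y \<omega>) + c * inc n \<omega>" if "\<omega> \<in> space M" for \<omega>
  proof -
    have "W (ts (Suc n)) \<omega> = (\<Sum>j<n. Y \<omega> j) + inc n \<omega>"
      using W_sum[OF that, of "Suc n"] by (simp add: Y_def)
    then have "OUproc W x (\<sigma> (Suc n)) \<omega> = c * (x + ((\<Sum>j<n. Y \<omega> j) + inc n \<omega>))"
      by (simp add: OUproc_def c_def ts_def)
    then show ?thesis unfolding zz_def c by (simp add: algebra_simps)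
  qed
  have "c\<^sup>2 * s\<^sup>2 = 1 - exp (- q)"
  proof -
    have "s\<^sup>2 = exp (\<sigma> (Suc n)) - exp (\<sigma> n)" using tsS[of n] by (simp add: s_def ts_def)
    moreover have "c\<^sup>2 = exp (- \<sigma> (Suc n))" by (simp add: c_def flip: exp_double)
    ultimately show ?thesis by (simp add: right_diff_distrib q_def flip: exp_add)
  qed
  then have cs: "c * s = sqrt (1 - exp (- q))"
    using s by (metis c_def exp_ge_zero less_imp_le mult_nonneg_nonneg power_mult_distrib real_sqrt_unique)
  have cpos: "c > 0" by (simp add: c_def)
  have zm[measurable]: "zz i \<in> borel_measurable ?P" if "i \<le> n" for i
    unfolding zz_def using that by (intro borel_measurable_times borel_measurable_add borel_measurable_sum measurable_component_singleton) auto
  define H where "H d = (\<Prod>i\<le>n. \<phi> i (zz i d))" for d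
  have Hm[measurable]: "H \<in> borel_measurable ?P"
    unfolding H_def by (intro borel_measurable_prod) auto
  have "\<exists>C. \<forall>y. i \<le> n \<longrightarrow> \<bar>\<phi> i y\<bar> \<le> C" for i using \<phi>[of i] unfolding bounded_borel_def by blast
  then obtain C where C: "\<And>i y. i \<le> n \<Longrightarrow> \<bar>\<phi> i y\<bar> \<le> C i" by metis
  have Hb: "\<bar>H d\<bar> \<le> (\<Prod>i\<le>n. C i)" for d
    unfolding H_def abs_prod by (intro prod_mono) (use C in auto)
  obtain C' where C': "C' > 0" "\<And>y. \<bar>\<psi> y\<bar> \<le> C'" using \<psi> bounded_borelE by blast
  interpret Y: prob_space "distr M ?P Y" by (rule prob_space_distr) simp
  interpret I: prob_space "distr M ?Q D" by (rule prob_space_distr) simp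
  interpret YI: pair_prob_space "distr M ?P Y" "distr M ?Q D" ..
  define F where "F = (\<lambda>(d, e). H d * \<psi> (exp (- q / 2) * zz n d + c * e n))"
  have Fm: "F \<in> borel_measurable (?P \<Otimes>\<^sub>M ?Q)" unfolding F_def
    by measurable
  have "(\<integral>\<omega>. (\<Prod>i\<le>n. \<phi> i (OUproc W x (\<sigma> i) \<omega>)) * \<psi> (OUproc W x (\<sigma> (Suc n)) \<omega>) \<partial>M)
      = (\<integral>\<omega>. F (Y \<omega>, D \<omega>) \<partial>M)"
    by (intro Bochner_Integration.integral_cong) (auto simp: F_def H_def Zi ZS Dn)
  also have "\<dots> = integral\<^sup>L (distr M (?P \<Otimes>\<^sub>M ?Q) (\<lambda>\<omega>. (Y \<omega>, D \<omega>))) F"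
    using Fm by (subst integral_distr) auto
  also have "\<dots> = (\<integral>d. (\<integral>e. F (d, e) \<partial>distr M ?Q D) \<partial>distr M ?P Y)"
    unfolding J
  proof (rule YI.integral_fst'[symmetric], rule YI.P.integrable_const_bound[where B="(\<Prod>i\<le>n. C i) * C'"])
    show "AE p in distr M ?P Y \<Otimes>\<^sub>M distr M ?Q D. norm (F p) \<le> (\<Prod>i\<le>n. C i) * C'"
      by (rule AE_I2) (simp add: F_def abs_mult split_beta mult_mono' Hb C')
  qed (use Fm in \<open>simp cong: measurable_cong_sets\<close>)
  also have "\<dots> = (\<integral>d. H d * ou_op q \<psi> (zz n d) \<partial>distr M ?P Y)"
  proof (rule Bochner_Integration.integral_cong[OF refl])
    fix d
    have "(\<integral>e. F (d, e) \<partial>distr M ?Q D) = (\<integral>\<omega>. F (d, D \<omega>) \<partial>M)"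
      by (rule integral_distr) (auto simp: F_def)
    also have "\<dots> = (\<integral>w. H d * \<psi> (exp (- q / 2) * zz n d + c * w) \<partial>distr M borel (inc n))"
      by (subst integral_distr) (auto simp: F_def Dn)
    also have "\<dots> = H d * ou_op q \<psi> (zz n d)"
      unfolding dD
      by (subst integral_density) (use s in \<open>auto simp: ou_op_eq_std[OF q cpos s cs] mult.left_commute\<close>)
    finally show "(\<integral>e. F (d, e) \<partial>distr M ?Q D) = H d * ou_op q \<psi> (zz n d)" .
  qed
  also have "\<dots> = (\<integral>\<omega>. H (Y \<omega>) * ou_op q \<psi> (zz n (Y \<omega>)) \<partial>M)"
    by (rule integral_distr) auto
  also have "\<dots> = (\<integral>\<omega>. (\<Prod>i\<le>n. \<phi> i (OUproc W x (\<sigma> i) \<omega>)) * ou_op q \<psi> (OUproc W x (\<sigma> n) \<omega>) \<partial>M)"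
    by (intro Bochner_Integration.integral_cong) (auto simp: H_def Zi)
  finally show ?thesis unfolding q_def .
qed

end

section \<open>Killed semigroups as grid limits\<close>

text \<open>For closed \<open>B\<close>, \<open>r > 0\<close> and bounded Borel \<open>f\<close> the
  limit exists and is the expectation of \<open>f\<close> over paths that stay in \<open>B\<close>
  throughout (\<open>confined_sg_eq\<close>). \<open>Suc N\<close> keeps the mesh well defined for
  every \<open>N\<close>.\<close>

definition confined_sg :: "real set \<Rightarrow> real \<Rightarrow> (real \<Rightarrow> real) \<Rightarrow> real \<Rightarrow> real" where
  "confined_sg B r f x = lim (\<lambda>N. (killed_op B (r / real (Suc N)) ^^ Suc N) f x)"

text \<open>The offset 2 keeps the right end point in \<open>[1/2, 1)\<close>, so every interval is
  nondegenerate.\<close>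

definition inner_interval :: "nat \<Rightarrow> real set" where
  "inner_interval m = {- (1 - 1 / real (m + 2))..1 - 1 / real (m + 2)}"

text \<open>Defined through the grid kernels and not as an expectation, so that it is the same function for
  every Brownian motion.\<close>
definition killed_sg :: "real \<Rightarrow> (real \<Rightarrow> real) \<Rightarrow> real \<Rightarrow> real" where
  "killed_sg r f x = lim (\<lambda>m. confined_sg (inner_interval m) r f x)"

lemma closed_inner_interval: "closed (inner_interval m)"
  unfolding inner_interval_def by simp

lemma bounded_borel_indicator_mult:
  "B \<in> sets borel \<Longrightarrow> bounded_borel f \<Longrightarrow> bounded_borel (\<lambda>y. indicator B y * f y)"
  by (intro bounded_borel_intros)

lemma bounded_borel_killed_op:
  assumes "q > 0" "B \<in> sets borel" "bounded_borel f"
  shows "bounded_borel (killed_op B q f)"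
  unfolding killed_op_def using assms by (intro bounded_borel_ou_op bounded_borel_indicator_mult)

lemma killed_op_bound:
  assumes "q > 0" "B \<in> sets borel" "bounded_borel f" "\<And>y. \<bar>f y\<bar> \<le> C"
  shows "\<bar>killed_op B q f x\<bar> \<le> C"
proof -
  have C0: "C \<ge> 0" using assms(4)[of 0] by simp
  have b: "bounded_borel (\<lambda>y. indicator B y * f y)" using assms by (intro bounded_borel_indicator_mult)
  have C: "indicator B y * f y \<le> C" "- C \<le> indicator B y * f y" for y
    using assms(4)[of y] C0 by (auto simp: indicator_def abs_le_iff)
  show ?thesis
    using ou_op_mono[OF assms(1) b bounded_borel_const C(1), of x]
      ou_op_mono[OF assms(1) bounded_borel_const b C(2), of x] assms(1)
    by (simp add: killed_op_def abs_le_iff)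
qed

lemma bounded_borel_killed_op_funpow:
  assumes "q > 0" "B \<in> sets borel" "bounded_borel f"
  shows "bounded_borel ((killed_op B q ^^ k) f)"
  by (induction k) (auto intro: bounded_borel_killed_op assms)

lemma killed_op_funpow_bound:
  assumes "q > 0" "B \<in> sets borel" "bounded_borel f" "\<And>y. \<bar>f y\<bar> \<le> C"
  shows "\<bar>(killed_op B q ^^ k) f x\<bar> \<le> C"
  by (induction k arbitrary: x)
    (auto intro: killed_op_bound bounded_borel_killed_op_funpow assms)

text \<open>Rounding a time \<open>v\<close> up to the grid gives grid points converging to \<open>v\<close>, so an excursion of a
  continuous path out of a closed set is eventually seen on the grid.\<close>
lemma grid_indicator_tendsto:
  fixes p :: "real \<Rightarrow> real"
  assumes p: "continuous_on {c..c + r} p" and B: "closed B" and r: "r > 0"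
  shows "(\<lambda>N. \<Prod>i\<in>{0<..Suc N}. indicator B (p (c + real i * (r / real (Suc N)))) :: real)
    \<longlonglongrightarrow> of_bool (\<forall>v\<in>{c..c + r}. p v \<in> B)"
proof (cases "\<forall>v\<in>{c..c + r}. p v \<in> B")
  case True
  have "c + real i * (r / real (Suc N)) \<in> {c..c + r}" if "i \<in> {0<..Suc N}" for i N
    using that r by (simp add: pos_divide_le_eq del: of_nat_Suc)
  then show ?thesis using True by (simp add: indicator_def)
next
  case False
  then obtain v where v: "v \<in> {c..c + r}" "p v \<notin> B" by auto
  \<comment> \<open>\<open>max 1\<close> because the grid product starts at index 1: for
    \<open>v = c\<close> the tested point lies one mesh after \<open>c\<close>, and continuity still
    makes it converge.\<close>
  define j where "j N = max 1 (nat \<lceil>(v - c) * real (Suc N) / r\<rceil>)" for N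
  define w where "w N = c + real (j N) * (r / real (Suc N))" for N
  have jle: "j N \<le> Suc N" for N
  proof -
    have "(v - c) * real (Suc N) / r \<le> real (Suc N)"
      using v r by (simp add: divide_le_eq mult.commute[of _ r] mult_right_mono del: of_nat_Suc)
    then have "\<lceil>(v - c) * real (Suc N) / r\<rceil> \<le> int (Suc N)"
      by (simp add: ceiling_le_iff)
    then show ?thesis unfolding j_def by linarith
  qed
  have j1: "j N \<in> {0<..Suc N}" for N using jle[of N] by (auto simp: j_def)
  have win: "w N \<in> {c..c + r}" for N
    unfolding w_def using jle[of N] r
    by (auto simp: field_simps simp del: of_nat_Suc intro!: mult_right_mono)
  have wlow: "v \<le> w N" for N
  proof -
    have "(v - c) * real (Suc N) / r \<le> real (j N)"
      unfolding j_def by linarith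
    then show ?thesis unfolding w_def using r by (simp add: field_simps del: of_nat_Suc)
  qed
  have wup: "w N \<le> v + r / real (Suc N)" for N
  proof -
    have "0 \<le> (v - c) * real (Suc N) / r" using v r by simp
    then have "real (j N) \<le> (v - c) * real (Suc N) / r + 1"
      unfolding j_def by linarith
    then have "real (j N) * (r / real (Suc N)) \<le> ((v - c) * real (Suc N) / r + 1) * (r / real (Suc N))"
      using r by (intro mult_right_mono) auto
    also have "\<dots> = (v - c) + r / real (Suc N)" using r by (simp add: field_simps del: of_nat_Suc)
    finally show ?thesis unfolding w_def by simp
  qed
  have "(\<lambda>N. v + r / real (Suc N)) \<longlonglongrightarrow> v + 0"
    by (intro tendsto_add tendsto_const LIMSEQ_Suc lim_const_over_n)
  then have "w \<longlonglongrightarrow> v"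
    by (intro tendsto_sandwich[of "\<lambda>_. v" w _ "\<lambda>N. v + r / real (Suc N)"])
       (auto intro: always_eventually wlow wup simp del: of_nat_Suc)
  then have "(\<lambda>N. p (w N)) \<longlonglongrightarrow> p v"
    using continuous_on_tendsto_compose[OF p _ v(1)] win by (auto intro: always_eventually)
  then have "eventually (\<lambda>N. p (w N) \<in> - B) sequentially"
    using B v by (intro topological_tendstoD) auto
  then have "eventually (\<lambda>N. (\<Prod>i\<in>{0<..Suc N}. indicator B (p (c + real i * (r / real (Suc N)))) :: real) = 0) sequentially"
  proof eventually_elim
    case (elim N)
    then show ?case using j1[of N] by (intro prod_zero) (auto intro!: bexI[of _ "j N"] simp: w_def simp del: of_nat_Suc)
  qed
  then show ?thesis using False by (auto intro: tendsto_eventually)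
qed

text \<open>On a compact time interval \<open>|p|\<close> attains its maximum, so a path inside the
  open interval is already inside one of the closed intervals.\<close>

lemma inner_interval_tendsto:
  fixes p :: "real \<Rightarrow> real"
  assumes p: "continuous_on {c..d} p" and cd: "c \<le> d"
  shows "(\<lambda>m. of_bool (\<forall>v\<in>{c..d}. p v \<in> inner_interval m) :: real) \<longlonglongrightarrow> of_bool (\<forall>v\<in>{c..d}. \<bar>p v\<bar> < 1)"
proof (cases "\<forall>v\<in>{c..d}. \<bar>p v\<bar> < 1")
  case True
  have "continuous_on {c..d} (\<lambda>v. \<bar>p v\<bar>)" using p by (intro continuous_intros)
  then obtain z where z: "z \<in> {c..d}" "\<And>v. v \<in> {c..d} \<Longrightarrow> \<bar>p v\<bar> \<le> \<bar>p z\<bar>"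
    using continuous_attains_sup[of "{c..d}" "\<lambda>v. \<bar>p v\<bar>"] cd by auto
  have "(\<lambda>m. 1 / real (m + 2)) \<longlonglongrightarrow> 0"
    using LIMSEQ_ignore_initial_segment[OF lim_const_over_n[of "1::real"], of 2] by simp
  then have "eventually (\<lambda>m. 1 / real (m + 2) < 1 - \<bar>p z\<bar>) sequentially"
    using True z by (intro order_tendstoD(2)) auto
  then have "eventually (\<lambda>m. (of_bool (\<forall>v\<in>{c..d}. p v \<in> inner_interval m) :: real) = 1) sequentially"
  proof eventually_elim
    case (elim m)
    have "p v \<in> inner_interval m" if "v \<in> {c..d}" for v
      using z(2)[OF that] elim unfolding inner_interval_def by (auto simp: abs_le_iff)
    then show ?case by auto
  qed
  then show ?thesis using True by (auto intro: tendsto_eventually)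
next
  case False
  then obtain v where v: "v \<in> {c..d}" "\<bar>p v\<bar> \<ge> 1" by force
  have "p v \<notin> inner_interval m" for m
  proof
    assume "p v \<in> inner_interval m"
    then have "\<bar>p v\<bar> \<le> 1 - 1 / real (m + 2)" unfolding inner_interval_def by (auto simp: abs_le_iff)
    moreover have "1 / real (m + 2) > 0" by simp
    ultimately show False using v by linarith
  qed
  then have "(\<lambda>m. of_bool (\<forall>v\<in>{c..d}. p v \<in> inner_interval m) :: real) = (\<lambda>_. 0)"
    using v(1) by (auto simp: fun_eq_iff simp del: atLeastAtMost_iff)
  then show ?thesis using False by (simp only: of_bool_eq tendsto_const)
qed

section \<open>Path representation of the killed semigroup\<close>

context brownian
begin

abbreviation stays :: "real set \<Rightarrow> real \<Rightarrow> real \<Rightarrow> real \<Rightarrow> 'a \<Rightarrow> real" where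
  "stays B x c d \<omega> \<equiv> of_bool (\<forall>v\<in>{c..d}. OUproc W x v \<omega> \<in> B)"

abbreviation alive :: "real \<Rightarrow> real \<Rightarrow> real \<Rightarrow> 'a \<Rightarrow> real" where
  "alive x c d \<omega> \<equiv> of_bool (\<forall>v\<in>{c..d}. \<bar>OUproc W x v \<omega>\<bar> < 1)"

text \<open>Induction peels off the last step: its indicator and \<open>f\<close> merge into
  \<open>killed_op B q f\<close>, while the earlier indicators become weights on the past. Equal
  step length is demanded only of the last \<open>k\<close> steps, so that two grids of different
  mesh can later be joined.\<close>

lemma markov_steps:
  fixes \<sigma> :: "nat \<Rightarrow> real"
  assumes \<sigma>0: "\<sigma> 0 = 0" and \<sigma>: "\<And>i. i < N + k \<Longrightarrow> \<sigma> i < \<sigma> (Suc i)"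
    and q: "\<And>i. N \<le> i \<Longrightarrow> i < N + k \<Longrightarrow> \<sigma> (Suc i) - \<sigma> i = q"
    and \<phi>: "\<And>i. i \<le> N \<Longrightarrow> bounded_borel (\<phi> i)" and B: "B \<in> sets borel" and f: "bounded_borel f"
  shows "(\<integral>\<omega>. (\<Prod>i\<le>N. \<phi> i (OUproc W x (\<sigma> i) \<omega>)) *
        ((\<Prod>i\<in>{N<..N+k}. indicator B (OUproc W x (\<sigma> i) \<omega>)) * f (OUproc W x (\<sigma> (N + k)) \<omega>)) \<partial>M) =
    (\<integral>\<omega>. (\<Prod>i\<le>N. \<phi> i (OUproc W x (\<sigma> i) \<omega>)) * (killed_op B q ^^ k) f (OUproc W x (\<sigma> N) \<omega>) \<partial>M)"
  using \<sigma> q f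
proof (induction k arbitrary: f)
  case (Suc k)
  have q0: "q > 0" using Suc.prems(1)[of N] Suc.prems(2)[of N] by simp
  define \<phi>' where "\<phi>' i = (if i \<le> N then \<phi> i else indicator B)" for i
  have b\<phi>: "bounded_borel (\<phi>' i)" for i unfolding \<phi>'_def using \<phi> B by (auto intro: bounded_borel_indicator)
  have split: "(\<Prod>i\<le>N+k. \<phi>' i (z i)) = (\<Prod>i\<le>N. \<phi> i (z i)) * (\<Prod>i\<in>{N<..N+k}. indicator B (z i))" for z :: "nat \<Rightarrow> real"
  proof -
    have "{..N+k} = {..N} \<union> {N<..N+k}" by auto
    moreover have "(\<Prod>i\<in>{..N} \<union> {N<..N+k}. \<phi>' i (z i)) = (\<Prod>i\<in>{..N}. \<phi>' i (z i)) * (\<Prod>i\<in>{N<..N+k}. \<phi>' i (z i))"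
      by (rule prod.union_disjoint) auto
    ultimately show ?thesis by (simp add: \<phi>'_def)
  qed
  have last: "{N<..N + Suc k} = insert (N + Suc k) {N<..N+k}" by auto
  have "(\<integral>\<omega>. (\<Prod>i\<le>N. \<phi> i (OUproc W x (\<sigma> i) \<omega>)) *
        ((\<Prod>i\<in>{N<..N+Suc k}. indicator B (OUproc W x (\<sigma> i) \<omega>)) * f (OUproc W x (\<sigma> (N + Suc k)) \<omega>)) \<partial>M) =
     (\<integral>\<omega>. (\<Prod>i\<le>N+k. \<phi>' i (OUproc W x (\<sigma> i) \<omega>)) *
        (\<lambda>y. indicator B y * f y) (OUproc W x (\<sigma> (Suc (N + k))) \<omega>) \<partial>M)"
    unfolding split last by (simp add: mult_ac)
  also have "\<dots> = (\<integral>\<omega>. (\<Prod>i\<le>N+k. \<phi>' i (OUproc W x (\<sigma> i) \<omega>)) * killed_op B q f (OUproc W x (\<sigma> (N + k)) \<omega>) \<partial>M)"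
    by (subst markov_step)
       (use \<sigma>0 Suc.prems b\<phi> B in \<open>auto simp: killed_op_def intro: bounded_borel_indicator_mult\<close>)
  also have "\<dots> = (\<integral>\<omega>. (\<Prod>i\<le>N. \<phi> i (OUproc W x (\<sigma> i) \<omega>)) *
        ((\<Prod>i\<in>{N<..N+k}. indicator B (OUproc W x (\<sigma> i) \<omega>)) * killed_op B q f (OUproc W x (\<sigma> (N + k)) \<omega>)) \<partial>M)"
    unfolding split by (simp add: mult_ac)
  also have "\<dots> = (\<integral>\<omega>. (\<Prod>i\<le>N. \<phi> i (OUproc W x (\<sigma> i) \<omega>)) * (killed_op B q ^^ k) (killed_op B q f) (OUproc W x (\<sigma> N) \<omega>) \<partial>M)"
    using Suc.prems q0 B by (intro Suc.IH bounded_borel_killed_op) auto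
  finally show ?case by (simp add: funpow_swap1)
qed simp

lemma killed_op_funpow_eq:
  assumes q: "q > 0" and B: "B \<in> sets borel" and f: "bounded_borel f"
  shows "(killed_op B q ^^ k) f x =
    (\<integral>\<omega>. (\<Prod>i\<in>{0<..k}. indicator B (OUproc W x (real i * q) \<omega>)) * f (OUproc W x (real k * q) \<omega>) \<partial>M)"
proof -
  have "(\<integral>\<omega>. (\<Prod>i\<le>0. (\<lambda>_ _. 1) i (OUproc W x (real i * q) \<omega>)) *
        ((\<Prod>i\<in>{0<..0+k}. indicator B (OUproc W x (real i * q) \<omega>)) * f (OUproc W x (real (0 + k) * q) \<omega>)) \<partial>M) =
    (\<integral>\<omega>. (\<Prod>i\<le>0. (\<lambda>_ _. 1) i (OUproc W x (real i * q) \<omega>)) * (killed_op B q ^^ k) f (OUproc W x (real 0 * q) \<omega>) \<partial>M)"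
    by (rule markov_steps) (use assms in \<open>auto simp: algebra_simps\<close>)
  also have "\<dots> = (\<integral>\<omega>. (killed_op B q ^^ k) f x \<partial>M)"
    by (intro Bochner_Integration.integral_cong) (auto simp: OU_0)
  finally show ?thesis by (simp add: prob_space)
qed

lemma OU_continuous_on:
  assumes "\<omega> \<in> space M" "0 \<le> c" shows "continuous_on {c..d} (\<lambda>v. OUproc W x v \<omega>)"
  using continuous_on_subset[OF OU_continuous[OF assms(1)]] assms(2) by auto

lemma grid_OU_tendsto:
  assumes "closed B" "r > 0" "\<omega> \<in> space M" "c \<ge> 0"
  shows "(\<lambda>N. \<Prod>i\<in>{0<..Suc N}. indicator B (OUproc W x (c + real i * (r / real (Suc N))) \<omega>) :: real)
    \<longlonglongrightarrow> stays B x c (c + r) \<omega>"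
  using assms by (intro grid_indicator_tendsto OU_continuous_on)

text \<open>The event involves uncountably many times; it is measurable as the pointwise limit of
  grid products.\<close>

lemma confined_measurable[measurable]:
  assumes "closed B" "r > 0" "c \<ge> 0"
  shows "(\<lambda>\<omega>. stays B x c (c + r) \<omega> :: real) \<in> borel_measurable M"
proof (rule borel_measurable_LIMSEQ_real[OF grid_OU_tendsto[OF assms(1,2) _ assms(3)]])
  fix N
  have [measurable]: "B \<in> sets borel" using assms by auto
  show "(\<lambda>\<omega>. \<Prod>i\<in>{0<..Suc N}. indicator B (OUproc W x (c + real i * (r / real (Suc N))) \<omega>) :: real) \<in> borel_measurable M"
    using assms by (intro borel_measurable_prod borel_measurable_indicator' OU_measurable) (auto simp del: of_nat_Suc intro!: measurable_compose[OF OU_measurable])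
qed

lemma unkilled_measurable[measurable]:
  assumes "r > 0" "c \<ge> 0"
  shows "(\<lambda>\<omega>. alive x c (c + r) \<omega> :: real) \<in> borel_measurable M"
  by (rule borel_measurable_LIMSEQ_real[OF inner_interval_tendsto])
     (use assms in \<open>auto intro: OU_continuous_on confined_measurable closed_inner_interval\<close>)

lemma prod_indicator_bounds:
  "0 \<le> (\<Prod>i\<in>A. indicator B (g i) :: real)" "(\<Prod>i\<in>A. indicator B (g i) :: real) \<le> 1"
  by (auto intro!: prod_nonneg prod_le_1)

lemma OU_measurable_comp:
  assumes "r \<ge> 0" "bounded_borel f" shows "(\<lambda>\<omega>. f (OUproc W x r \<omega>)) \<in> borel_measurable M"
  using measurable_compose[OF OU_measurable[OF assms(1)] bounded_borel_measurable[OF assms(2)]] .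

lemma confined_funpow_tendsto:
  assumes B: "closed B" and r: "r > 0" and f: "bounded_borel f"
  shows "(\<lambda>N. (killed_op B (r / real (Suc N)) ^^ Suc N) f x)
    \<longlonglongrightarrow> (\<integral>\<omega>. stays B x 0 r \<omega> * f (OUproc W x r \<omega>) \<partial>M)"
proof -
  have Bs: "B \<in> sets borel" using B by auto
  obtain C where C: "C > 0" "\<And>x. \<bar>f x\<bar> \<le> C" using f bounded_borelE by blast
  have eq: "(killed_op B (r / real (Suc N)) ^^ Suc N) f x =
      (\<integral>\<omega>. (\<Prod>i\<in>{0<..Suc N}. indicator B (OUproc W x (real i * (r / real (Suc N))) \<omega>)) * f (OUproc W x r \<omega>) \<partial>M)" for N
    using killed_op_funpow_eq[OF _ Bs f, of "r / real (Suc N)" "Suc N" x] r by (simp del: of_nat_Suc prod.cl_ivl_Suc)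
  have [measurable]: "(\<lambda>\<omega>. f (OUproc W x r \<omega>)) \<in> borel_measurable M" using r f by (intro OU_measurable_comp) auto
  show ?thesis unfolding eq
  proof (rule integral_dominated_convergence[where w="\<lambda>_. C"])
    show "AE \<omega> in M. (\<lambda>N. (\<Prod>i\<in>{0<..Suc N}. indicator B (OUproc W x (real i * (r / real (Suc N))) \<omega>)) * f (OUproc W x r \<omega>))
        \<longlonglongrightarrow> stays B x 0 r \<omega> * f (OUproc W x r \<omega>)"
      using grid_OU_tendsto[OF B r, of _ 0] by (intro AE_I2 tendsto_mult) auto
    show "AE \<omega> in M. norm ((\<Prod>i\<in>{0<..Suc N}. indicator B (OUproc W x (real i * (r / real (Suc N))) \<omega>)) * f (OUproc W x r \<omega>)) \<le> C" for N
      using mult_mono[OF prod_indicator_bounds(2) C(2)] 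
      by (intro AE_I2) (simp add: abs_mult prod_indicator_bounds(1) del: prod.cl_ivl_Suc)
    show "(\<lambda>\<omega>. stays B x 0 r \<omega> * f (OUproc W x r \<omega>)) \<in> borel_measurable M"
      using confined_measurable[OF B r, of 0 x] by simp
    show "(\<lambda>\<omega>. (\<Prod>i\<in>{0<..Suc N}. indicator B (OUproc W x (real i * (r / real (Suc N))) \<omega>)) * f (OUproc W x r \<omega>)) \<in> borel_measurable M" for N
      using r Bs by (intro borel_measurable_times borel_measurable_prod measurable_compose[OF OU_measurable borel_measurable_indicator]) auto
  qed simp
qed

lemma confined_sg_eq:
  assumes "closed B" "r > 0" "bounded_borel f"
  shows "confined_sg B r f x = (\<integral>\<omega>. stays B x 0 r \<omega> * f (OUproc W x r \<omega>) \<partial>M)"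
  unfolding confined_sg_def by (rule limI[OF confined_funpow_tendsto[OF assms]])

lemma confined_sg_tendsto:
  assumes "closed B" "r > 0" "bounded_borel f"
  shows "(\<lambda>N. (killed_op B (r / real (Suc N)) ^^ Suc N) f x) \<longlonglongrightarrow> confined_sg B r f x"
  using confined_funpow_tendsto[OF assms] confined_sg_eq[OF assms] by simp

lemma confined_sg_bound:
  assumes "closed B" "r > 0" "bounded_borel f" "\<And>y. \<bar>f y\<bar> \<le> C"
  shows "\<bar>confined_sg B r f x\<bar> \<le> C"
  by (rule LIMSEQ_le_const2[OF tendsto_rabs[OF confined_sg_tendsto[OF assms(1-3)]]])
     (use assms in \<open>auto intro!: exI[of _ 0] killed_op_funpow_bound simp del: funpow.simps\<close>)

lemma bounded_borel_confined_sg: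
  assumes "closed B" "r > 0" "bounded_borel f"
  shows "bounded_borel (confined_sg B r f)"
proof -
  obtain C where C: "C > 0" "\<And>x. \<bar>f x\<bar> \<le> C" using assms bounded_borelE by blast
  have "confined_sg B r f \<in> borel_measurable borel"
    by (rule borel_measurable_LIMSEQ_real[OF confined_sg_tendsto[OF assms]])
       (use assms in \<open>auto intro!: bounded_borel_measurable bounded_borel_killed_op_funpow simp del: funpow.simps\<close>)
  then show ?thesis by (rule bounded_borelI) (rule confined_sg_bound[OF assms C(2)])
qed

lemma killed_int_tendsto:
  assumes r: "r > 0" and f: "bounded_borel f"
  shows "(\<lambda>m. confined_sg (inner_interval m) r f x)
    \<longlonglongrightarrow> (\<integral>\<omega>. alive x 0 r \<omega> * f (OUproc W x r \<omega>) \<partial>M)"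
proof -
  obtain C where C: "C > 0" "\<And>x. \<bar>f x\<bar> \<le> C" using f bounded_borelE by blast
  have [measurable]: "(\<lambda>\<omega>. f (OUproc W x r \<omega>)) \<in> borel_measurable M" using r f by (intro OU_measurable_comp) auto
  show ?thesis unfolding confined_sg_eq[OF closed_inner_interval r f]
  proof (rule integral_dominated_convergence[where w="\<lambda>_. C"])
    show "AE \<omega> in M. (\<lambda>m. stays (inner_interval m) x 0 r \<omega> * f (OUproc W x r \<omega>))
        \<longlonglongrightarrow> alive x 0 r \<omega> * f (OUproc W x r \<omega>)"
      using r by (intro AE_I2 tendsto_mult inner_interval_tendsto OU_continuous_on tendsto_const) auto
    show "AE \<omega> in M. norm (stays (inner_interval m) x 0 r \<omega> * f (OUproc W x r \<omega>)) \<le> C" for m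
      using C by (intro AE_I2) (auto intro: less_imp_le)
    show "(\<lambda>\<omega>. alive x 0 r \<omega> * f (OUproc W x r \<omega>)) \<in> borel_measurable M"
      using unkilled_measurable[OF r, of 0 x] by simp
    show "(\<lambda>\<omega>. stays (inner_interval m) x 0 r \<omega> * f (OUproc W x r \<omega>)) \<in> borel_measurable M" for m
      using confined_measurable[OF closed_inner_interval r, of 0 x m] by simp
  qed simp
qed

lemma killed_sg_eq:
  assumes "r > 0" "bounded_borel f"
  shows "killed_sg r f x = (\<integral>\<omega>. alive x 0 r \<omega> * f (OUproc W x r \<omega>) \<partial>M)"
  unfolding killed_sg_def by (rule limI[OF killed_int_tendsto[OF assms]])

lemma killed_sg_tendsto:
  assumes "r > 0" "bounded_borel f"
  shows "(\<lambda>m. confined_sg (inner_interval m) r f x) \<longlonglongrightarrow> killed_sg r f x"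
  using killed_int_tendsto[OF assms] killed_sg_eq[OF assms] by simp

lemma killed_sg_bound:
  assumes "r > 0" "bounded_borel f" "\<And>y. \<bar>f y\<bar> \<le> C"
  shows "\<bar>killed_sg r f x\<bar> \<le> C"
  by (rule LIMSEQ_le_const2[OF tendsto_rabs[OF killed_sg_tendsto[OF assms(1,2)]]])
     (use assms in \<open>auto intro!: exI[of _ 0] confined_sg_bound closed_inner_interval\<close>)

lemma bounded_borel_killed_sg:
  assumes "r > 0" "bounded_borel f"
  shows "bounded_borel (killed_sg r f)"
proof -
  obtain C where C: "C > 0" "\<And>x. \<bar>f x\<bar> \<le> C" using assms bounded_borelE by blast
  have "killed_sg r f \<in> borel_measurable borel"
    by (rule borel_measurable_LIMSEQ_real[OF killed_sg_tendsto[OF assms]])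
       (use assms in \<open>auto intro!: bounded_borel_measurable bounded_borel_confined_sg closed_inner_interval\<close>)
  then show ?thesis by (rule bounded_borelI) (rule killed_sg_bound[OF assms C(2)])
qed


text \<open>The intervals \<open>[0, r]\<close> and \<open>[r, r + q]\<close> get separate grids
  with the same number of steps, placed one after the other. At fixed \<open>N\<close> the second
  grid collapses by \<open>markov_steps\<close>; dominated convergence on both sides and uniqueness
  of limits give the identity.\<close>

lemma confined_markov:
  assumes B: "closed B" and r: "r > 0" and q: "q > 0" and f1: "bounded_borel f1" and f2: "bounded_borel f2"
  shows "(\<integral>\<omega>. (stays B x 0 r \<omega> * f1 (OUproc W x r \<omega>)) *
      (stays B x r (r+q) \<omega> * f2 (OUproc W x (r + q) \<omega>)) \<partial>M) =
    (\<integral>\<omega>. (stays B x 0 r \<omega> * f1 (OUproc W x r \<omega>)) *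
      confined_sg B q f2 (OUproc W x r \<omega>) \<partial>M)" (is "?L = ?R")
proof -
  have Bs[measurable]: "B \<in> sets borel" using B by auto
  define P where "P N \<omega> = (\<Prod>i\<in>{0<..Suc N}. indicator B (OUproc W x (real i * (r / real (Suc N))) \<omega>) :: real)" for N \<omega>
  define Q where "Q N \<omega> = (\<Prod>i\<in>{0<..Suc N}. indicator B (OUproc W x (r + real i * (q / real (Suc N))) \<omega>) :: real)" for N \<omega>
  have eq: "(\<integral>\<omega>. (P N \<omega> * f1 (OUproc W x r \<omega>)) * (Q N \<omega> * f2 (OUproc W x (r + q) \<omega>)) \<partial>M) =
      (\<integral>\<omega>. (P N \<omega> * f1 (OUproc W x r \<omega>)) * (killed_op B (q / real (Suc N)) ^^ Suc N) f2 (OUproc W x r \<omega>) \<partial>M)" for N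
  proof -
    define \<sigma> where "\<sigma> i = (if i \<le> Suc N then real i * (r / real (Suc N)) else r + real (i - Suc N) * (q / real (Suc N)))" for i
    \<comment> \<open>Weight 1 at index 0, which the grid product skips. At index
      \<open>Suc N\<close>, that is at time \<open>r\<close>, the test function \<open>f1\<close>
      joins the indicator.\<close>
    define \<phi> where "\<phi> i = (if i = 0 then (\<lambda>_. 1) else if i = Suc N then (\<lambda>y. indicator B y * f1 y) else indicator B)" for i :: nat
    have step: "\<sigma> (Suc i) - \<sigma> i = (if i < Suc N then r / real (Suc N) else q / real (Suc N))" for i
    proof (cases "i < Suc N")
      case True
      have "real (Suc i) * a - real i * a = a" for a :: real by (simp add: algebra_simps)
      then show ?thesis using True unfolding \<sigma>_def by (simp del: of_nat_Suc times_divide_eq_right)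
    next
      case False
      then have "\<sigma> i = r + real (i - Suc N) * (q / real (Suc N))"
        unfolding \<sigma>_def by (cases "i = Suc N") auto
      moreover have "real (Suc i - Suc N) = real (i - Suc N) + 1" using False by simp
      moreover have "\<sigma> (Suc i) = r + real (Suc i - Suc N) * (q / real (Suc N))"
        unfolding \<sigma>_def using False by (simp del: of_nat_Suc)
      ultimately have "\<sigma> (Suc i) - \<sigma> i = q / real (Suc N)"
        by (simp only: distrib_right)
      then show ?thesis using False by (simp only: if_False)
    qed
    have \<sigma>r: "\<sigma> (Suc N) = r" unfolding \<sigma>_def by simp
    have \<sigma>rq: "\<sigma> (Suc N + Suc N) = r + q" unfolding \<sigma>_def by simp
    have P: "(\<Prod>i\<le>Suc N. \<phi> i (OUproc W x (\<sigma> i) \<omega>)) = P N \<omega> * f1 (OUproc W x r \<omega>)" for \<omega>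
    proof -
      have 1: "{..Suc N} = insert 0 (insert (Suc N) {0<..N})" and 2: "{0<..Suc N} = insert (Suc N) {0<..N}" by auto
      have "(\<Prod>i\<in>{0<..N}. \<phi> i (OUproc W x (\<sigma> i) \<omega>)) =
          (\<Prod>i\<in>{0<..N}. indicator B (OUproc W x (real i * (r / real (Suc N))) \<omega>))"
        by (rule prod.cong) (auto simp: \<phi>_def \<sigma>_def)
      then show ?thesis unfolding P_def 1 2 using \<sigma>r by (simp add: \<phi>_def mult_ac)
    qed
    have Q: "(\<Prod>i\<in>{Suc N<..Suc N + Suc N}. indicator B (OUproc W x (\<sigma> i) \<omega>)) = Q N \<omega>" for \<omega>
      unfolding Q_def
      by (rule prod.reindex_bij_witness[of _ "\<lambda>j. j + Suc N" "\<lambda>i. i - Suc N"]) (auto simp: \<sigma>_def)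
    have "(\<integral>\<omega>. (\<Prod>i\<le>Suc N. \<phi> i (OUproc W x (\<sigma> i) \<omega>)) *
        ((\<Prod>i\<in>{Suc N<..Suc N + Suc N}. indicator B (OUproc W x (\<sigma> i) \<omega>)) * f2 (OUproc W x (\<sigma> (Suc N + Suc N)) \<omega>)) \<partial>M) =
      (\<integral>\<omega>. (\<Prod>i\<le>Suc N. \<phi> i (OUproc W x (\<sigma> i) \<omega>)) * (killed_op B (q / real (Suc N)) ^^ Suc N) f2 (OUproc W x (\<sigma> (Suc N)) \<omega>) \<partial>M)"
    proof (rule markov_steps)
      show "\<sigma> 0 = 0" by (simp add: \<sigma>_def)
      show "\<sigma> i < \<sigma> (Suc i)" for i
        using step[of i] r q by (smt (verit) divide_pos_pos of_nat_0_less_iff zero_less_Suc)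
      show "\<sigma> (Suc i) - \<sigma> i = q / real (Suc N)" if "Suc N \<le> i" for i
        using step[of i] that by auto
      show "bounded_borel (\<phi> i)" for i
        unfolding \<phi>_def using f1 by (auto intro: bounded_borel_indicator bounded_borel_indicator_mult)
    qed (use f2 in auto)
    then show ?thesis unfolding P Q \<sigma>r \<sigma>rq .
  qed
  obtain C where C: "C > 0" "\<And>x. \<bar>f1 x\<bar> \<le> C" using f1 bounded_borelE by blast
  obtain D where D: "D > 0" "\<And>x. \<bar>f2 x\<bar> \<le> D" using f2 bounded_borelE by blast
  have Pb: "\<bar>P N \<omega>\<bar> \<le> 1" and Qb: "\<bar>Q N \<omega>\<bar> \<le> 1" for N \<omega>
    unfolding P_def Q_def by (simp_all only: abs_of_nonneg prod_indicator_bounds)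
  have Pm[measurable]: "P N \<in> borel_measurable M" and Qm[measurable]: "Q N \<in> borel_measurable M" for N
    unfolding P_def Q_def using r q
    by (auto intro!: borel_measurable_prod measurable_compose[OF OU_measurable borel_measurable_indicator] simp del: prod.cl_ivl_Suc)
  have f1m[measurable]: "(\<lambda>\<omega>. f1 (OUproc W x r \<omega>)) \<in> borel_measurable M"
    and f2m[measurable]: "(\<lambda>\<omega>. f2 (OUproc W x (r + q) \<omega>)) \<in> borel_measurable M"
    using r q f1 f2 by (auto intro: OU_measurable_comp)
  have km[measurable]: "(\<lambda>\<omega>. (killed_op B (q / real (Suc N)) ^^ Suc N) f2 (OUproc W x r \<omega>)) \<in> borel_measurable M" for N
    using r q f2 Bs by (intro OU_measurable_comp bounded_borel_killed_op_funpow) auto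
  have cm[measurable]: "(\<lambda>\<omega>. confined_sg B q f2 (OUproc W x r \<omega>)) \<in> borel_measurable M"
    using r q f2 B by (intro OU_measurable_comp bounded_borel_confined_sg) auto
  have sm[measurable]: "(\<lambda>\<omega>. stays B x 0 r \<omega> :: real) \<in> borel_measurable M"
    using confined_measurable[OF B r, of 0 x] by simp
  have sm'[measurable]: "(\<lambda>\<omega>. stays B x r (r+q) \<omega> :: real) \<in> borel_measurable M"
    using confined_measurable[OF B q, of r x] r by simp
  have "(\<lambda>N. \<integral>\<omega>. (P N \<omega> * f1 (OUproc W x r \<omega>)) * (Q N \<omega> * f2 (OUproc W x (r + q) \<omega>)) \<partial>M) \<longlonglongrightarrow> ?L"
  proof (rule integral_dominated_convergence[where w="\<lambda>_. (1 * C) * (1 * D)"])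
    show "AE \<omega> in M. (\<lambda>N. (P N \<omega> * f1 (OUproc W x r \<omega>)) * (Q N \<omega> * f2 (OUproc W x (r + q) \<omega>))) \<longlonglongrightarrow>
      (stays B x 0 r \<omega> * f1 (OUproc W x r \<omega>)) *
      (stays B x r (r+q) \<omega> * f2 (OUproc W x (r + q) \<omega>))"
      unfolding P_def Q_def
      using grid_OU_tendsto[OF B r, of _ 0 x] grid_OU_tendsto[OF B q, of _ r x] r
      by (intro AE_I2 tendsto_mult tendsto_const) auto
    show "AE \<omega> in M. norm ((P N \<omega> * f1 (OUproc W x r \<omega>)) * (Q N \<omega> * f2 (OUproc W x (r + q) \<omega>))) \<le> (1 * C) * (1 * D)" for N
      unfolding real_norm_def abs_mult
      by (intro AE_I2 mult_mono' Pb Qb C D mult_nonneg_nonneg) auto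
  qed (auto intro!: borel_measurable_times Pm Qm f1m f2m sm sm')
  moreover have "(\<lambda>N. \<integral>\<omega>. (P N \<omega> * f1 (OUproc W x r \<omega>)) * (killed_op B (q / real (Suc N)) ^^ Suc N) f2 (OUproc W x r \<omega>) \<partial>M) \<longlonglongrightarrow> ?R"
  proof (rule integral_dominated_convergence[where w="\<lambda>_. (1 * C) * D"])
    show "AE \<omega> in M. (\<lambda>N. (P N \<omega> * f1 (OUproc W x r \<omega>)) * (killed_op B (q / real (Suc N)) ^^ Suc N) f2 (OUproc W x r \<omega>)) \<longlonglongrightarrow>
      (stays B x 0 r \<omega> * f1 (OUproc W x r \<omega>)) * confined_sg B q f2 (OUproc W x r \<omega>)"
      unfolding P_def
      using grid_OU_tendsto[OF B r, of _ 0 x]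
      by (intro AE_I2 tendsto_mult tendsto_const confined_sg_tendsto B q f2) auto
    show "AE \<omega> in M. norm ((P N \<omega> * f1 (OUproc W x r \<omega>)) * (killed_op B (q / real (Suc N)) ^^ Suc N) f2 (OUproc W x r \<omega>)) \<le> (1 * C) * D" for N
      unfolding real_norm_def abs_mult
      by (intro AE_I2 mult_mono' Pb C killed_op_funpow_bound D(2) mult_nonneg_nonneg f2 Bs) (use q in auto)
  qed (auto intro!: borel_measurable_times Pm km f1m sm cm simp del: funpow.simps of_nat_Suc)
  ultimately show ?thesis unfolding eq by (rule LIMSEQ_unique)
qed

text \<open>The intermediate weight \<open>f1\<close> serves the occupation probabilities: it
  records the position at time \<open>r\<close> on paths that must survive until
  \<open>r + q\<close>. With \<open>f1 = 1\<close> the same identity is the semigroup law.\<close>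

lemma killed_markov:
  assumes r: "r > 0" and q: "q > 0" and f1: "bounded_borel f1" and f2: "bounded_borel f2"
  shows "(\<integral>\<omega>. alive x 0 (r+q) \<omega> * (f1 (OUproc W x r \<omega>) * f2 (OUproc W x (r + q) \<omega>)) \<partial>M) =
    killed_sg r (\<lambda>y. f1 y * killed_sg q f2 y) x"
proof -
  obtain C where C: "C > 0" "\<And>x. \<bar>f1 x\<bar> \<le> C" using f1 bounded_borelE by blast
  obtain D where D: "D > 0" "\<And>x. \<bar>f2 x\<bar> \<le> D" using f2 bounded_borelE by blast
  have f1m[measurable]: "(\<lambda>\<omega>. f1 (OUproc W x r \<omega>)) \<in> borel_measurable M"
    and f2m[measurable]: "(\<lambda>\<omega>. f2 (OUproc W x (r + q) \<omega>)) \<in> borel_measurable M"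
    using r q f1 f2 by (auto intro: OU_measurable_comp)
  have cm[measurable]: "(\<lambda>\<omega>. confined_sg (inner_interval m) q f2 (OUproc W x r \<omega>)) \<in> borel_measurable M" for m
    using r q f2 by (intro OU_measurable_comp bounded_borel_confined_sg closed_inner_interval) auto
  have km[measurable]: "(\<lambda>\<omega>. killed_sg q f2 (OUproc W x r \<omega>)) \<in> borel_measurable M"
    using r q f2 by (intro OU_measurable_comp bounded_borel_killed_sg) auto
  have sm[measurable]: "(\<lambda>\<omega>. stays (inner_interval m) x 0 s \<omega> :: real) \<in> borel_measurable M"
    if "s > 0" for s m using confined_measurable[OF closed_inner_interval that, of 0 x] by simp
  have um[measurable]: "(\<lambda>\<omega>. alive x 0 s \<omega> :: real) \<in> borel_measurable M"
    if "s > 0" for s using unkilled_measurable[OF that, of 0 x] by simp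
  have split: "(of_bool (\<forall>v\<in>{0..r+q}. p v \<in> B) :: real) = of_bool (\<forall>v\<in>{0..r}. p v \<in> B) * of_bool (\<forall>v\<in>{r..r+q}. p v \<in> B)"
    for p :: "real \<Rightarrow> real" and B
  proof -
    have "{0..r+q} = {0..r} \<union> {r..r+q}" using r q by auto
    then show ?thesis by (simp add: ball_Un)
  qed
  have eq: "(\<integral>\<omega>. stays (inner_interval m) x 0 (r+q) \<omega> * (f1 (OUproc W x r \<omega>) * f2 (OUproc W x (r + q) \<omega>)) \<partial>M)
    = (\<integral>\<omega>. stays (inner_interval m) x 0 r \<omega> * (f1 (OUproc W x r \<omega>) *
      confined_sg (inner_interval m) q f2 (OUproc W x r \<omega>)) \<partial>M)" for m
    unfolding split using confined_markov[OF closed_inner_interval[of m] r q f1 f2, of x] by (simp only: mult_ac)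
  have "(\<lambda>m. \<integral>\<omega>. stays (inner_interval m) x 0 (r+q) \<omega> * (f1 (OUproc W x r \<omega>) * f2 (OUproc W x (r + q) \<omega>)) \<partial>M)
    \<longlonglongrightarrow> (\<integral>\<omega>. alive x 0 (r+q) \<omega> * (f1 (OUproc W x r \<omega>) * f2 (OUproc W x (r + q) \<omega>)) \<partial>M)"
  proof (rule integral_dominated_convergence[where w="\<lambda>_. 1 * (C * D)"])
    show "AE \<omega> in M. (\<lambda>m. stays (inner_interval m) x 0 (r+q) \<omega> * (f1 (OUproc W x r \<omega>) * f2 (OUproc W x (r + q) \<omega>)))
      \<longlonglongrightarrow> alive x 0 (r+q) \<omega> * (f1 (OUproc W x r \<omega>) * f2 (OUproc W x (r + q) \<omega>))"
      using r q by (intro AE_I2 tendsto_mult inner_interval_tendsto OU_continuous_on tendsto_const) auto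
    show "AE \<omega> in M. norm (stays (inner_interval m) x 0 (r+q) \<omega> * (f1 (OUproc W x r \<omega>) * f2 (OUproc W x (r + q) \<omega>))) \<le> 1 * (C * D)" for m
      unfolding real_norm_def abs_mult
      by (intro AE_I2 mult_mono' C D mult_nonneg_nonneg) auto
  qed (use r q in \<open>auto intro!: borel_measurable_times f1m f2m sm um\<close>)
  moreover have "(\<lambda>m. \<integral>\<omega>. stays (inner_interval m) x 0 r \<omega> * (f1 (OUproc W x r \<omega>) *
      confined_sg (inner_interval m) q f2 (OUproc W x r \<omega>)) \<partial>M)
    \<longlonglongrightarrow> (\<integral>\<omega>. alive x 0 r \<omega> * (f1 (OUproc W x r \<omega>) * killed_sg q f2 (OUproc W x r \<omega>)) \<partial>M)"
  proof (rule integral_dominated_convergence[where w="\<lambda>_. 1 * (C * D)"])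
    show "AE \<omega> in M. (\<lambda>m. stays (inner_interval m) x 0 r \<omega> * (f1 (OUproc W x r \<omega>) *
      confined_sg (inner_interval m) q f2 (OUproc W x r \<omega>)))
      \<longlonglongrightarrow> alive x 0 r \<omega> * (f1 (OUproc W x r \<omega>) * killed_sg q f2 (OUproc W x r \<omega>))"
      using r q by (intro AE_I2 tendsto_mult inner_interval_tendsto OU_continuous_on tendsto_const killed_sg_tendsto f2) auto
    show "AE \<omega> in M. norm (stays (inner_interval m) x 0 r \<omega> * (f1 (OUproc W x r \<omega>) *
      confined_sg (inner_interval m) q f2 (OUproc W x r \<omega>))) \<le> 1 * (C * D)" for m
      unfolding real_norm_def abs_mult
      by (intro AE_I2 mult_mono' C confined_sg_bound D(2) closed_inner_interval mult_nonneg_nonneg f2 q) auto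
  qed (use r q in \<open>auto intro!: borel_measurable_times f1m cm km sm um\<close>)
  ultimately have "(\<integral>\<omega>. alive x 0 (r+q) \<omega> * (f1 (OUproc W x r \<omega>) * f2 (OUproc W x (r + q) \<omega>)) \<partial>M)
    = (\<integral>\<omega>. alive x 0 r \<omega> * (f1 (OUproc W x r \<omega>) * killed_sg q f2 (OUproc W x r \<omega>)) \<partial>M)"
    unfolding eq by (rule LIMSEQ_unique)
  then show ?thesis
    using killed_sg_eq[OF r bounded_borel_mult[OF f1 bounded_borel_killed_sg[OF q f2]], of x] by simp
qed

lemma killed_sg_add:
  assumes "r > 0" "q > 0" "bounded_borel f"
  shows "killed_sg (r + q) f x = killed_sg r (killed_sg q f) x"
  using killed_markov[OF assms(1,2) bounded_borel_const[of 1] assms(3), of x]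
    killed_sg_eq[of "r + q" f x] assms by simp

end

section \<open>The principal eigenfunction\<close>

definition bump :: "real \<Rightarrow> real" where
  "bump x = (if \<bar>x\<bar> < 1 then 1 - x\<^sup>2 else 0)"

lemma bump_nonneg: "0 \<le> bump x"
  unfolding bump_def by (simp add: abs_square_le_1)

lemma bump_pos: "\<bar>x\<bar> < 1 \<Longrightarrow> 0 < bump x"
  unfolding bump_def by (simp add: abs_square_less_1)

lemma bump_le_1: "bump x \<le> 1"
  unfolding bump_def by simp

lemma borel_measurable_bump[measurable]: "bump \<in> borel_measurable borel"
  unfolding bump_def by measurable

lemma bounded_borel_bump: "bounded_borel bump"
  by (rule bounded_borelI[where C=1]) (auto simp: bump_nonneg bump_le_1)

section \<open>Iteration of one-step inequalities\<close>

lemma killed_op_mono: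
  assumes "q > 0" "B \<in> sets borel" "bounded_borel f" "bounded_borel g" "\<And>y. y \<in> B \<Longrightarrow> f y \<le> g y"
  shows "killed_op B q f x \<le> killed_op B q g x"
  unfolding killed_op_def using assms
  by (intro ou_op_mono bounded_borel_indicator_mult) (auto simp: indicator_def)

lemma killed_op_affine:
  assumes "q > 0" "B \<in> sets borel" "bounded_borel f" "bounded_borel g"
  shows "killed_op B q (\<lambda>y. c * f y + d * g y) x = c * killed_op B q f x + d * killed_op B q g x"
proof -
  have "killed_op B q (\<lambda>y. c * f y + d * g y) x =
      ou_op q (\<lambda>y. c * (indicator B y * f y) + d * (indicator B y * g y)) x"
    unfolding killed_op_def by (simp add: algebra_simps)
  also have "\<dots> = ou_op q (\<lambda>y. c * (indicator B y * f y)) x + ou_op q (\<lambda>y. d * (indicator B y * g y)) x"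
    using assms by (intro ou_op_add bounded_borel_mult bounded_borel_const bounded_borel_indicator)
  finally show ?thesis unfolding killed_op_def ou_op_cmult .
qed

lemma killed_op_1_le:
  assumes "q > 0" "B \<in> sets borel"
  shows "killed_op B q (\<lambda>_. 1) x \<le> 1"
  using killed_op_bound[OF assms bounded_borel_const[of 1], of 1 x] by simp

text \<open>A defect \<open>e\<close> in the one-step inequality costs at most \<open>e\<close> per
  step, because the later steps are sub-Markov and \<open>a \<le> 1\<close>. For mesh
  \<open>r / N\<close>, factor \<open>exp (- r / N)\<close> and a defect of second order in the
  mesh, the total error vanishes as \<open>N\<close> grows and the factor becomes
  \<open>exp (- r)\<close>.\<close>

lemma killed_op_funpow_upper:
  assumes q: "q > 0" and B: "B \<in> sets borel" and f: "bounded_borel f"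
    and a: "0 \<le> a" "a \<le> 1" and e: "0 \<le> e"
    and step: "\<And>x. x \<in> B \<Longrightarrow> killed_op B q f x \<le> a * f x + e"
    and x: "x \<in> B"
  shows "(killed_op B q ^^ k) f x \<le> a ^ k * f x + real k * e"
  using x
proof (induction k arbitrary: x)
  case (Suc k)
  have "(killed_op B q ^^ Suc k) f x \<le> killed_op B q (\<lambda>y. a ^ k * f y + (real k * e) * 1) x"
    unfolding funpow.simps comp_def
    using Suc.IH by (intro killed_op_mono bounded_borel_killed_op_funpow bounded_borel_add bounded_borel_mult bounded_borel_const q B f) auto
  also have "\<dots> = a ^ k * killed_op B q f x + (real k * e) * killed_op B q (\<lambda>_. 1) x"
    by (rule killed_op_affine[OF q B f bounded_borel_const])
  also have "\<dots> \<le> a ^ k * (a * f x + e) + (real k * e) * 1"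
    using Suc.prems step killed_op_1_le[OF q B] a e by (intro add_mono mult_left_mono) auto
  also have "\<dots> = a ^ Suc k * f x + a ^ k * e + real k * e" by (simp add: algebra_simps)
  also have "\<dots> \<le> a ^ Suc k * f x + real (Suc k) * e"
    using mult_right_mono[OF power_le_one[OF a] e, of k] by (simp add: algebra_simps)
  finally show ?case .
qed simp

lemma killed_op_uminus: "killed_op B q (\<lambda>y. - f y) x = - killed_op B q f x"
  using ou_op_cmult[of q "-1" "\<lambda>y. indicator B y * f y" x] unfolding killed_op_def by simp

lemma killed_op_funpow_uminus: "(killed_op B q ^^ k) (\<lambda>y. - f y) x = - (killed_op B q ^^ k) f x"
proof (induction k arbitrary: x)
  case (Suc k)
  have "(killed_op B q ^^ k) (\<lambda>y. - f y) = (\<lambda>y. - (killed_op B q ^^ k) f y)" using Suc.IH by auto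
  then show ?case by (simp add: killed_op_uminus)
qed simp

lemma killed_op_funpow_lower:
  assumes q: "q > 0" and B: "B \<in> sets borel" and f: "bounded_borel f"
    and a: "0 \<le> a" "a \<le> 1" and e: "0 \<le> e"
    and step: "\<And>x. x \<in> B \<Longrightarrow> a * f x - e \<le> killed_op B q f x"
    and x: "x \<in> B"
  shows "a ^ k * f x - real k * e \<le> (killed_op B q ^^ k) f x"
proof -
  have "(killed_op B q ^^ k) (\<lambda>y. - f y) x \<le> a ^ k * - f x + real k * e"
    using bounded_borel_mult[OF bounded_borel_const[of "-1"] f] step
    by (intro killed_op_funpow_upper q B a e x) (force simp: killed_op_uminus)+
  then show ?thesis unfolding killed_op_funpow_uminus by simp
qed

section \<open>Gaussian moments and one-step estimates\<close>

lemma ou_density_quartic: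
  fixes q x :: real
  defines "m \<equiv> exp (- q / 2) * x" and "v \<equiv> 1 - exp (- q)"
  assumes q: "q > 0" and p: "\<And>y. p y = c0 + c1 * (y - m) + c2 * (y - m)^2 + c3 * (y - m)^3 + c4 * (y - m)^4"
  shows "integrable lborel (\<lambda>y. ou_density q x y * p y)"
    and "(\<integral>y. ou_density q x y * p y \<partial>lborel) = c0 + c2 * v + 3 * c4 * v\<^sup>2"
proof -
  have v: "v > 0" using q by (simp add: v_def)
  then have s: "sqrt v > 0" by simp
  let ?n = "normal_density m (sqrt v)"
  have 0: "has_bochner_integral lborel (\<lambda>y. ?n y) 1" using normal_moment_even[OF s, of m 0] by simp
  have 1: "has_bochner_integral lborel (\<lambda>y. ?n y * (y - m)) 0" using normal_moment_odd[OF s, of m 0] by simp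
  have 2: "has_bochner_integral lborel (\<lambda>y. ?n y * (y - m)^2) v"
    using normal_moment_even[OF s, of m 1] v by simp
  have 3: "has_bochner_integral lborel (\<lambda>y. ?n y * (y - m)^3) 0"
    using normal_moment_odd[OF s, of m 1] by simp
  have 4: "has_bochner_integral lborel (\<lambda>y. ?n y * (y - m)^4) (3 * v\<^sup>2)"
    using normal_moment_even[OF s, of m 2] v by (simp add: power2_eq_square fact_numeral)
  have "has_bochner_integral lborel (\<lambda>y. c0 * ?n y + c1 * (?n y * (y - m)) + c2 * (?n y * (y - m)^2)
      + c3 * (?n y * (y - m)^3) + c4 * (?n y * (y - m)^4)) (c0 * 1 + c1 * 0 + c2 * v + c3 * 0 + c4 * (3 * v\<^sup>2))"
    by (intro has_bochner_integral_add has_bochner_integral_mult_right 0 1 2 3 4)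
  moreover have "(\<lambda>y. c0 * ?n y + c1 * (?n y * (y - m)) + c2 * (?n y * (y - m)^2)
      + c3 * (?n y * (y - m)^3) + c4 * (?n y * (y - m)^4)) = (\<lambda>y. ou_density q x y * p y)"
    unfolding p by (simp add: ou_density_def m_def v_def fun_eq_iff algebra_simps)
  ultimately have "has_bochner_integral lborel (\<lambda>y. ou_density q x y * p y) (c0 + c2 * v + 3 * c4 * v\<^sup>2)"
    by (simp add: mult_ac)
  then show "integrable lborel (\<lambda>y. ou_density q x y * p y)"
    and "(\<integral>y. ou_density q x y * p y \<partial>lborel) = c0 + c2 * v + 3 * c4 * v\<^sup>2"
    by (auto simp: has_bochner_integral_iff)
qed

text \<open>Without killing, \<open>1 - y\<^sup>2\<close> is an exact eigenfunction (up to sign the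
  second Hermite polynomial) and constants are preserved. The parameter \<open>c\<close> is
  \<open>1\<close> in the upper bound for \<open>bump\<close> and \<open>b\<^sup>2\<close> in the
  lower one.\<close>

lemma ou_density_parabola:
  assumes "q > 0"
  shows "integrable lborel (\<lambda>y. ou_density q x y * (c - y\<^sup>2))"
    and "(\<integral>y. ou_density q x y * (c - y\<^sup>2) \<partial>lborel) = c - 1 + exp (- q) * (1 - x\<^sup>2)"
proof -
  define m where "m = exp (- q / 2) * x"
  have m2: "m\<^sup>2 = exp (- q) * x\<^sup>2" by (simp add: m_def power_mult_distrib flip: exp_double)
  have p: "c - y\<^sup>2 = (c - m\<^sup>2) + (- 2 * m) * (y - m) + (- 1) * (y - m)^2 + 0 * (y - m)^3 + 0 * (y - m)^4" for y
    by (simp add: power2_eq_square algebra_simps)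
  show "integrable lborel (\<lambda>y. ou_density q x y * (c - y\<^sup>2))"
    by (rule ou_density_quartic(1)[OF assms p[unfolded m_def]])
  show "(\<integral>y. ou_density q x y * (c - y\<^sup>2) \<partial>lborel) = c - 1 + exp (- q) * (1 - x\<^sup>2)"
    unfolding ou_density_quartic(2)[OF assms p[unfolded m_def], folded m_def] m2 by (simp add: algebra_simps)
qed

text \<open>The polynomial has mean drop at least \<open>1 - a\<close> with
  \<open>a = exp (- q)\<close>, and \<open>q / 2 \<le> 1 - a\<close>. The restriction
  \<open>q \<le> 1 / 2\<close> gives \<open>1 / 2 \<le> a\<close>, hence
  \<open>1 + a \<le> 6 * a - 1\<close>; with \<open>x^4 \<le> x\<^sup>2\<close> this makes the
  remaining terms nonnegative.\<close>

lemma ou_density_barrier: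
  assumes q: "0 < q" "q \<le> 1 / 2" and x: "\<bar>x\<bar> \<le> 1"
  shows "integrable lborel (\<lambda>y. ou_density q x y * ((1 - y\<^sup>2) * (2 + y\<^sup>2)))"
    and "(\<integral>y. ou_density q x y * ((1 - y\<^sup>2) * (2 + y\<^sup>2)) \<partial>lborel) \<le> (1 - x\<^sup>2) * (2 + x\<^sup>2) - q / 2"
proof -
  define m where "m = exp (- q / 2) * x"
  define a where "a = exp (- q)"
  have m2: "m\<^sup>2 = a * x\<^sup>2" by (simp add: m_def a_def power_mult_distrib flip: exp_double)
  have p: "(1 - y\<^sup>2) * (2 + y\<^sup>2) = (2 - m^2 - m^4) + (- 2 * m - 4 * m^3) * (y - m) + (- 1 - 6 * m^2) * (y - m)^2
      + (- 4 * m) * (y - m)^3 + (- 1) * (y - m)^4" for y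
    by (simp add: eval_nat_numeral algebra_simps)
  show "integrable lborel (\<lambda>y. ou_density q x y * ((1 - y\<^sup>2) * (2 + y\<^sup>2)))"
    by (rule ou_density_quartic(1)[OF q(1) p[unfolded m_def]])
  have I: "(\<integral>y. ou_density q x y * ((1 - y\<^sup>2) * (2 + y\<^sup>2)) \<partial>lborel) =
      (2 - m^2 - m^4) + (- 1 - 6 * m^2) * (1 - a) + 3 * (- 1) * (1 - a)\<^sup>2"
    using ou_density_quartic(2)[OF q(1) p[unfolded m_def]] by (simp add: m_def a_def)
  have m4: "m^4 = a\<^sup>2 * x^4"
  proof -
    have "m^4 = (m\<^sup>2)\<^sup>2" by simp
    then show ?thesis unfolding m2 by (simp add: power_mult_distrib)
  qed
  have a1: "a \<le> 1" using q by (simp add: a_def)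
  have a2: "1 / 2 \<le> a" unfolding a_def using q exp_ge_add_one_self[of "- q"] by linarith
  have x2: "0 \<le> x\<^sup>2" "x\<^sup>2 \<le> 1" using x by (auto simp: abs_square_le_1)
  have x4: "x^4 \<le> x\<^sup>2" using mult_left_mono[OF x2(2) x2(1)] by (simp add: eval_nat_numeral mult_ac)
  have aq: "q / 2 \<le> 1 - a"
  proof -
    have "1 + q \<le> exp q" by (rule exp_ge_add_one_self)
    then have "a \<le> 1 / (1 + q)" unfolding a_def exp_minus inverse_eq_divide using q by (intro divide_left_mono) auto
    also have "\<dots> \<le> 1 - q / 2"
    proof -
      have "q * q \<le> 1 * q" using q by (intro mult_right_mono) auto
      then show ?thesis using q by (simp add: field_simps)
    qed
    finally show ?thesis by simp
  qed
  have "(1 - x\<^sup>2) * (2 + x\<^sup>2) - (\<integral>y. ou_density q x y * ((1 - y\<^sup>2) * (2 + y\<^sup>2)) \<partial>lborel) - (1 - a)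
      = (1 - a) * ((6 * a - 1) * x\<^sup>2 - (1 + a) * x^4 + 3 * (1 - a))"
    unfolding I m4 m2 by (simp add: eval_nat_numeral algebra_simps)
  moreover have "(1 + a) * x^4 \<le> (6 * a - 1) * x\<^sup>2"
    using x2 x4 a1 a2 by (intro mult_mono) auto
  then have "0 \<le> (1 - a) * ((6 * a - 1) * x\<^sup>2 - (1 + a) * x^4 + 3 * (1 - a))"
    using a1 by (intro mult_nonneg_nonneg) auto
  ultimately show "(\<integral>y. ou_density q x y * ((1 - y\<^sup>2) * (2 + y\<^sup>2)) \<partial>lborel) \<le> (1 - x\<^sup>2) * (2 + x\<^sup>2) - q / 2"
    using aq by linarith
qed

text \<open>Displacement of the mean and variance are both at most \<open>q\<close>, so the fourth
  moment is of order \<open>q\<^sup>2\<close>; the constant is \<open>1 + 6 + 3\<close>, one summand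
  for each term of the expansion that is not odd.\<close>

lemma ou_density_fourth_moment:
  assumes q: "0 < q" "q \<le> 1" and x: "\<bar>x\<bar> \<le> 1"
  shows "integrable lborel (\<lambda>y. ou_density q x y * (y - x)^4)"
    and "(\<integral>y. ou_density q x y * (y - x)^4 \<partial>lborel) \<le> 10 * q\<^sup>2"
proof -
  define m where "m = exp (- q / 2) * x"
  define d where "d = m - x"
  have p: "(y - x)^4 = d^4 + (4 * d^3) * (y - m) + (6 * d^2) * (y - m)^2
      + (4 * d) * (y - m)^3 + 1 * (y - m)^4" for y
    unfolding d_def by (simp add: eval_nat_numeral algebra_simps)
  show "integrable lborel (\<lambda>y. ou_density q x y * (y - x)^4)"
    by (rule ou_density_quartic(1)[OF q(1) p[unfolded m_def]])
  have I: "(\<integral>y. ou_density q x y * (y - x)^4 \<partial>lborel) =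
      d^4 + 6 * d^2 * (1 - exp (- q)) + 3 * 1 * (1 - exp (- q))\<^sup>2"
    by (rule ou_density_quartic(2)[OF q(1) p[unfolded m_def]])
  have v: "0 \<le> 1 - exp (- q)" "1 - exp (- q) \<le> q" using q exp_ge_add_one_self[of "- q"] by auto
  have "d = - ((1 - exp (- q / 2)) * x)" unfolding d_def m_def by (simp add: algebra_simps)
  then have "\<bar>d\<bar> = (1 - exp (- q / 2)) * \<bar>x\<bar>" using q by (simp add: abs_mult)
  also have "\<dots> \<le> (q / 2) * 1" using q x exp_ge_add_one_self[of "- q / 2"] by (intro mult_mono) auto
  also have "\<dots> \<le> q" using q by simp
  finally have d: "\<bar>d\<bar> \<le> q" .
  have d2: "d\<^sup>2 \<le> q\<^sup>2" using d q by (metis abs_ge_zero power2_abs power_mono)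
  have d4: "d^4 \<le> q^4" using d q by (metis abs_ge_zero power_even_abs power_mono even_numeral)
  have q4: "q^4 \<le> q\<^sup>2" using q by (intro power_decreasing) auto
  have "d\<^sup>2 * (1 - exp (- q)) \<le> q\<^sup>2 * 1" using d2 v q by (intro mult_mono) auto
  moreover have "(1 - exp (- q))\<^sup>2 \<le> q\<^sup>2" using v by (intro power_mono)
  ultimately show "(\<integral>y. ou_density q x y * (y - x)^4 \<partial>lborel) \<le> 10 * q\<^sup>2"
    unfolding I using d4 q4 by linarith
qed

text \<open>A jump from \<open>[-b, b]\<close> out of \<open>(-1, 1)\<close> in one step has length at least \<open>1 - b\<close>; its
  contribution is of order \<open>q\<^sup>2\<close> by the fourth moment and disappears in the grid limit.\<close>
lemma killed_op_le_overshoot: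
  assumes q: "0 < q" "q \<le> 1" and b: "0 \<le> b" "b < 1" and x: "x \<in> {-b..b}"
    and f: "bounded_borel f" and fp: "\<And>y. \<bar>y\<bar> \<le> b \<Longrightarrow> f y \<le> p y"
    and p0: "\<And>y. \<bar>y\<bar> \<le> 1 \<Longrightarrow> 0 \<le> p y" and p4: "\<And>y. \<bar>y\<bar> > 1 \<Longrightarrow> - (2 * y^4) \<le> p y"
    and pint: "integrable lborel (\<lambda>y. ou_density q x y * p y)"
  shows "killed_op {-b..b} q f x \<le> (\<integral>y. ou_density q x y * p y \<partial>lborel) + 20 * (1 + 1 / (1 - b))^4 * q\<^sup>2"
proof -
  \<comment> \<open>For \<open>|y| > 1\<close> one has \<open>1 \<le> (|y| - b) / (1 - b)\<close>,
    hence \<open>|y| \<le> (1 + 1 / (1 - b)) * |y - x|\<close>. The factor 2 is the one in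
    \<open>p4\<close>, and multiplied by the fourth-moment constant 10 it gives the 20 of the
    conclusion.\<close>
  define C where "C = 2 * (1 + 1 / (1 - b))^4"
  have C: "C \<ge> 0" unfolding C_def using b by simp
  have x1: "\<bar>x\<bar> \<le> 1" "\<bar>x\<bar> \<le> b" using x b by auto
  have le: "indicator {-b..b} y * f y \<le> p y + C * (y - x)^4" for y
  proof -
    consider "\<bar>y\<bar> \<le> b" | "b < \<bar>y\<bar>" "\<bar>y\<bar> \<le> 1" | "\<bar>y\<bar> > 1" by linarith
    then show ?thesis
    proof cases
      case 1
      then have "indicator {-b..b} y * f y \<le> p y" using fp by (auto simp: indicator_def)
      then show ?thesis using mult_nonneg_nonneg[OF C, of "(y - x)^4"] by simp
    next
      case 2
      then show ?thesis using p0[of y] mult_nonneg_nonneg[OF C, of "(y - x)^4"] by (auto simp: indicator_def)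
    next
      case 3
      have w: "\<bar>y\<bar> - b \<le> \<bar>y - x\<bar>" using x1 by linarith
      have "\<bar>y\<bar> \<le> (1 + 1 / (1 - b)) * (\<bar>y\<bar> - b)"
      proof -
        have "1 \<le> (1 / (1 - b)) * (\<bar>y\<bar> - b)" using 3 b by (simp add: pos_le_divide_eq)
        then have "\<bar>y\<bar> \<le> (\<bar>y\<bar> - b) + (1 / (1 - b)) * (\<bar>y\<bar> - b)" using b by argo
        then show ?thesis by (simp only: distrib_right mult_1)
      qed
      also have "\<dots> \<le> (1 + 1 / (1 - b)) * \<bar>y - x\<bar>" using w b by (intro mult_left_mono) auto
      finally have "\<bar>y\<bar>^4 \<le> ((1 + 1 / (1 - b)) * \<bar>y - x\<bar>)^4" by (intro power_mono) auto
      then have "2 * y^4 \<le> C * (y - x)^4" unfolding C_def power_mult_distrib by simp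
      then show ?thesis using p4[OF 3] 3 b by (auto simp: indicator_def)
    qed
  qed
  have eq: "(\<lambda>y. ou_density q x y * (p y + C * (y - x)^4)) = (\<lambda>y. ou_density q x y * p y + C * (ou_density q x y * (y - x)^4))"
    by (simp add: algebra_simps)
  have i: "integrable lborel (\<lambda>y. ou_density q x y * (p y + C * (y - x)^4))"
    unfolding eq using pint ou_density_fourth_moment(1)[OF q x1(1)] by (intro Bochner_Integration.integrable_add integrable_mult_right)
  have "killed_op {-b..b} q f x \<le> (\<integral>y. ou_density q x y * (p y + C * (y - x)^4) \<partial>lborel)"
    unfolding killed_op_def ou_op_def
    by (intro integral_mono[OF integrable_ou_density_mult[OF q(1) bounded_borel_indicator_mult[OF _ f]] i] mult_left_mono le) auto
  also have "\<dots> = (\<integral>y. ou_density q x y * p y \<partial>lborel) + C * (\<integral>y. ou_density q x y * (y - x)^4 \<partial>lborel)"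
    unfolding eq using pint ou_density_fourth_moment(1)[OF q x1(1)] by simp
  also have "\<dots> \<le> (\<integral>y. ou_density q x y * p y \<partial>lborel) + C * (10 * q\<^sup>2)"
    using ou_density_fourth_moment(2)[OF q x1(1)] C by (intro add_left_mono mult_left_mono)
  finally show ?thesis by (simp add: C_def)
qed

lemma killed_op_bump_upper:
  assumes q: "0 < q" "q \<le> 1" and b: "0 \<le> b" "b < 1" and x: "x \<in> {-b..b}"
  shows "killed_op {-b..b} q bump x \<le> exp (- q) * bump x + 20 * (1 + 1 / (1 - b))^4 * q\<^sup>2"
proof -
  have "killed_op {-b..b} q bump x \<le> (\<integral>y. ou_density q x y * (1 - y\<^sup>2) \<partial>lborel) + 20 * (1 + 1 / (1 - b))^4 * q\<^sup>2"
  proof (rule killed_op_le_overshoot[OF q b x bounded_borel_bump])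
    show "- (2 * y^4) \<le> 1 - y\<^sup>2" if "\<bar>y\<bar> > 1" for y :: real
    proof -
      have "1 \<le> y\<^sup>2" using that by (simp add: abs_square_less_1 not_less[symmetric])
      moreover have "y^4 = y\<^sup>2 * y\<^sup>2" by (simp add: eval_nat_numeral)
      ultimately show ?thesis using mult_left_mono[of 1 "y\<^sup>2" "y\<^sup>2"] by simp
    qed
  qed (use b q in \<open>auto simp: bump_def abs_square_le_1 intro: ou_density_parabola\<close>)
  moreover have "\<bar>x\<bar> < 1" using x b by auto
  ultimately show ?thesis using ou_density_parabola(2)[OF q(1), of x 1] by (simp add: bump_def)
qed

text \<open>No overshoot term arises: \<open>b\<^sup>2 - y\<^sup>2\<close> is negative outside
  \<open>[-b, b]\<close>, so discarding the jumps out of the interval only raises the integral. The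
  price is a defect of first order in \<open>q\<close>, since the eigenfunction identity is off by
  the constant \<open>b\<^sup>2 - 1\<close>.\<close>

lemma killed_op_parabola_lower:
  assumes q: "0 < q" and b: "0 \<le> b" "b < 1"
  shows "exp (- q) * (b\<^sup>2 - x\<^sup>2) - (1 - b\<^sup>2) * q \<le> killed_op {-b..b} q (\<lambda>y. indicator {-b..b} y * (b\<^sup>2 - y\<^sup>2)) x"
proof -
  have sq: "y\<^sup>2 \<le> b\<^sup>2 \<longleftrightarrow> - b \<le> y \<and> y \<le> b" for y
    using abs_le_square_iff[of y b] b by (auto simp: abs_le_iff)
  have f: "bounded_borel (\<lambda>y. indicator {-b..b} y * (b\<^sup>2 - y\<^sup>2))"
  proof (rule bounded_borelI[where C="b\<^sup>2"])
    show "\<bar>indicator {-b..b} y * (b\<^sup>2 - y\<^sup>2)\<bar> \<le> b\<^sup>2" for y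
      using sq[of y] by (simp add: indicator_def abs_le_iff)
  qed measurable
  have b2: "b\<^sup>2 \<le> 1" using b by (simp add: power_le_one)
  have "1 - exp (- q) \<le> q" using exp_ge_add_one_self[of "- q"] by simp
  then have "(1 - b\<^sup>2) * (1 - exp (- q)) \<le> (1 - b\<^sup>2) * q" using b2 by (intro mult_left_mono) auto
  then have "exp (- q) * (b\<^sup>2 - x\<^sup>2) - (1 - b\<^sup>2) * q \<le> b\<^sup>2 - 1 + exp (- q) * (1 - x\<^sup>2)"
    by (simp add: algebra_simps)
  also have "\<dots> = (\<integral>y. ou_density q x y * (b\<^sup>2 - y\<^sup>2) \<partial>lborel)"
    using ou_density_parabola(2)[OF q] by simp
  also have "\<dots> \<le> (\<integral>y. ou_density q x y * (indicator {-b..b} y * (indicator {-b..b} y * (b\<^sup>2 - y\<^sup>2))) \<partial>lborel)"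
  proof (intro integral_mono ou_density_parabola(1) integrable_ou_density_mult bounded_borel_indicator_mult[OF _ f] q mult_left_mono)
    show "b\<^sup>2 - y\<^sup>2 \<le> indicator {-b..b} y * (indicator {-b..b} y * (b\<^sup>2 - y\<^sup>2))" for y
      using sq[of y] by (auto simp: indicator_def)
  qed auto
  finally show ?thesis unfolding killed_op_def ou_op_def .
qed

text \<open>The generator maps \<open>(1 - x\<^sup>2) (2 + x\<^sup>2)\<close> below \<open>- 1\<close> on \<open>[-1, 1]\<close>, so it dominates the expected
  exit time.\<close>
definition barrier :: "real \<Rightarrow> real" where
  "barrier x = (if \<bar>x\<bar> \<le> 1 then (1 - x\<^sup>2) * (2 + x\<^sup>2) else 0)"

lemma barrier_nonneg: "0 \<le> barrier x"
  unfolding barrier_def by (auto simp: abs_square_le_1)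

lemma bounded_borel_barrier: "bounded_borel barrier"
proof (rule bounded_borelI[where C=3])
  show "barrier \<in> borel_measurable borel" unfolding barrier_def by measurable
  have "(1 - x\<^sup>2) * (2 + x\<^sup>2) \<le> 1 * 3" if "\<bar>x\<bar> \<le> 1" for x :: real
    using that by (intro mult_mono) (auto simp: abs_square_le_1)
  then show "\<bar>barrier x\<bar> \<le> 3" for x
    unfolding abs_of_nonneg[OF barrier_nonneg] by (simp add: barrier_def)
qed

lemma barrier_le_bump:
  assumes "\<bar>x\<bar> < 1" shows "barrier x \<le> 3 * bump x"
proof -
  have "x\<^sup>2 \<le> 1" using assms by (simp add: abs_square_le_1)
  then have "(1 - x\<^sup>2) * (2 + x\<^sup>2) \<le> (1 - x\<^sup>2) * 3" by (intro mult_left_mono) auto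
  then show ?thesis using assms by (simp add: barrier_def bump_def)
qed

lemma killed_op_barrier:
  assumes q: "0 < q" "q \<le> 1 / 2" and b: "0 \<le> b" "b < 1" and x: "x \<in> {-b..b}"
  shows "killed_op {-b..b} q barrier x \<le> barrier x - q / 2 + 20 * (1 + 1 / (1 - b))^4 * q\<^sup>2"
proof -
  have x1: "\<bar>x\<bar> \<le> 1" using x b by auto
  have q1: "q \<le> 1" using q by simp
  have "killed_op {-b..b} q barrier x \<le> (\<integral>y. ou_density q x y * ((1 - y\<^sup>2) * (2 + y\<^sup>2)) \<partial>lborel) + 20 * (1 + 1 / (1 - b))^4 * q\<^sup>2"
  proof (rule killed_op_le_overshoot[OF q(1) q1 b x bounded_borel_barrier])
    show "- (2 * y^4) \<le> (1 - y\<^sup>2) * (2 + y\<^sup>2)" if "\<bar>y\<bar> > 1" for y :: real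
    proof -
      have "1 \<le> y\<^sup>2" using that by (simp add: abs_square_less_1 not_less[symmetric])
      then have "y\<^sup>2 * 1 \<le> y\<^sup>2 * y\<^sup>2" by (intro mult_left_mono) auto
      moreover have "(1 - y\<^sup>2) * (2 + y\<^sup>2) = 2 - y\<^sup>2 - y\<^sup>2 * y\<^sup>2" by (simp add: algebra_simps)
      moreover have "y^4 = y\<^sup>2 * y\<^sup>2" by (simp add: eval_nat_numeral)
      ultimately show ?thesis by linarith
    qed
  qed (use b q x1 in \<open>auto simp: barrier_def abs_square_le_1 intro: ou_density_barrier\<close>)
  then show ?thesis using x1 ou_density_barrier(2)[OF q x1] by (simp add: barrier_def)
qed

text \<open>A discrete Dynkin formula: the barrier loses \<open>q / 2\<close> in mean, up to the
  error term, at each step survived, and whoever survives \<open>k\<close> steps has survived all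
  earlier ones. So \<open>k * (q / 2)\<close> times the survival probability is paid for by the
  initial value of the barrier.\<close>

lemma killed_op_funpow_survival:
  assumes q: "0 < q" "q \<le> 1 / 2" and b: "0 \<le> b" "b < 1" and x: "x \<in> {-b..b}"
  shows "real k * (q / 2) * (killed_op {-b..b} q ^^ k) (\<lambda>_. 1) x
    \<le> barrier x + real k * (20 * (1 + 1 / (1 - b))^4 * q\<^sup>2)"
proof -
  define e where "e = 20 * (1 + 1 / (1 - b))^4 * q\<^sup>2"
  define T where "T = killed_op {-b..b} q"
  have e: "e \<ge> 0" unfolding e_def by simp
  have Tb: "bounded_borel ((T ^^ k) f)" if "bounded_borel f" for k f
    unfolding T_def using that q by (intro bounded_borel_killed_op_funpow) auto
  have bb: "bounded_borel (T barrier)" "bounded_borel barrier"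
    unfolding T_def using q by (auto intro!: bounded_borel_killed_op bounded_borel_barrier)
  have T1: "\<bar>(T ^^ k) (\<lambda>_. 1) x\<bar> \<le> 1" for k x
    unfolding T_def using q by (intro killed_op_funpow_bound) auto
  have up: "(T ^^ k) barrier x \<le> barrier x + real k * e - real k * (q / 2) * (T ^^ k) (\<lambda>_. 1) x"
    if "x \<in> {-b..b}" for k x
    using that
  proof (induction k arbitrary: x)
    case (Suc k)
    let ?u = "(T ^^ k) (\<lambda>_. 1)"
    have "(T ^^ Suc k) barrier x \<le> T (\<lambda>y. 1 * barrier y + 1 * ((real k * e) * 1 + (- (real k * (q / 2))) * ?u y)) x"
      unfolding funpow.simps comp_def T_def
    proof (rule killed_op_mono)
      show "bounded_borel ((killed_op {-b..b} q ^^ k) barrier)" using Tb[OF bounded_borel_barrier] unfolding T_def .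
      show "bounded_borel (\<lambda>y. 1 * barrier y + 1 * ((real k * e) * 1 + (- (real k * (q / 2))) * (killed_op {-b..b} q ^^ k) (\<lambda>_. 1) y))"
        using Tb[OF bounded_borel_const[of 1], of k] unfolding T_def
        by (intro bounded_borel_add bounded_borel_mult bounded_borel_const bounded_borel_barrier)
    qed (use q Suc.IH in \<open>auto simp: T_def algebra_simps\<close>)
    also have "\<dots> = T barrier x + (real k * e * T (\<lambda>_. 1) x - real k * (q / 2) * (T ^^ Suc k) (\<lambda>_. 1) x)"
    proof -
      have u: "bounded_borel ?u" by (rule Tb) simp
      have "T (\<lambda>y. 1 * barrier y + 1 * ((real k * e) * 1 + (- (real k * (q / 2))) * ?u y)) x
        = 1 * T barrier x + 1 * T (\<lambda>y. (real k * e) * 1 + (- (real k * (q / 2))) * ?u y) x"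
        unfolding T_def using q u[unfolded T_def]
        by (intro killed_op_affine bounded_borel_add bounded_borel_mult bounded_borel_const bounded_borel_barrier) auto
      also have "T (\<lambda>y. (real k * e) * 1 + (- (real k * (q / 2))) * ?u y) x
        = (real k * e) * T (\<lambda>_. 1) x + (- (real k * (q / 2))) * T ?u x"
        unfolding T_def using q u[unfolded T_def] by (intro killed_op_affine bounded_borel_const) auto
      finally show ?thesis by simp
    qed
    also have "\<dots> \<le> (barrier x - q / 2 + e) + (real k * e * 1 - real k * (q / 2) * (T ^^ Suc k) (\<lambda>_. 1) x)"
      using killed_op_barrier[OF q b Suc.prems] killed_op_1_le[of q "{-b..b}" x] q e
      by (intro add_mono diff_mono mult_left_mono) (auto simp: T_def e_def)
    \<comment> \<open>The new step contributes a full \<open>q / 2\<close>; it is weakened to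
      \<open>q / 2\<close> times the survival probability so that it combines with the other
      losses.\<close>
    also have "\<dots> \<le> barrier x + real (Suc k) * e - real (Suc k) * (q / 2) * (T ^^ Suc k) (\<lambda>_. 1) x"
    proof -
      have "(q / 2) * (T ^^ Suc k) (\<lambda>_. 1) x \<le> (q / 2) * 1"
        using T1[of "Suc k" x] q by (intro mult_left_mono) auto
      then show ?thesis by (simp add: algebra_simps del: funpow.simps)
    qed
    finally show ?case .
  qed simp
  have "(T ^^ k) barrier x \<ge> 0" for k x
  proof (induction k arbitrary: x)
    case (Suc k)
    have "T (\<lambda>_. 0) x \<le> T ((T ^^ k) barrier) x"
      unfolding T_def using Suc.IH q Tb[OF bounded_borel_barrier, of k]
      by (intro killed_op_mono) (auto simp: T_def)
    moreover have "T (\<lambda>_. 0) x = 0" by (simp add: T_def killed_op_def ou_op_def)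
    ultimately show ?case by simp
  qed (simp add: barrier_nonneg)
  then show ?thesis using up[OF x, of k] unfolding e_def T_def by (smt (verit))
qed

lemma grid_error_tendsto_0:
  "(\<lambda>N. real (Suc N) * (c * (r / real (Suc N))\<^sup>2)) \<longlonglongrightarrow> 0"
proof -
  have "real (Suc N) * (c * (r / real (Suc N))\<^sup>2) = c * r\<^sup>2 / real (Suc N)" for N
    by (simp add: power2_eq_square field_simps del: of_nat_Suc)
  moreover have "(\<lambda>N. c * r\<^sup>2 / real (Suc N)) \<longlonglongrightarrow> 0" by (intro LIMSEQ_Suc lim_const_over_n)
  ultimately show ?thesis by simp
qed

lemma eventually_grid_small:
  assumes "c > 0" shows "eventually (\<lambda>N. r / real (Suc N) \<le> c) sequentially"
proof -
  have "(\<lambda>N. r / real (Suc N)) \<longlonglongrightarrow> 0" by (intro LIMSEQ_Suc lim_const_over_n)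
  then have "eventually (\<lambda>N. r / real (Suc N) < c) sequentially"
    using assms by (rule order_tendstoD)
  then show ?thesis by eventually_elim simp
qed

lemma inner_interval_endpoint: "0 \<le> 1 - 1 / real (m + 2)" "1 - 1 / real (m + 2) < 1"
  by (auto simp: field_simps)

lemma eventually_in_inner_interval:
  assumes "\<bar>x\<bar> < 1" shows "eventually (\<lambda>m. x \<in> inner_interval m) sequentially"
proof -
  have "(\<lambda>m. 1 / real (m + 2)) \<longlonglongrightarrow> 0"
    using LIMSEQ_ignore_initial_segment[OF lim_const_over_n[of "1::real"], of 2] by simp
  then have "eventually (\<lambda>m. 1 / real (m + 2) < 1 - \<bar>x\<bar>) sequentially"
    using assms by (intro order_tendstoD(2)) auto
  then show ?thesis by eventually_elim (auto simp: inner_interval_def)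
qed

section \<open>Grid limits of the one-step estimates\<close>

context brownian
begin

lemma confined_sg_bump_upper:
  assumes r: "r > 0" and x: "x \<in> inner_interval m"
  shows "confined_sg (inner_interval m) r bump x \<le> exp (- r) * bump x"
proof -
  define b where "b = 1 - 1 / real (m + 2)"
  have B: "inner_interval m = {-b..b}" by (simp add: inner_interval_def b_def)
  have b: "0 \<le> b" "b < 1" using inner_interval_endpoint[of m] by (auto simp: b_def)
  have xb: "x \<in> {-b..b}" using x B by simp
  let ?c = "20 * (1 + 1 / (1 - b))^4"
  have lim: "(\<lambda>N. exp (- r) * bump x + real (Suc N) * (?c * (r / real (Suc N))\<^sup>2)) \<longlonglongrightarrow> exp (- r) * bump x + 0"
    by (intro tendsto_add tendsto_const grid_error_tendsto_0)
  have "eventually (\<lambda>N. (killed_op {-b..b} (r / real (Suc N)) ^^ Suc N) bump x \<le>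
      exp (- r) * bump x + real (Suc N) * (?c * (r / real (Suc N))\<^sup>2)) sequentially"
    using eventually_grid_small[OF zero_less_one, of r]
  proof (eventually_elim)
    case (elim N)
    have q: "0 < r / real (Suc N)" using r by simp
    have "(killed_op {-b..b} (r / real (Suc N)) ^^ Suc N) bump x
      \<le> exp (- (r / real (Suc N))) ^ Suc N * bump x + real (Suc N) * (?c * (r / real (Suc N))\<^sup>2)"
      by (rule killed_op_funpow_upper)
         (use q elim b xb in \<open>auto intro!: bounded_borel_bump killed_op_bump_upper simp del: of_nat_Suc\<close>)
    also have "exp (- (r / real (Suc N))) ^ Suc N = exp (- r)"
      by (simp flip: exp_of_nat_mult del: of_nat_Suc power_Suc)
    finally show ?case .
  qed
  from tendsto_le[OF _ lim confined_sg_tendsto[OF closed_inner_interval[of m] r bounded_borel_bump, unfolded B] this]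
  show ?thesis unfolding B by simp
qed

text \<open>With \<open>b = 1 - 1 / real (m + 2)\<close>, the parabola
  \<open>b\<^sup>2 - y\<^sup>2\<close> cut off at \<open>[-b, b]\<close> lies below
  \<open>bump\<close>. Its first-order defect survives the grid limit as
  \<open>r * (1 - b\<^sup>2)\<close> and disappears only when the intervals exhaust
  \<open>(-1, 1)\<close>.\<close>

lemma confined_sg_bump_lower:
  assumes r: "r > 0" and x: "x \<in> inner_interval m"
  shows "exp (- r) * ((1 - 1 / real (m + 2))\<^sup>2 - x\<^sup>2) - r * (1 - (1 - 1 / real (m + 2))\<^sup>2)
    \<le> confined_sg (inner_interval m) r bump x"
proof -
  define b where "b = 1 - 1 / real (m + 2)"
  have B: "inner_interval m = {-b..b}" by (simp add: inner_interval_def b_def)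
  have b: "0 \<le> b" "b < 1" using inner_interval_endpoint[of m] by (auto simp: b_def)
  have xb: "x \<in> {-b..b}" using x B by simp
  have b2: "b\<^sup>2 \<le> 1" using b by (simp add: power_le_one)
  let ?f = "\<lambda>y. indicator {-b..b} y * (b\<^sup>2 - y\<^sup>2) :: real"
  have f0: "0 \<le> ?f y" "?f y \<le> bump y" for y
  proof -
    show "0 \<le> ?f y" using abs_le_square_iff[of y b] b by (auto simp: indicator_def abs_le_iff)
    show "?f y \<le> bump y" using b b2 bump_nonneg[of y] by (auto simp: indicator_def bump_def)
  qed
  have f: "bounded_borel ?f"
    by (rule bounded_borelI[where C=1]) (use f0 bump_le_1 in \<open>auto intro: order_trans\<close>)
  have "exp (- r) * ?f x - r * (1 - b\<^sup>2) \<le> (killed_op {-b..b} (r / real (Suc N)) ^^ Suc N) bump x" for N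
  proof -
    have q: "0 < r / real (Suc N)" using r by simp
    have "exp (- r) * ?f x - r * (1 - b\<^sup>2) = exp (- (r / real (Suc N))) ^ Suc N * ?f x - real (Suc N) * ((1 - b\<^sup>2) * (r / real (Suc N)))"
      by (simp flip: exp_of_nat_mult del: of_nat_Suc power_Suc)
    also have "\<dots> \<le> (killed_op {-b..b} (r / real (Suc N)) ^^ Suc N) ?f x"
    proof (rule killed_op_funpow_lower[OF q _ f _ _ _ _ xb])
      show "exp (- (r / real (Suc N))) * ?f y - (1 - b\<^sup>2) * (r / real (Suc N)) \<le> killed_op {-b..b} (r / real (Suc N)) ?f y"
        if "y \<in> {-b..b}" for y
        using killed_op_parabola_lower[OF q b, of y] that by simp
      show "0 \<le> (1 - b\<^sup>2) * (r / real (Suc N))" using b2 q by (intro mult_nonneg_nonneg) auto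
    qed (use q in auto)
    also have "\<dots> \<le> (killed_op {-b..b} (r / real (Suc N)) ^^ Suc N) bump x"
    proof -
      have "(killed_op {-b..b} (r / real (Suc N)) ^^ k) ?f x \<le> (killed_op {-b..b} (r / real (Suc N)) ^^ k) bump x" for k x
      proof (induction k arbitrary: x)
        case (Suc k)
        show ?case unfolding funpow.simps comp_def
          using Suc.IH q f bounded_borel_bump by (intro killed_op_mono bounded_borel_killed_op_funpow) auto
      qed (use f0 in auto)
      then show ?thesis .
    qed
    finally show ?thesis .
  qed
  then have "exp (- r) * ?f x - r * (1 - b\<^sup>2) \<le> confined_sg (inner_interval m) r bump x"
    using LIMSEQ_le_const[OF confined_sg_tendsto[OF closed_inner_interval[of m] r bounded_borel_bump, of x, unfolded B]]
    unfolding B by blast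
  then show ?thesis using xb by (simp add: b_def)
qed

lemma killed_sg_bump:
  assumes r: "r > 0" and x: "\<bar>x\<bar> < 1"
  shows "killed_sg r bump x = exp (- r) * bump x"
proof (rule antisym)
  note lim = killed_sg_tendsto[OF r bounded_borel_bump, of x]
  show "killed_sg r bump x \<le> exp (- r) * bump x"
    by (rule tendsto_upperbound[OF lim])
       (use eventually_in_inner_interval[OF x] confined_sg_bump_upper[OF r] in \<open>auto elim: eventually_mono\<close>)
  have 0: "(\<lambda>m. 1 / real (m + 2)) \<longlonglongrightarrow> 0"
    using LIMSEQ_ignore_initial_segment[OF lim_const_over_n[of "1::real"], of 2] by simp
  have lim': "(\<lambda>m. exp (- r) * ((1 - 1 / real (m + 2))\<^sup>2 - x\<^sup>2) - r * (1 - (1 - 1 / real (m + 2))\<^sup>2))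
     \<longlonglongrightarrow> exp (- r) * ((1 - 0)\<^sup>2 - x\<^sup>2) - r * (1 - (1 - 0)\<^sup>2)"
    by (intro tendsto_intros 0)
  have "exp (- r) * ((1 - 0)\<^sup>2 - x\<^sup>2) - r * (1 - (1 - 0)\<^sup>2) \<le> killed_sg r bump x"
    by (rule tendsto_le[OF _ lim lim'])
       (use eventually_in_inner_interval[OF x] confined_sg_bump_lower[OF r] in \<open>auto elim: eventually_mono\<close>)
  then show "exp (- r) * bump x \<le> killed_sg r bump x" using x by (simp add: bump_def)
qed

text \<open>The constant is \<open>2 * 3\<close>: the barrier decays at rate \<open>1 / 2\<close>
  per unit of time, and \<open>barrier\<close> is at most \<open>3 * bump\<close>. Survival thus
  vanishes at the boundary at least as fast as the eigenfunction.\<close>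

lemma killed_sg_survival:
  assumes r: "r > 0" and x: "\<bar>x\<bar> < 1"
  shows "killed_sg r (\<lambda>_. 1) x \<le> 6 / r * bump x"
proof -
  have "r / 2 * confined_sg (inner_interval m) r (\<lambda>_. 1) x \<le> barrier x" if x: "x \<in> inner_interval m" for m
  proof -
    define b where "b = 1 - 1 / real (m + 2)"
    have B: "inner_interval m = {-b..b}" by (simp add: inner_interval_def b_def)
    have b: "0 \<le> b" "b < 1" using inner_interval_endpoint[of m] by (auto simp: b_def)
    have xb: "x \<in> {-b..b}" using x B by simp
    let ?c = "20 * (1 + 1 / (1 - b))^4"
    have lim: "(\<lambda>N. barrier x + real (Suc N) * (?c * (r / real (Suc N))\<^sup>2)) \<longlonglongrightarrow> barrier x + 0"
      by (intro tendsto_add tendsto_const grid_error_tendsto_0)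
    have lim2: "(\<lambda>N. r / 2 * (killed_op {-b..b} (r / real (Suc N)) ^^ Suc N) (\<lambda>_. 1) x)
      \<longlonglongrightarrow> r / 2 * confined_sg (inner_interval m) r (\<lambda>_. 1) x"
      unfolding B by (intro tendsto_mult tendsto_const confined_sg_tendsto r bounded_borel_const) simp
    have "eventually (\<lambda>N. r / 2 * (killed_op {-b..b} (r / real (Suc N)) ^^ Suc N) (\<lambda>_. 1) x \<le>
        barrier x + real (Suc N) * (?c * (r / real (Suc N))\<^sup>2)) sequentially"
      using eventually_grid_small[OF half_gt_zero[OF zero_less_one], of r]
    proof (eventually_elim)
      case (elim N)
      have q: "0 < r / real (Suc N)" using r by simp
      have "real (Suc N) * (r / real (Suc N) / 2) = r / 2" by (simp del: of_nat_Suc)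
      then show ?case using killed_op_funpow_survival[OF q elim b xb, of "Suc N"] by (simp only:)
    qed
    from tendsto_le[OF _ lim lim2 this] show ?thesis by simp
  qed
  then have ev: "eventually (\<lambda>m. confined_sg (inner_interval m) r (\<lambda>_. 1) x \<le> 6 / r * bump x) sequentially"
    using eventually_in_inner_interval[OF x]
  proof (elim eventually_mono)
    fix m assume "\<And>m. x \<in> inner_interval m \<Longrightarrow> r / 2 * confined_sg (inner_interval m) r (\<lambda>_. 1) x \<le> barrier x"
      and "x \<in> inner_interval m"
    then have "r / 2 * confined_sg (inner_interval m) r (\<lambda>_. 1) x \<le> 3 * bump x"
      using barrier_le_bump[OF x] by (meson order_trans)
    then show "confined_sg (inner_interval m) r (\<lambda>_. 1) x \<le> 6 / r * bump x" using r by (simp add: field_simps)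
  qed
  show ?thesis by (rule tendsto_upperbound[OF killed_sg_tendsto[OF r bounded_borel_const] ev]) simp
qed

end

section \<open>Reflection and symmetry\<close>

lemma normal_density_reflect:
  assumes "s > 0"
  shows "normal_density m s (c - y) = normal_density m s y * exp (- ((c - y - m)\<^sup>2 - (y - m)\<^sup>2) / (2 * s\<^sup>2))"
proof -
  have eq: "- (c - y - m)\<^sup>2 / (2 * s\<^sup>2) = - (y - m)\<^sup>2 / (2 * s\<^sup>2) + - ((c - y - m)\<^sup>2 - (y - m)\<^sup>2) / (2 * s\<^sup>2)"
    using assms by (simp add: field_simps)
  show ?thesis unfolding normal_density_def eq exp_add by simp
qed

lemma reflect_square_diff: "((2 * \<beta> - y - m)\<^sup>2 - (y - m)\<^sup>2 :: real) = 4 * (\<beta> - y) * (\<beta> - m)"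
  by (simp add: power2_eq_square algebra_simps)

text \<open>The level \<open>\<beta>\<close> separates \<open>y\<close> from the mean
  \<open>m\<close>, so reflecting \<open>y\<close> in \<open>\<beta>\<close> takes it no farther
  from the mean.\<close>

lemma normal_density_le_reflect:
  assumes s: "s > 0" and "0 \<le> (\<beta> - y) * (m - \<beta>)"
  shows "normal_density m s y \<le> normal_density m s (2 * \<beta> - y)"
proof -
  have "0 \<le> - (4 * (\<beta> - y) * (\<beta> - m)) / (2 * s\<^sup>2)"
    using assms by (intro divide_nonneg_nonneg) (auto simp: algebra_simps)
  then have "1 \<le> exp (- ((2 * \<beta> - y - m)\<^sup>2 - (y - m)\<^sup>2) / (2 * s\<^sup>2))"
    unfolding reflect_square_diff by simp
  then show ?thesis unfolding normal_density_reflect[OF s]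
    using mult_left_mono[of 1 _ "normal_density m s y"] by simp
qed

text \<open>The method of images, cut off after the first image at each end. The full alternating
  series would be exact for Brownian motion in an interval; for a lower bound the two negative
  images suffice.\<close>

definition reflected :: "real \<Rightarrow> (real \<Rightarrow> real) \<Rightarrow> real \<Rightarrow> real" where
  "reflected \<beta> f y = f y - f (2 * \<beta> - y) - f (2 * (- \<beta>) - y)"

lemma bounded_borel_reflected:
  assumes "bounded_borel f" shows "bounded_borel (reflected \<beta> f)"
  unfolding reflected_def using assms by (intro bounded_borel_diff bounded_borel_reflect)

text \<open>Substituting \<open>c - y\<close> for \<open>y\<close> moves the reflection from the
  function to the density, where images can be compared pointwise.\<close>

lemma ou_op_reflected:
  assumes q: "q > 0" and f: "bounded_borel f"
  shows "integrable lborel (\<lambda>y. (ou_density q x y - ou_density q x (2 * \<beta> - y) - ou_density q x (2 * (- \<beta>) - y)) * f y)"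
    and "ou_op q (reflected \<beta> f) x =
      (\<integral>y. (ou_density q x y - ou_density q x (2 * \<beta> - y) - ou_density q x (2 * (- \<beta>) - y)) * f y \<partial>lborel)"
proof -
  have i0: "integrable lborel (\<lambda>y. ou_density q x y * f y)" using q f by (rule integrable_ou_density_mult)
  have ir: "integrable lborel (\<lambda>y. ou_density q x y * f (c - y))" for c
    using q f by (intro integrable_ou_density_mult bounded_borel_reflect)
  have ic: "integrable lborel (\<lambda>y. ou_density q x (c - y) * f y)" for c
    using lborel_integrable_real_affine[OF ir[of c], of "-1" c] by simp
  have eq: "(\<integral>y. ou_density q x y * f (c - y) \<partial>lborel) = (\<integral>y. ou_density q x (c - y) * f y \<partial>lborel)" for c
    using lborel_integral_real_affine[of "-1" "\<lambda>y. ou_density q x y * f (c - y)" c] by simp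
  have s: "(\<lambda>y. (ou_density q x y - ou_density q x (2 * \<beta> - y) - ou_density q x (2 * (- \<beta>) - y)) * f y) =
    (\<lambda>y. ou_density q x y * f y - ou_density q x (2 * \<beta> - y) * f y - ou_density q x (2 * (- \<beta>) - y) * f y)"
    by (simp add: algebra_simps)
  show "integrable lborel (\<lambda>y. (ou_density q x y - ou_density q x (2 * \<beta> - y) - ou_density q x (2 * (- \<beta>) - y)) * f y)"
    unfolding s by (intro Bochner_Integration.integrable_diff i0 ic)
  have "ou_op q (reflected \<beta> f) x = (\<integral>y. ou_density q x y * f y - ou_density q x y * f (2 * \<beta> - y) - ou_density q x y * f (2 * (- \<beta>) - y) \<partial>lborel)"
    unfolding ou_op_def reflected_def by (simp add: right_diff_distrib)
  also have "\<dots> = (\<integral>y. ou_density q x y * f y \<partial>lborel) - (\<integral>y. ou_density q x y * f (2 * \<beta> - y) \<partial>lborel)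
      - (\<integral>y. ou_density q x y * f (2 * (- \<beta>) - y) \<partial>lborel)"
    by (simp only: Bochner_Integration.integral_diff Bochner_Integration.integrable_diff i0 ir)
  also have "\<dots> = (\<integral>y. ou_density q x y * f y - ou_density q x (2 * \<beta> - y) * f y - ou_density q x (2 * (- \<beta>) - y) * f y \<partial>lborel)"
    unfolding eq by (simp only: Bochner_Integration.integral_diff Bochner_Integration.integrable_diff i0 ic)
  finally show "ou_op q (reflected \<beta> f) x =
      (\<integral>y. (ou_density q x y - ou_density q x (2 * \<beta> - y) - ou_density q x (2 * (- \<beta>) - y)) * f y \<partial>lborel)"
    unfolding s .
qed

text \<open>Once the Gaussian mean has reached or passed \<open>\<beta>\<close> on one side, the
  image across that side dominates the direct density on all of \<open>[-\<beta>, \<beta>]\<close>,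
  outside which \<open>f\<close> vanishes. The other image only lowers the value further.\<close>

lemma ou_op_reflected_nonpos:
  assumes q: "q > 0" and f: "bounded_borel f" "\<And>y. 0 \<le> f y" "\<And>y. \<beta> < \<bar>y\<bar> \<Longrightarrow> f y = 0"
    and x: "\<beta> \<le> exp (- q / 2) * \<bar>x\<bar>"
  shows "ou_op q (reflected \<beta> f) x \<le> 0"
proof -
  have s: "sqrt (1 - exp (- q)) > 0" using q by simp
  define m where "m = exp (- q / 2) * x"
  have mx: "\<beta> \<le> \<bar>m\<bar>" using x unfolding m_def by (simp add: abs_mult)
  have "ou_density q x y - ou_density q x (2 * \<beta> - y) - ou_density q x (2 * (- \<beta>) - y) \<le> 0" if y: "\<bar>y\<bar> \<le> \<beta>" for y
  proof (cases "m \<ge> 0")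
    case True
    then have "0 \<le> (\<beta> - y) * (m - \<beta>)" using mx y by (intro mult_nonneg_nonneg) auto
    from normal_density_le_reflect[OF s this]
    have "ou_density q x y \<le> ou_density q x (2 * \<beta> - y)" unfolding ou_density_def m_def .
    then show ?thesis using ou_density_nonneg[of q x "2 * (- \<beta>) - y"] by linarith
  next
    case False
    then have "0 \<le> (- \<beta> - y) * (m - - \<beta>)" using mx y by (intro mult_nonpos_nonpos) auto
    from normal_density_le_reflect[OF s this]
    have "ou_density q x y \<le> ou_density q x (2 * (- \<beta>) - y)" unfolding ou_density_def m_def .
    then show ?thesis using ou_density_nonneg[of q x "2 * \<beta> - y"] by linarith
  qed
  then have "(ou_density q x y - ou_density q x (2 * \<beta> - y) - ou_density q x (2 * (- \<beta>) - y)) * f y \<le> 0" for y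
    using f(2,3)[of y] by (cases "\<bar>y\<bar> \<le> \<beta>") (auto intro: mult_nonpos_nonneg)
  then show ?thesis unfolding ou_op_reflected(2)[OF q f(1)]
    using integral_mono[OF ou_op_reflected(1)[OF q f(1), of x \<beta>] integrable_zero] by simp
qed

lemma integrable_bounded_borel_interval:
  assumes "bounded_borel f"
  shows "integrable lborel (\<lambda>x. indicator {a..b} x * f x)" "integrable lborel (\<lambda>x. indicator {a<..<b} x * f x)"
proof -
  have [measurable]: "f \<in> borel_measurable borel" using assms by (rule bounded_borel_measurable)
  obtain C where C: "C > 0" "\<And>x. \<bar>f x\<bar> \<le> C" using assms bounded_borelE by blast
  show "integrable lborel (\<lambda>x. indicator {a..b} x * f x)"
    by (rule integrableI_bounded_set[where A="{a..b}" and B=C])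
       (use C in \<open>auto simp: indicator_def abs_mult emeasure_lborel_Icc_eq\<close>)
  show "integrable lborel (\<lambda>x. indicator {a<..<b} x * f x)"
    by (rule integrableI_bounded_set[where A="{a..b}" and B=C])
       (use C in \<open>auto simp: indicator_def abs_mult emeasure_lborel_Icc_eq intro: less_imp_le\<close>)
qed

section \<open>Reversibility and symmetry of the killed kernels\<close>

lemma bounded_borel_gauss: "bounded_borel (\<lambda>x. exp (- x\<^sup>2 / 2))"
  by (rule bounded_borelI[where C=1]) auto

text \<open>With \<open>e = exp (- q / 2)\<close> the exponent of the product is \<open>- (x\<^sup>2
  + y\<^sup>2 - 2 * e * x * y) / (2 * (1 - e\<^sup>2))\<close>, which is symmetric in
  \<open>x\<close> and \<open>y\<close>.\<close>

lemma ou_density_reversible: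
  assumes "q > 0"
  shows "exp (- x\<^sup>2 / 2) * ou_density q x y = exp (- y\<^sup>2 / 2) * ou_density q y x"
proof -
  define e where "e = exp (- q / 2)"
  have e2: "exp (- q) = e\<^sup>2" by (simp add: e_def flip: exp_double)
  have v: "1 - e\<^sup>2 > 0" unfolding e2[symmetric] using assms by simp
  have *: "- x\<^sup>2 / 2 + - (y - e * x)\<^sup>2 / (2 * (1 - e\<^sup>2)) = - (x\<^sup>2 + y\<^sup>2 - 2 * e * x * y) / (2 * (1 - e\<^sup>2))" for x y :: real
    using v by (simp add: field_simps) (simp add: power2_eq_square power4_eq_xxxx algebra_simps)
  have sq: "(sqrt (1 - e\<^sup>2))\<^sup>2 = 1 - e\<^sup>2" using v by simp
  have "exp (- x\<^sup>2 / 2) * ou_density q x y = 1 / sqrt (2 * pi * (1 - e\<^sup>2)) * exp (- (x\<^sup>2 + y\<^sup>2 - 2 * e * x * y) / (2 * (1 - e\<^sup>2)))" for x y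
    unfolding ou_density_def normal_density_def e2 sq *[symmetric] exp_add by (simp add: e_def)
  then show ?thesis by (simp add: algebra_simps)
qed

lemma ou_density_le: "q > 0 \<Longrightarrow> ou_density q x y \<le> 1 / sqrt (2 * pi * (1 - exp (- q)))"
  using mult_left_mono[of "exp (- (y - exp (- q / 2) * x)\<^sup>2 / (2 * (sqrt (1 - exp (- q)))\<^sup>2))" 1 "1 / sqrt (2 * pi * (1 - exp (- q)))"]
  unfolding ou_density_def normal_density_def by simp

text \<open>The interval is imposed on the starting point as well as on the end point. This makes
  the weighted kernel symmetric, and bounded with bounded support, so Fubini applies.\<close>

lemma killed_op_symmetric:
  assumes q: "q > 0" and f: "bounded_borel f" and g: "bounded_borel g"
  shows "(\<integral>x. indicator {-b..b} x * (killed_op {-b..b} q f x * g x * exp (- x\<^sup>2 / 2)) \<partial>lborel) =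
    (\<integral>x. indicator {-b..b} x * (f x * killed_op {-b..b} q g x * exp (- x\<^sup>2 / 2)) \<partial>lborel)"
proof -
  have [measurable]: "f \<in> borel_measurable borel" "g \<in> borel_measurable borel"
    using f g bounded_borel_measurable by auto
  obtain C where C: "C > 0" "\<And>x. \<bar>f x\<bar> \<le> C" using f bounded_borelE by blast
  obtain D where D: "D > 0" "\<And>x. \<bar>g x\<bar> \<le> D" using g bounded_borelE by blast
  let ?B = "{-b..b}"
  define F where "F x y = indicator ?B x * indicator ?B y * (f y * g x) * (exp (- x\<^sup>2 / 2) * ou_density q x y)" for x y :: real
  have Fm: "(\<lambda>(x, y). F x y) \<in> borel_measurable (lborel \<Otimes>\<^sub>M lborel)" unfolding F_def by measurable
  have "integrable (lborel \<Otimes>\<^sub>M lborel) (\<lambda>(x, y). F x y)"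
  proof (rule integrableI_bounded_set[where A="?B \<times> ?B" and B="(C * D) * (1 * (1 / sqrt (2 * pi * (1 - exp (- q)))))"])
    show "emeasure (lborel \<Otimes>\<^sub>M lborel) (?B \<times> ?B) < \<infinity>"
      by (subst lborel.emeasure_pair_measure_Times) (auto simp: emeasure_lborel_Icc_eq ennreal_mult_less_top)
    show "AE p in lborel \<Otimes>\<^sub>M lborel. p \<in> ?B \<times> ?B \<longrightarrow> norm (case p of (x, y) \<Rightarrow> F x y) \<le> (C * D) * (1 * (1 / sqrt (2 * pi * (1 - exp (- q)))))"
    proof (intro AE_I2 impI)
      fix p :: "real \<times> real" assume p: "p \<in> ?B \<times> ?B"
      obtain x y where xy: "p = (x, y)" by (cases p)
      have "norm (F x y) = (\<bar>f y\<bar> * \<bar>g x\<bar>) * (exp (- x\<^sup>2 / 2) * ou_density q x y)"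
        using p xy unfolding F_def by (simp add: abs_mult)
      also have "\<dots> \<le> (C * D) * (1 * (1 / sqrt (2 * pi * (1 - exp (- q)))))"
        using C D q by (intro mult_mono' ou_density_le mult_nonneg_nonneg) auto
      finally show "norm (case p of (x, y) \<Rightarrow> F x y) \<le> (C * D) * (1 * (1 / sqrt (2 * pi * (1 - exp (- q)))))" using xy by simp
    qed
    show "AE p in lborel \<Otimes>\<^sub>M lborel. p \<notin> ?B \<times> ?B \<longrightarrow> (case p of (x, y) \<Rightarrow> F x y) = 0"
      by (intro AE_I2) (auto simp: F_def indicator_def)
  qed (use Fm in auto)
  then have "(\<integral>y. (\<integral>x. F x y \<partial>lborel) \<partial>lborel) = (\<integral>x. (\<integral>y. F x y \<partial>lborel) \<partial>lborel)"
    by (rule lborel_pair.Fubini_integral)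
  moreover have "(\<integral>y. F x y \<partial>lborel) = indicator ?B x * (killed_op ?B q f x * g x * exp (- x\<^sup>2 / 2))" for x
  proof -
    have "(\<integral>y. F x y \<partial>lborel) = (\<integral>y. (indicator ?B x * g x * exp (- x\<^sup>2 / 2)) * (ou_density q x y * (indicator ?B y * f y)) \<partial>lborel)"
      unfolding F_def by (simp add: mult_ac)
    then show ?thesis unfolding killed_op_def ou_op_def by simp
  qed
  moreover have "(\<integral>x. F x y \<partial>lborel) = indicator ?B y * (f y * killed_op ?B q g y * exp (- y\<^sup>2 / 2))" for y
  proof -
    have "(\<integral>x. F x y \<partial>lborel) = (\<integral>x. (indicator ?B y * f y * exp (- y\<^sup>2 / 2)) * (ou_density q y x * (indicator ?B x * g x)) \<partial>lborel)"
      unfolding F_def ou_density_reversible[OF q, of _ y] by (simp add: mult_ac)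
    then show ?thesis unfolding killed_op_def ou_op_def by simp
  qed
  ultimately show ?thesis by simp
qed

lemma killed_op_funpow_symmetric:
  assumes q: "q > 0" and f: "bounded_borel f" and g: "bounded_borel g"
  shows "(\<integral>x. indicator {-b..b} x * ((killed_op {-b..b} q ^^ k) f x * g x * exp (- x\<^sup>2 / 2)) \<partial>lborel) =
    (\<integral>x. indicator {-b..b} x * (f x * (killed_op {-b..b} q ^^ k) g x * exp (- x\<^sup>2 / 2)) \<partial>lborel)"
  using g
proof (induction k arbitrary: g)
  case (Suc k)
  have "(\<integral>x. indicator {-b..b} x * ((killed_op {-b..b} q ^^ Suc k) f x * g x * exp (- x\<^sup>2 / 2)) \<partial>lborel) =
    (\<integral>x. indicator {-b..b} x * ((killed_op {-b..b} q ^^ k) f x * killed_op {-b..b} q g x * exp (- x\<^sup>2 / 2)) \<partial>lborel)"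
    using killed_op_symmetric[OF q bounded_borel_killed_op_funpow[OF q _ f] Suc.prems] by simp
  also have "\<dots> = (\<integral>x. indicator {-b..b} x * (f x * (killed_op {-b..b} q ^^ k) (killed_op {-b..b} q g) x * exp (- x\<^sup>2 / 2)) \<partial>lborel)"
    using q Suc.prems by (intro Suc.IH bounded_borel_killed_op) auto
  finally show ?case by (simp add: funpow_swap1)
qed simp

text \<open>Serves both limits: \<open>I\<close> is constant while the mesh tends to zero, and runs
  through the inner intervals while they exhaust \<open>(-1, 1)\<close>.\<close>

lemma integral_indicator_tendsto:
  assumes u: "\<And>n. bounded_borel (u n)" "\<And>n x. \<bar>u n x\<bar> \<le> C" "\<And>x. (\<lambda>n. u n x) \<longlonglongrightarrow> v x"
    and I: "\<And>n. I n \<in> sets borel" "\<And>n. I n \<subseteq> {-1..1}" and J: "J \<in> sets borel"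
    and IJ: "\<And>x. (\<lambda>n. indicator (I n) x :: real) \<longlonglongrightarrow> indicator J x"
    and w: "bounded_borel w"
  shows "(\<lambda>n. \<integral>x. indicator (I n) x * (u n x * w x) \<partial>lborel) \<longlonglongrightarrow> (\<integral>x. indicator J x * (v x * w x) \<partial>lborel)"
proof -
  have um[measurable]: "u n \<in> borel_measurable borel" for n using u(1) by (rule bounded_borel_measurable)
  have wm[measurable]: "w \<in> borel_measurable borel" using w by (rule bounded_borel_measurable)
  have [measurable]: "v \<in> borel_measurable borel" by (rule borel_measurable_LIMSEQ_real[OF u(3) um])
  note [measurable] = I(1) J
  obtain D where D: "D > 0" "\<And>x. \<bar>w x\<bar> \<le> D" using w bounded_borelE by blast
  have C: "C \<ge> 0" using u(2)[of 0 0] by simp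
  show ?thesis
  proof (rule integral_dominated_convergence[where w="\<lambda>x. indicator {-1..1} x * (C * D)"])
    show "AE x in lborel. (\<lambda>n. indicator (I n) x * (u n x * w x)) \<longlonglongrightarrow> indicator J x * (v x * w x)"
      by (intro AE_I2 tendsto_intros IJ u)
    show "AE x in lborel. norm (indicator (I n) x * (u n x * w x)) \<le> indicator {-1..1} x * (C * D)" for n
      unfolding real_norm_def abs_mult
      using u(2) D I(2)[of n] C by (intro AE_I2 mult_mono' ) (auto simp: indicator_def)
  qed (auto intro: integrable_bounded_borel_interval)
qed

lemma inner_interval_subset: "inner_interval m \<subseteq> {-1<..<1}"
proof
  fix x assume "x \<in> inner_interval m"
  then have "- (1 - 1 / real (m + 2)) \<le> x" "x \<le> 1 - 1 / real (m + 2)"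
    unfolding inner_interval_def by (simp_all only: atLeastAtMost_iff)
  with inner_interval_endpoint[of m] have "- 1 < x" "x < 1" by linarith+
  then show "x \<in> {-1<..<1}" by simp
qed

lemma indicator_inner_interval_tendsto: "(\<lambda>m. indicator (inner_interval m) x :: real) \<longlonglongrightarrow> indicator {-1<..<1} x"
proof (cases "\<bar>x\<bar> < 1")
  case True
  have "eventually (\<lambda>m. (indicator (inner_interval m) x :: real) = 1) sequentially"
    by (rule eventually_mono[OF eventually_in_inner_interval[OF True]]) simp
  then show ?thesis using True by (auto intro: tendsto_eventually simp: indicator_def)
next
  case False
  then have "x \<notin> {-1<..<1}" by auto
  moreover from this have "x \<notin> inner_interval m" for m using inner_interval_subset[of m] by blast
  ultimately show ?thesis by simp
qed

section \<open>Lower bounds by reflection, and symmetry in the limit\<close>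

context brownian
begin

text \<open>Chapman-Kolmogorov without computing a Gaussian convolution: with
  \<open>B = UNIV\<close>, \<open>killed_op_funpow_eq\<close> expresses \<open>i\<close> steps of
  length \<open>q\<close> and one step of length \<open>i * q\<close> as the same
  expectation.\<close>

lemma ou_op_add_time:
  assumes q: "q > 0" and i: "i > 0" and f: "bounded_borel f"
  shows "ou_op q (ou_op (real i * q) f) x = ou_op (real (Suc i) * q) f x"
proof -
  have U: "killed_op UNIV q = ou_op q" for q by (simp add: killed_op_def fun_eq_iff)
  have eq: "(ou_op q ^^ i) f x = ou_op (real i * q) f x" if "i > 0" for i x
    using killed_op_funpow_eq[OF q _ f, of UNIV i x] killed_op_funpow_eq[of "real i * q" UNIV f 1 x] q f that
    by (simp add: U)
  have "ou_op q (ou_op (real i * q) f) x = ou_op q ((ou_op q ^^ i) f) x"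
    using eq[OF i] by presburger
  also have "\<dots> = (ou_op q ^^ Suc i) f x" by simp
  also have "\<dots> = ou_op (real (Suc i) * q) f x" by (rule eq) simp
  finally show ?thesis .
qed

text \<open>Reflection principle as a comparison of operators: the reflected function has nonpositive
  image outside \<open>[-b, b]\<close>, so discarding paths that leave can only increase the expectation.\<close>
lemma killed_op_funpow_ge_reflected:
  assumes q: "q > 0" and b: "b > 0" and k: "k > 0" and kq: "real k * q \<le> r" and \<beta>: "\<beta> = b * exp (- r / 2)"
    and f: "bounded_borel f" "\<And>y. 0 \<le> f y" "\<And>y. \<beta> < \<bar>y\<bar> \<Longrightarrow> f y = 0"
  shows "ou_op (real k * q) (reflected \<beta> f) x \<le> (killed_op {-b..b} q ^^ k) f x"
  using k kq
proof (induction k arbitrary: x rule: nat_induct_non_zero)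
  case 1
  have r0: "r > 0" using 1 q by simp
  have "\<beta> \<le> b" unfolding \<beta> using b r0 by (intro mult_left_le) auto
  have inside: "indicator {-b..b} y * f y = f y" for y
  proof (cases "y \<in> {-b..b}")
    case False
    then have "\<beta> < \<bar>y\<bar>" using \<open>\<beta> \<le> b\<close> by (auto simp: abs_real_def)
    then show ?thesis using f(3) by simp
  qed simp
  have "reflected \<beta> f y \<le> f y" for y
    using f(2)[of "2 * \<beta> - y"] f(2)[of "2 * (- \<beta>) - y"] unfolding reflected_def by linarith
  then show ?case
    using ou_op_mono[OF q bounded_borel_reflected[OF f(1)] f(1), of \<beta> x]
    by (simp add: killed_op_def inside)
next
  case (Suc k)
  let ?g = "ou_op (real k * q) (reflected \<beta> f)"
  have kq: "real k * q > 0" "real k * q \<le> r" using Suc q by (auto simp: algebra_simps)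
  have g: "bounded_borel ?g" by (intro bounded_borel_ou_op kq bounded_borel_reflected f)
  \<comment> \<open>Started at or beyond \<open>b\<close>, the mean is still at or beyond
    \<open>b * exp (- r / 2) = \<beta>\<close> as long as the elapsed time is at most
    \<open>r\<close>. This is why the reflection level is taken below \<open>b\<close>.\<close>
  have neg: "?g z \<le> 0" if "b \<le> \<bar>z\<bar>" for z
  proof (rule ou_op_reflected_nonpos[OF kq(1) f])
    have "exp (- r / 2) \<le> exp (- (real k * q) / 2)" using kq by simp
    then have "exp (- r / 2) * b \<le> exp (- (real k * q) / 2) * \<bar>z\<bar>" using that b by (intro mult_mono) auto
    then show "\<beta> \<le> exp (- (real k * q) / 2) * \<bar>z\<bar>" unfolding \<beta> by (simp add: mult.commute)
  qed
  have "ou_op (real (Suc k) * q) (reflected \<beta> f) x = ou_op q ?g x"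
    using ou_op_add_time[OF q Suc.hyps(1) bounded_borel_reflected[OF f(1)]] by simp
  also have "\<dots> \<le> ou_op q (\<lambda>y. indicator {-b..b} y * ?g y) x"
  proof (rule ou_op_mono[OF q g bounded_borel_indicator_mult[OF _ g]])
    show "?g y \<le> indicator {-b..b} y * ?g y" for y
      using neg[of y] by (cases "y \<in> {-b..b}") (auto simp: abs_le_iff not_le le_minus_iff)
  qed simp
  also have "\<dots> = killed_op {-b..b} q ?g x" by (simp add: killed_op_def)
  also have "\<dots> \<le> killed_op {-b..b} q ((killed_op {-b..b} q ^^ k) f) x"
    using Suc.IH kq(2) by (intro killed_op_mono q g bounded_borel_killed_op_funpow f) auto
  finally show ?case by simp
qed

lemma confined_sg_ge_reflected:
  assumes r: "r > 0" and \<beta>: "\<beta> = (1 - 1 / real (m + 2)) * exp (- r / 2)"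
    and f: "bounded_borel f" "\<And>y. 0 \<le> f y" "\<And>y. \<beta> < \<bar>y\<bar> \<Longrightarrow> f y = 0"
  shows "ou_op r (reflected \<beta> f) x \<le> confined_sg (inner_interval m) r f x"
proof -
  have "ou_op r (reflected \<beta> f) x \<le> (killed_op (inner_interval m) (r / real (Suc N)) ^^ Suc N) f x" for N
  proof -
    have q: "r / real (Suc N) > 0" using r by simp
    have b: "1 - 1 / real (m + 2) > 0" by (simp add: field_simps)
    have eq: "real (Suc N) * (r / real (Suc N)) = r" by (simp del: of_nat_Suc)
    show ?thesis
      using killed_op_funpow_ge_reflected[OF q b zero_less_Suc _ \<beta> f, of N x] unfolding eq inner_interval_def by simp
  qed
  then show ?thesis
    using LIMSEQ_le_const[OF confined_sg_tendsto[OF closed_inner_interval r f(1)]] by blast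
qed

lemma killed_integrable:
  assumes "r > 0" "bounded_borel f"
  shows "integrable M (\<lambda>\<omega>. alive x 0 r \<omega> * f (OUproc W x r \<omega>))"
proof -
  obtain C where C: "C > 0" "\<And>x. \<bar>f x\<bar> \<le> C" using assms bounded_borelE by blast
  have "(\<lambda>\<omega>. alive x 0 r \<omega> :: real) \<in> borel_measurable M"
    using unkilled_measurable[OF assms(1), of 0 x] by simp
  then show ?thesis
    using assms C by (intro integrable_bounded_comp[where C=C] borel_measurable_times OU_measurable_comp)
      (auto intro: less_imp_le)
qed

lemma killed_sg_mono:
  assumes r: "r > 0" and "bounded_borel f" "bounded_borel g" "\<And>y. \<bar>y\<bar> < 1 \<Longrightarrow> f y \<le> g y"
  shows "killed_sg r f x \<le> killed_sg r g x"
  unfolding killed_sg_eq[OF r assms(2)] killed_sg_eq[OF r assms(3)] using assms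
  by (intro integral_mono killed_integrable) auto

lemma killed_sg_affine:
  assumes r: "r > 0" and f: "bounded_borel f" and g: "bounded_borel g"
  shows "killed_sg r (\<lambda>y. c * f y + d * g y) x = c * killed_sg r f x + d * killed_sg r g x"
proof -
  have b: "bounded_borel (\<lambda>y. c * f y + d * g y)"
    using f g by (intro bounded_borel_add bounded_borel_mult bounded_borel_const)
  have "(\<lambda>\<omega>. alive x 0 r \<omega> * (c * f (OUproc W x r \<omega>) + d * g (OUproc W x r \<omega>))) =
      (\<lambda>\<omega>. c * (alive x 0 r \<omega> * f (OUproc W x r \<omega>)) +
        d * (alive x 0 r \<omega> * g (OUproc W x r \<omega>)))"
    by (simp add: algebra_simps)
  then show ?thesis
    unfolding killed_sg_eq[OF r f] killed_sg_eq[OF r g] killed_sg_eq[OF r b]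
    using killed_integrable[OF r f, of x] killed_integrable[OF r g, of x] by simp
qed

lemma killed_sg_cmult:
  assumes "r > 0" "bounded_borel f"
  shows "killed_sg r (\<lambda>y. c * f y) x = c * killed_sg r f x"
  using killed_sg_affine[OF assms assms(2), of c 0 x] by simp

lemma confined_sg_le_killed_sg:
  assumes r: "r > 0" and f: "bounded_borel f" "\<And>y. 0 \<le> f y"
  shows "confined_sg (inner_interval m) r f x \<le> killed_sg r f x"
  unfolding killed_sg_eq[OF r f(1)] confined_sg_eq[OF closed_inner_interval r f(1)]
proof (rule integral_mono[OF _ killed_integrable[OF r f(1)]])
  obtain C where C: "C > 0" "\<And>x. \<bar>f x\<bar> \<le> C" using f(1) bounded_borelE by blast
  have "(\<lambda>\<omega>. stays (inner_interval m) x 0 r \<omega> :: real) \<in> borel_measurable M"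
    using confined_measurable[OF closed_inner_interval r, of 0 x m] by simp
  then show "integrable M (\<lambda>\<omega>. stays (inner_interval m) x 0 r \<omega> * f (OUproc W x r \<omega>))"
    using r f C by (intro integrable_bounded_comp[where C=C] borel_measurable_times OU_measurable_comp)
      (auto intro: less_imp_le)
  have "\<bar>y\<bar> < 1" if "y \<in> inner_interval m" for y
    using subsetD[OF inner_interval_subset that] by auto
  then show "stays (inner_interval m) x 0 r \<omega> * f (OUproc W x r \<omega>)
    \<le> alive x 0 r \<omega> * f (OUproc W x r \<omega>)" for \<omega>
    using f(2) by (intro mult_right_mono) auto
qed

text \<open>For a short time \<open>r\<close> each of the two images carries at most a quarter of
  the direct density, so at least half of it remains. With
  \<open>\<delta> = 2 / real (m + 2)\<close>, starting points reach up to
  \<open>1 - \<delta>\<close> and the reflecting level comes from \<open>1 - \<delta> / 2\<close>;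
  both are scaled by \<open>E\<close>, and the gap between them controls the images.\<close>

lemma killed_sg_interior_minorization:
  assumes m: "m > 0"
  obtains r \<kappa> c where "r > 0" "0 < \<kappa>" "\<kappa> < 1" "c > 0"
    "\<And>x f. \<bar>x\<bar> \<le> 1 - 2 / real (m + 2) \<Longrightarrow> bounded_borel f \<Longrightarrow> (\<And>y. \<bar>y\<bar> < 1 \<Longrightarrow> 0 \<le> f y) \<Longrightarrow>
      c * (\<integral>y. indicator {-\<kappa>..\<kappa>} y * f y \<partial>lborel) \<le> killed_sg r f x"
proof -
  define \<delta> where "\<delta> = 2 / real (m + 2)"
  have \<delta>: "0 < \<delta>" "\<delta> < 1" using m by (auto simp: \<delta>_def field_simps)
  \<comment> \<open>Chosen so that the variance \<open>v\<close> equals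
    \<open>(E * \<delta> / 2)\<^sup>2\<close>. The exponent of an image relative to the direct
    density is then at most \<open>-2\<close>, and \<open>exp (- 2) \<le> 1 / 4\<close>.\<close>
  define r where "r = ln (1 + \<delta>\<^sup>2 / 4)"
  have er: "exp r = 1 + \<delta>\<^sup>2 / 4" unfolding r_def using \<delta> by (intro exp_ln) (auto intro: add_pos_nonneg)
  have r: "r > 0" unfolding r_def using \<delta> by (simp add: ln_gt_zero)
  define E where "E = exp (- r / 2)"
  have E: "0 < E" "E < 1" using r by (auto simp: E_def)
  have E2: "E\<^sup>2 = exp (- r)" by (simp add: E_def flip: exp_double)
  define \<beta> where "\<beta> = (1 - 1 / real (m + 2)) * exp (- r / 2)"
  have \<beta>E: "\<beta> = (1 - \<delta> / 2) * E" unfolding \<beta>_def E_def \<delta>_def by (simp add: field_simps)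
  define \<kappa> where "\<kappa> = (1 - \<delta>) * E"
  define v where "v = 1 - exp (- r)"
  have v: "v > 0" unfolding v_def using r by simp
  have Ev: "E\<^sup>2 * (\<delta>\<^sup>2 / 4) = v"
  proof -
    have "\<delta>\<^sup>2 / 4 = exp r - 1" using er by simp
    then show ?thesis unfolding E2 v_def by (simp add: right_diff_distrib flip: exp_add)
  qed
  have s: "sqrt v > 0" "(sqrt v)\<^sup>2 = v" using v by auto
  have "(1 - \<delta>) * E < 1 * 1" using \<delta> E by (intro mult_strict_mono) auto
  then have \<kappa>: "0 < \<kappa>" "\<kappa> < 1" unfolding \<kappa>_def using \<delta> E by auto
  have \<kappa>\<beta>: "\<kappa> \<le> \<beta>" unfolding \<kappa>_def \<beta>E using \<delta> E by (intro mult_right_mono) auto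
  \<comment> \<open>Half the value of the Gaussian density with variance \<open>v\<close> at
    distance 2 from its mean; 2 bounds the distance between the mean and the points of
    \<open>[-\<kappa>, \<kappa>]\<close>.\<close>
  define c where "c = (1 / sqrt (2 * pi * v) * exp (- 4 / (2 * v))) / 2"
  have c: "c > 0" unfolding c_def using v by simp
  have "c * (\<integral>y. indicator {-\<kappa>..\<kappa>} y * f y \<partial>lborel) \<le> killed_sg r f x"
    if x: "\<bar>x\<bar> \<le> 1 - 2 / real (m + 2)" and f: "bounded_borel f" "\<And>y. \<bar>y\<bar> < 1 \<Longrightarrow> 0 \<le> f y" for x f
  proof -
    define f' where "f' y = indicator {-\<kappa>..\<kappa>} y * f y" for y
    have f': "bounded_borel f'" unfolding f'_def using f by (intro bounded_borel_indicator_mult) auto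
    have f'0: "0 \<le> f' y" for y using f(2)[of y] \<kappa> by (auto simp: f'_def indicator_def)
    have f's: "f' y = 0" if "\<beta> < \<bar>y\<bar>" for y using that \<kappa>\<beta> by (auto simp: f'_def indicator_def)
    define \<mu> where "\<mu> = E * x"
    have \<mu>: "\<bar>\<mu>\<bar> \<le> E * (1 - \<delta>)" unfolding \<mu>_def using x E by (simp add: abs_mult \<delta>_def)
    have dens: "ou_density r x = normal_density \<mu> (sqrt v)" by (simp add: ou_density_def \<mu>_def E_def v_def)
    have exp2: "exp (- 2) \<le> (1 / 4 :: real)"
    proof -
      have "2 \<le> exp (1::real)" using exp_ge_add_one_self[of 1] by simp
      then have "2 * 2 \<le> exp (1::real) * exp 1" by (intro mult_mono) auto
      then have "4 \<le> exp (2::real)" by (simp flip: exp_add)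
      then show ?thesis by (simp add: exp_minus field_simps)
    qed
    have quarter: "ou_density r x (2 * \<gamma> - y) \<le> ou_density r x y / 4"
      if g: "(E * \<delta> / 2)\<^sup>2 \<le> (\<gamma> - y) * (\<gamma> - \<mu>)" for \<gamma> y
    proof -
      have "4 * v \<le> 4 * ((\<gamma> - y) * (\<gamma> - \<mu>))"
        using g Ev by (simp add: power_mult_distrib power_divide)
      then have "2 \<le> (4 * (\<gamma> - y) * (\<gamma> - \<mu>)) / (2 * v)" using v by (simp add: field_simps)
      then have "exp (- (4 * (\<gamma> - y) * (\<gamma> - \<mu>)) / (2 * v)) \<le> exp (- 2)" by simp
      then have "exp (- (4 * (\<gamma> - y) * (\<gamma> - \<mu>)) / (2 * v)) \<le> 1 / 4" using exp2 by linarith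
      then have "normal_density \<mu> (sqrt v) y * exp (- (4 * (\<gamma> - y) * (\<gamma> - \<mu>)) / (2 * v)) \<le> normal_density \<mu> (sqrt v) y * (1 / 4)"
        by (intro mult_left_mono) auto
      then show ?thesis unfolding dens normal_density_reflect[OF s(1)] reflect_square_diff s(2) by simp
    qed
    have pt: "c * f' y \<le> (ou_density r x y - ou_density r x (2 * \<beta> - y) - ou_density r x (2 * (- \<beta>) - y)) * f' y" for y
    proof (cases "y \<in> {-\<kappa>..\<kappa>}")
      case True
      have gap: "E * \<delta> / 2 \<le> \<beta> - \<bar>y\<bar>" "E * \<delta> / 2 \<le> \<beta> - \<bar>\<mu>\<bar>"
        using True \<mu> unfolding \<beta>E \<kappa>_def by (auto simp: algebra_simps abs_le_iff)
      have g0: "0 \<le> E * \<delta> / 2" using E \<delta> by simp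
      have "E * \<delta> / 2 * (E * \<delta> / 2) \<le> (\<beta> - y) * (\<beta> - \<mu>)"
        by (rule mult_mono') (use gap g0 in auto)
      then have 1: "ou_density r x (2 * \<beta> - y) \<le> ou_density r x y / 4"
        by (intro quarter) (simp add: power2_eq_square)
      have "E * \<delta> / 2 * (E * \<delta> / 2) \<le> (\<beta> + y) * (\<beta> + \<mu>)"
        by (rule mult_mono') (use gap g0 in auto)
      also have "\<dots> = (- \<beta> - y) * (- \<beta> - \<mu>)" by (simp add: algebra_simps)
      finally have 2: "ou_density r x (2 * (- \<beta>) - y) \<le> ou_density r x y / 4"
        by (intro quarter) (simp add: power2_eq_square)
      have "\<bar>y - \<mu>\<bar> \<le> 2"
      proof -
        have "E * (1 - \<delta>) \<le> 1 * 1" using E \<delta> by (intro mult_mono) auto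
        then show ?thesis using True \<mu> \<kappa> by (auto simp: abs_le_iff)
      qed
      then have "(y - \<mu>)\<^sup>2 \<le> 2\<^sup>2" by (metis abs_ge_zero power2_abs power_mono)
      then have "(y - \<mu>)\<^sup>2 / (2 * v) \<le> 2\<^sup>2 / (2 * v)"
        using v by (intro divide_right_mono) auto
      then have "exp (- 4 / (2 * v)) \<le> exp (- (y - \<mu>)\<^sup>2 / (2 * v))"
        by simp
      then have "1 / sqrt (2 * pi * v) * exp (- 4 / (2 * v)) \<le> 1 / sqrt (2 * pi * v) * exp (- (y - \<mu>)\<^sup>2 / (2 * v))"
        using v by (intro mult_left_mono) auto
      then have 3: "2 * c \<le> ou_density r x y"
        unfolding dens normal_density_def c_def s(2) by simp
      show ?thesis using 1 2 3 by (intro mult_right_mono f'0) linarith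
    qed (simp add: f'_def)
    have "c * (\<integral>y. f' y \<partial>lborel) = (\<integral>y. c * f' y \<partial>lborel)" by simp
    also have "\<dots> \<le> ou_op r (reflected \<beta> f') x"
      unfolding ou_op_reflected(2)[OF r f']
      by (intro integral_mono ou_op_reflected(1)[OF r f'] pt)
         (simp add: f'_def integrable_bounded_borel_interval f)
    also have "\<dots> \<le> confined_sg (inner_interval m) r f' x"
      by (rule confined_sg_ge_reflected[OF r \<beta>_def f' f'0 f's])
    also have "\<dots> \<le> killed_sg r f' x" by (rule confined_sg_le_killed_sg[OF r f' f'0])
    also have "\<dots> \<le> killed_sg r f x"
      by (rule killed_sg_mono[OF r f' f(1)]) (use f(2) in \<open>auto simp: f'_def indicator_def\<close>)
    finally show ?thesis by (simp add: f'_def)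
  qed
  then show ?thesis using that r \<kappa> c by blast
qed

text \<open>Symmetry is exact on every grid, by \<open>killed_op_funpow_symmetric\<close>, and
  passes through both limits.\<close>

lemma killed_sg_symmetric:
  assumes r: "r > 0" and f: "bounded_borel f" and g: "bounded_borel g"
  shows "(\<integral>x. indicator {-1<..<1} x * (killed_sg r f x * (g x * exp (- x\<^sup>2 / 2))) \<partial>lborel) =
    (\<integral>x. indicator {-1<..<1} x * (killed_sg r g x * (f x * exp (- x\<^sup>2 / 2))) \<partial>lborel)"
proof -
  have confined: "(\<integral>x. indicator (inner_interval m) x * (confined_sg (inner_interval m) r f x * (g x * exp (- x\<^sup>2 / 2))) \<partial>lborel) =
    (\<integral>x. indicator (inner_interval m) x * (confined_sg (inner_interval m) r g x * (f x * exp (- x\<^sup>2 / 2))) \<partial>lborel)" for m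
  proof -
    have lim: "(\<lambda>N. \<integral>x. indicator (inner_interval m) x * ((killed_op (inner_interval m) (r / real (Suc N)) ^^ Suc N) f x * (g x * exp (- x\<^sup>2 / 2))) \<partial>lborel)
      \<longlonglongrightarrow> (\<integral>x. indicator (inner_interval m) x * (confined_sg (inner_interval m) r f x * (g x * exp (- x\<^sup>2 / 2))) \<partial>lborel)"
      if f: "bounded_borel f" and g: "bounded_borel g" for f g
    proof -
      obtain C where C: "C > 0" "\<And>x. \<bar>f x\<bar> \<le> C" using f bounded_borelE by blast
      have q: "r / real (Suc N) > 0" for N using r by simp
      have B: "inner_interval m \<in> sets borel" unfolding inner_interval_def by simp
      show ?thesis
      proof (rule integral_indicator_tendsto)
        show "bounded_borel ((killed_op (inner_interval m) (r / real (Suc N)) ^^ Suc N) f)" for N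
          by (rule bounded_borel_killed_op_funpow[OF q B f])
        show "\<bar>(killed_op (inner_interval m) (r / real (Suc N)) ^^ Suc N) f x\<bar> \<le> C" for N x
          by (rule killed_op_funpow_bound[OF q B f C(2)])
        show "(\<lambda>N. (killed_op (inner_interval m) (r / real (Suc N)) ^^ Suc N) f x) \<longlonglongrightarrow> confined_sg (inner_interval m) r f x" for x
          by (rule confined_sg_tendsto[OF closed_inner_interval r f])
        show "inner_interval m \<subseteq> {-1..1}" using inner_interval_subset[of m] by auto
        show "bounded_borel (\<lambda>x. g x * exp (- x\<^sup>2 / 2))" by (intro bounded_borel_mult g bounded_borel_gauss)
      qed (use B in auto)
    qed
    have eq: "(\<integral>x. indicator (inner_interval m) x * ((killed_op (inner_interval m) (r / real (Suc N)) ^^ Suc N) f x * (g x * exp (- x\<^sup>2 / 2))) \<partial>lborel)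
      = (\<integral>x. indicator (inner_interval m) x * ((killed_op (inner_interval m) (r / real (Suc N)) ^^ Suc N) g x * (f x * exp (- x\<^sup>2 / 2))) \<partial>lborel)" for N
      using killed_op_funpow_symmetric[OF _ f g, of "r / real (Suc N)" "1 - 1 / real (m + 2)" "Suc N"] r
      unfolding inner_interval_def[symmetric] by (simp add: mult_ac del: funpow.simps of_nat_Suc)
    show ?thesis using LIMSEQ_unique[OF lim[OF f g]] lim[OF g f] unfolding eq by blast
  qed
  have lim: "(\<lambda>m. \<integral>x. indicator (inner_interval m) x * (confined_sg (inner_interval m) r f x * (g x * exp (- x\<^sup>2 / 2))) \<partial>lborel)
      \<longlonglongrightarrow> (\<integral>x. indicator {-1<..<1} x * (killed_sg r f x * (g x * exp (- x\<^sup>2 / 2))) \<partial>lborel)"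
    if f: "bounded_borel f" and g: "bounded_borel g" for f g
  proof -
    obtain C where C: "C > 0" "\<And>x. \<bar>f x\<bar> \<le> C" using f bounded_borelE by blast
    show ?thesis
    proof (rule integral_indicator_tendsto)
      show "bounded_borel (confined_sg (inner_interval m) r f)" for m
        by (rule bounded_borel_confined_sg[OF closed_inner_interval r f])
      show "\<bar>confined_sg (inner_interval m) r f x\<bar> \<le> C" for m x
        by (rule confined_sg_bound[OF closed_inner_interval r f C(2)])
      show "(\<lambda>m. confined_sg (inner_interval m) r f x) \<longlonglongrightarrow> killed_sg r f x" for x
        by (rule killed_sg_tendsto[OF r f])
      show "inner_interval m \<subseteq> {-1..1}" for m using inner_interval_subset[of m] by auto
      show "bounded_borel (\<lambda>x. g x * exp (- x\<^sup>2 / 2))" by (intro bounded_borel_mult g bounded_borel_gauss)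
      show "inner_interval m \<in> sets borel" for m unfolding inner_interval_def by simp
    qed (auto intro: indicator_inner_interval_tendsto)
  qed
  show ?thesis using LIMSEQ_unique[OF lim[OF f g]] lim[OF g f] unfolding confined by blast
qed

end

section \<open>Convergence to the principal eigenfunction\<close>

text \<open>Up to the factor \<open>K_OU\<close> this is integration against
  \<open>alpha_OU\<close>: the left eigenmeasure of a reversible semigroup is the eigenfunction
  times the reversing weight.\<close>

definition bump_pairing :: "(real \<Rightarrow> real) \<Rightarrow> real" where
  "bump_pairing g = (\<integral>x. indicator {-1<..<1} x * (g x * (bump x * exp (- x\<^sup>2 / 2))) \<partial>lborel)"

lemma integrable_bump_pairing:
  assumes "bounded_borel g"
  shows "integrable lborel (\<lambda>x. indicator {-1<..<1} x * (g x * (bump x * exp (- x\<^sup>2 / 2))))"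
  by (intro integrable_bounded_borel_interval bounded_borel_mult assms bounded_borel_bump bounded_borel_gauss)

lemma bump_pairing_mono:
  assumes "bounded_borel f" "bounded_borel g" "\<And>x. \<bar>x\<bar> < 1 \<Longrightarrow> f x \<le> g x"
  shows "bump_pairing f \<le> bump_pairing g"
  unfolding bump_pairing_def
proof (rule integral_mono[OF integrable_bump_pairing[OF assms(1)] integrable_bump_pairing[OF assms(2)]])
  show "indicator {-1<..<1} x * (f x * (bump x * exp (- x\<^sup>2 / 2)))
    \<le> indicator {-1<..<1} x * (g x * (bump x * exp (- x\<^sup>2 / 2)))" for x
    using assms(3)[of x] bump_nonneg[of x] by (auto simp: indicator_def intro!: mult_right_mono)
qed

lemma bump_pairing_cmult: "bump_pairing (\<lambda>x. c * g x) = c * bump_pairing g"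
  unfolding bump_pairing_def by (simp add: mult_ac flip: integral_mult_right_zero)

lemma integral_indicator_pos:
  fixes f :: "real \<Rightarrow> real"
  assumes i: "integrable lborel (\<lambda>x. indicator J x * f x)" and ab: "a < b" "{a..b} \<subseteq> J"
    and f: "\<And>x. x \<in> J \<Longrightarrow> 0 \<le> f x" and c: "c > 0" "\<And>x. x \<in> {a..b} \<Longrightarrow> c \<le> f x"
  shows "0 < (\<integral>x. indicator J x * f x \<partial>lborel)"
proof -
  have "0 < c * (b - a)" using ab c by simp
  also have "\<dots> = (\<integral>x. indicator {a..b} x * c \<partial>lborel)" using ab by simp
  also have "\<dots> \<le> (\<integral>x. indicator J x * f x \<partial>lborel)"
    using i ab f c by (intro integral_mono integrable_bounded_borel_interval) (auto simp: indicator_def)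
  finally show ?thesis .
qed

lemma bump_gauss_lower: "x \<in> {-1/2..1/2} \<Longrightarrow> 1 / 2 \<le> bump x" "x \<in> {-1/2..1/2} \<Longrightarrow> 1 / 2 \<le> exp (- x\<^sup>2 / 2)"
proof -
  assume x: "x \<in> {-1/2..1/2}"
  then have "\<bar>x\<bar> \<le> 1 / 2" by auto
  then have "x\<^sup>2 \<le> (1 / 2)\<^sup>2" by (metis abs_ge_zero power2_abs power_mono)
  then have x2: "x\<^sup>2 \<le> 1 / 4" by (simp add: power2_eq_square)
  have "\<bar>x\<bar> < 1" using x by auto
  then show "1 / 2 \<le> bump x" using x2 by (simp add: bump_def)
  show "1 / 2 \<le> exp (- x\<^sup>2 / 2)" using exp_ge_add_one_self[of "- x\<^sup>2 / 2"] x2 by simp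
qed

lemma bump_pairing_pos:
  assumes "bounded_borel g" "\<And>x. \<bar>x\<bar> < 1 \<Longrightarrow> 0 \<le> g x" "c > 0" "\<And>x. x \<in> {-1/2..1/2} \<Longrightarrow> c \<le> g x"
  shows "0 < bump_pairing g"
  unfolding bump_pairing_def
proof (rule integral_indicator_pos[OF integrable_bump_pairing[OF assms(1)], of "-1/2" "1/2" "c * (1 / 2 * (1 / 2))"])
  show "c * (1 / 2 * (1 / 2)) \<le> g x * (bump x * exp (- x\<^sup>2 / 2))" if "x \<in> {-1/2..1/2}" for x
    using assms that bump_gauss_lower[of x] by (intro mult_mono) (auto simp: bump_nonneg intro: order_trans[of 0 c, OF less_imp_le])
  show "0 \<le> g x * (bump x * exp (- x\<^sup>2 / 2))" if "x \<in> {-1<..<1}" for x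
    using assms(2)[of x] that by (auto simp: bump_nonneg)
qed (use assms in auto)

text \<open>Bounds on the quotient \<open>g / bump\<close>. The width \<open>hi - lo\<close> is the
  quantity that contracts, like an oscillation under the Doob transform by
  \<open>bump\<close>.\<close>

definition bump_band :: "(real \<Rightarrow> real) \<Rightarrow> real \<Rightarrow> real \<Rightarrow> bool" where
  "bump_band g lo hi \<longleftrightarrow> bounded_borel g \<and> (\<forall>x. \<bar>x\<bar> < 1 \<longrightarrow> lo * bump x \<le> g x \<and> g x \<le> hi * bump x)"

lemma bump_bandD:
  assumes "bump_band g lo hi"
  shows "bounded_borel g" "\<And>x. \<bar>x\<bar> < 1 \<Longrightarrow> lo * bump x \<le> g x" "\<And>x. \<bar>x\<bar> < 1 \<Longrightarrow> g x \<le> hi * bump x"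
  using assms unfolding bump_band_def by auto

section \<open>Contraction of the rescaled semigroup\<close>

context brownian
begin

text \<open>The operator \<open>exp r * killed_sg r\<close> is monotone and fixes
  \<open>bump\<close> on \<open>(-1, 1)\<close>, so it preserves bounds by multiples of
  \<open>bump\<close>.\<close>

lemma bump_band_evolve:
  assumes r: "r > 0" and g: "bump_band g lo hi"
  shows "bump_band (\<lambda>x. exp r * killed_sg r g x) lo hi"
proof -
  note gD = bump_bandD[OF g]
  have bc: "bounded_borel (\<lambda>x. c * bump x)" for c by (intro bounded_borel_mult bounded_borel_const bounded_borel_bump)
  have eq: "exp r * killed_sg r (\<lambda>y. c * bump y) x = c * bump x" if "\<bar>x\<bar> < 1" for c x
    using killed_sg_cmult[OF r bounded_borel_bump] killed_sg_bump[OF r that] by (simp flip: exp_add)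
  have "lo * bump x \<le> exp r * killed_sg r g x" if x: "\<bar>x\<bar> < 1" for x
    using mult_left_mono[OF killed_sg_mono[OF r bc gD(1,2)], of "exp r" x] eq[OF x] by simp
  moreover have "exp r * killed_sg r g x \<le> hi * bump x" if x: "\<bar>x\<bar> < 1" for x
    using mult_left_mono[OF killed_sg_mono[OF r gD(1) bc gD(3)], of "exp r" x] eq[OF x] by simp
  ultimately show ?thesis unfolding bump_band_def
    using bounded_borel_mult[OF bounded_borel_const bounded_borel_killed_sg[OF r gD(1)]] by auto
qed

text \<open>Symmetry moves the semigroup onto \<open>bump\<close>, where the eigenvalue cancels
  \<open>exp r\<close>. This is the quasi-stationarity of \<open>alpha_OU\<close>, and the conserved
  quantity identifies the limit.\<close>

lemma bump_pairing_evolve: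
  assumes r: "r > 0" and g: "bounded_borel g"
  shows "bump_pairing (\<lambda>x. exp r * killed_sg r g x) = bump_pairing g"
proof -
  have "bump_pairing (killed_sg r g) = (\<integral>x. indicator {-1<..<1} x * (killed_sg r bump x * (g x * exp (- x\<^sup>2 / 2))) \<partial>lborel)"
    unfolding bump_pairing_def by (rule killed_sg_symmetric[OF r g bounded_borel_bump])
  also have "\<dots> = (\<integral>x. exp (- r) * (indicator {-1<..<1} x * (g x * (bump x * exp (- x\<^sup>2 / 2)))) \<partial>lborel)"
    by (rule Bochner_Integration.integral_cong) (auto simp: indicator_def killed_sg_bump[OF r])
  also have "\<dots> = exp (- r) * bump_pairing g" unfolding bump_pairing_def by simp
  finally show ?thesis unfolding bump_pairing_cmult by (simp flip: exp_add)
qed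

lemma bump_pairing_band:
  assumes "bump_band g lo hi"
  shows "lo * bump_pairing bump \<le> bump_pairing g" "bump_pairing g \<le> hi * bump_pairing bump"
  using bump_pairing_mono[OF bounded_borel_mult[OF bounded_borel_const bounded_borel_bump] bump_bandD(1,2)[OF assms]]
    bump_pairing_mono[OF bump_bandD(1)[OF assms] bounded_borel_mult[OF bounded_borel_const bounded_borel_bump] bump_bandD(3)[OF assms]]
  by (auto simp: bump_pairing_cmult)

text \<open>By the eigenvalue identity a surviving path carries \<open>bump\<close>-mass \<open>exp (- 1) * bump x\<close>, and by the
  survival bound only a small part of it can sit near the boundary.\<close>
lemma killed_sg_interior_mass:
  assumes x: "\<bar>x\<bar> < 1"
  shows "bump x / 6 \<le> killed_sg 1 (indicator {-(1 - 1/72)..1 - 1/72}) x"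
proof -
  let ?K = "{-(1 - 1/72)..1 - 1/72 :: real}"
  have bK: "bounded_borel (indicator ?K)" by (rule bounded_borel_indicator) simp
  \<comment> \<open>Outside \<open>?K\<close> the value of \<open>bump\<close> is at most
    \<open>2 / 72 = 1 / 36\<close>. With the survival bound \<open>6 * bump x\<close> the mass lost
    there is at most \<open>bump x / 6\<close>, and \<open>exp (- 1) \<ge> 1 / 3\<close> leaves
    \<open>1 / 3 - 1 / 6 = 1 / 6\<close>. The redundant factors 1 match the shape of
    \<open>killed_sg_affine\<close>.\<close>
  have "bump y \<le> 1 * indicator ?K y + (1/36) * 1" if y: "\<bar>y\<bar> < 1" for y :: real
  proof (cases "y \<in> ?K")
    case False
    then have "1 - 1/72 < \<bar>y\<bar>" by (auto simp: abs_real_def)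
    moreover have "indicator ?K y = (0::real)" using False by (rule indicator_simps(2))
    moreover have "bump y = (1 - \<bar>y\<bar>) * (1 + \<bar>y\<bar>)"
      using y by (simp add: bump_def power2_eq_square algebra_simps)
    moreover have "(1 - \<bar>y\<bar>) * (1 + \<bar>y\<bar>) \<le> (1/72) * 2"
      using y calculation(1) by (intro mult_mono) auto
    ultimately show ?thesis by linarith
  qed (use bump_le_1[of y] in simp)
  then have "killed_sg 1 bump x \<le> killed_sg 1 (\<lambda>y. 1 * indicator ?K y + (1/36) * 1) x"
    by (intro killed_sg_mono bounded_borel_add bounded_borel_mult bounded_borel_const bounded_borel_bump bK) auto
  also have "\<dots> = 1 * killed_sg 1 (indicator ?K) x + (1/36) * killed_sg 1 (\<lambda>_. 1) x"
    by (rule killed_sg_affine[OF _ bK bounded_borel_const]) simp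
  also have "\<dots> \<le> killed_sg 1 (indicator ?K) x + bump x / 6"
    using killed_sg_survival[OF _ x, of 1] by simp
  finally have "exp (- 1) * bump x \<le> killed_sg 1 (indicator ?K) x + bump x / 6"
    using killed_sg_bump[OF _ x, of 1] by simp
  moreover have "1 / 3 \<le> exp (- 1 :: real)" using exp_le by (simp add: exp_minus field_simps)
  then have "1 / 3 * bump x \<le> exp (- 1) * bump x" by (intro mult_right_mono bump_nonneg)
  ultimately show ?thesis by simp
qed

text \<open>One unit of time brings the path alive into a compact part of the interior with
  probability at least \<open>bump x / 6\<close>; from there the interior minorization acts for a
  further time \<open>r\<close>. The factor \<open>bump x\<close> makes the bound usable relative to
  the eigenfunction.\<close>

lemma killed_sg_minorization:
  obtains r \<kappa> c where "r > 0" "0 < \<kappa>" "\<kappa> < 1" "c > 0"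
    "\<And>x f. \<bar>x\<bar> < 1 \<Longrightarrow> bounded_borel f \<Longrightarrow> (\<And>y. \<bar>y\<bar> < 1 \<Longrightarrow> 0 \<le> f y) \<Longrightarrow>
      c * (\<integral>y. indicator {-\<kappa>..\<kappa>} y * f y \<partial>lborel) * bump x \<le> killed_sg r f x"
proof -
  \<comment> \<open>The index 142 is taken so that \<open>2 / real (142 + 2) = 1 / 72\<close>, the
    margin of the interval \<open>?K\<close>.\<close>
  obtain r \<kappa> c where r: "r > 0" and \<kappa>: "0 < \<kappa>" "\<kappa> < 1" and c: "c > 0" and
    low: "\<And>x f. \<bar>x\<bar> \<le> 1 - 2 / real (142 + 2) \<Longrightarrow> bounded_borel f \<Longrightarrow> (\<And>y. \<bar>y\<bar> < 1 \<Longrightarrow> 0 \<le> f y) \<Longrightarrow>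
      c * (\<integral>y. indicator {-\<kappa>..\<kappa>} y * f y \<partial>lborel) \<le> killed_sg r f x"
    using killed_sg_interior_minorization[of 142, OF zero_less_numeral] by blast
  let ?K = "{-(1 - 1/72)..1 - 1/72 :: real}"
  have bK: "bounded_borel (indicator ?K)" by (rule bounded_borel_indicator) simp
  show ?thesis
  proof (rule that[of "1 + r" \<kappa> "c / 6"])
    fix x :: real and f assume x: "\<bar>x\<bar> < 1" and f: "bounded_borel f" and f0: "\<And>y. \<bar>y\<bar> < 1 \<Longrightarrow> 0 \<le> f y"
    define J where "J = (\<integral>y. indicator {-\<kappa>..\<kappa>} y * f y \<partial>lborel)"
    have J: "0 \<le> J" unfolding J_def using \<kappa> f0 by (intro integral_nonneg_AE AE_I2) (auto simp: indicator_def)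
    have kf: "bounded_borel (killed_sg r f)" by (rule bounded_borel_killed_sg[OF r f])
    have pos: "0 \<le> killed_sg r f y" for y
      unfolding killed_sg_eq[OF r f] using f0 r by (intro integral_nonneg_AE AE_I2) auto
    have "c / 6 * J * bump x = c * J * (bump x / 6)" by simp
    also have "\<dots> \<le> c * J * killed_sg 1 (indicator ?K) x"
      using c J killed_sg_interior_mass[OF x] by (intro mult_left_mono) auto
    also have "\<dots> = killed_sg 1 (\<lambda>y. c * J * indicator ?K y) x"
      using killed_sg_cmult[OF _ bK] by simp
    also have "\<dots> \<le> killed_sg 1 (killed_sg r f) x"
    proof (rule killed_sg_mono[OF _ _ kf])
      show "c * J * indicator ?K y \<le> killed_sg r f y" for y
      proof (cases "y \<in> ?K")
        case True
        then have "\<bar>y\<bar> \<le> 1 - 2 / real (142 + 2)" by auto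
        then show ?thesis using low[OF _ f f0, of y] True by (simp add: J_def)
      qed (simp add: pos)
      show "bounded_borel (\<lambda>y. c * J * indicator ?K y)"
        by (rule bounded_borel_mult[OF bounded_borel_const bK])
    qed simp
    also have "\<dots> = killed_sg (1 + r) f x" using killed_sg_add[OF _ r f, of 1] by simp
    finally show "c / 6 * (\<integral>y. indicator {-\<kappa>..\<kappa>} y * f y \<partial>lborel) * bump x \<le> killed_sg (1 + r) f x"
      by (simp add: J_def)
  qed (use r \<kappa> c in auto)
qed

text \<open>The minorization is applied to the two functions \<open>g - lo * bump\<close> and
  \<open>hi * bump - g\<close>, both nonnegative on \<open>(-1, 1)\<close>. Each moves one end of
  the band inward, and the two gains add up to \<open>d * J bump * (hi - lo)\<close>, from which
  \<open>g\<close> has dropped out.\<close>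

lemma bump_band_contraction:
  obtains r \<theta> where "r > 0" "0 \<le> \<theta>" "\<theta> < 1"
    "\<And>g lo hi. bump_band g lo hi \<Longrightarrow>
      \<exists>lo' hi'. bump_band (\<lambda>x. exp r * killed_sg r g x) lo' hi' \<and> hi' - lo' = \<theta> * (hi - lo)"
proof -
  obtain r \<kappa> c where r: "r > 0" and \<kappa>: "0 < \<kappa>" "\<kappa> < 1" and c: "c > 0" and
    low: "\<And>x f. \<bar>x\<bar> < 1 \<Longrightarrow> bounded_borel f \<Longrightarrow> (\<And>y. \<bar>y\<bar> < 1 \<Longrightarrow> 0 \<le> f y) \<Longrightarrow>
      c * (\<integral>y. indicator {-\<kappa>..\<kappa>} y * f y \<partial>lborel) * bump x \<le> killed_sg r f x"
    using killed_sg_minorization by blast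
  define J where "J f = (\<integral>y. indicator {-\<kappa>..\<kappa>} y * f y \<partial>lborel)" for f :: "real \<Rightarrow> real"
  have Ji: "integrable lborel (\<lambda>y. indicator {-\<kappa>..\<kappa>} y * f y)" if "bounded_borel f" for f
    using that by (rule integrable_bounded_borel_interval)
  have Jaff: "J (\<lambda>y. a * f y + d * g y) = a * J f + d * J g" if "bounded_borel f" "bounded_borel g" for a d f g
  proof -
    have "(\<lambda>y. indicator {-\<kappa>..\<kappa>} y * (a * f y + d * g y)) =
        (\<lambda>y. a * (indicator {-\<kappa>..\<kappa>} y * f y) + d * (indicator {-\<kappa>..\<kappa>} y * g y))"
      by (simp add: algebra_simps)
    then show ?thesis unfolding J_def using Ji[OF that(1)] Ji[OF that(2)] by simp
  qed
  have Jb: "J bump > 0" unfolding J_def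
  proof (rule integral_indicator_pos[OF Ji[OF bounded_borel_bump], of "- min \<kappa> (1/2)" "min \<kappa> (1/2)" "1/2"])
    show "1 / 2 \<le> bump x" if "x \<in> {- min \<kappa> (1/2)..min \<kappa> (1/2)}" for x
      using that by (intro bump_gauss_lower(1)) auto
  qed (use \<kappa> in \<open>auto simp: bump_nonneg\<close>)
  define d where "d = exp r * c"
  have d: "d > 0" unfolding d_def using c by simp
  define \<theta> where "\<theta> = 1 - d * J bump"
  \<comment> \<open>Testing the minorization on the eigenfunction itself at \<open>0\<close> shows
    \<open>d * J bump \<le> 1\<close>, so \<open>\<theta>\<close> is not negative.\<close>
  have "c * J bump * bump 0 \<le> killed_sg r bump 0"
    unfolding J_def using bump_nonneg by (intro low bounded_borel_bump) auto
  then have "exp r * (c * J bump) \<le> exp r * exp (- r)"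
    using killed_sg_bump[OF r, of 0] by (simp add: bump_def)
  then have "d * J bump \<le> 1" unfolding d_def by (simp flip: exp_add)
  then have \<theta>: "0 \<le> \<theta>" "\<theta> < 1" unfolding \<theta>_def using d Jb by auto
  have "\<exists>lo' hi'. bump_band (\<lambda>x. exp r * killed_sg r g x) lo' hi' \<and> hi' - lo' = \<theta> * (hi - lo)"
    if g: "bump_band g lo hi" for g lo hi
  proof (intro exI conjI)
    note gD = bump_bandD[OF g]
    note bb = bounded_borel_bump
    \<comment> \<open>Used with \<open>a = 1\<close>, \<open>e = - lo\<close> for the lower end of
      the band and with \<open>a = - 1\<close>, \<open>e = hi\<close> for the upper one.\<close>
    have main: "a * (exp r * killed_sg r g x) + e * bump x \<ge> d * (a * J g + e * J bump) * bump x"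
      if x: "\<bar>x\<bar> < 1" and nn: "\<And>y. \<bar>y\<bar> < 1 \<Longrightarrow> 0 \<le> a * g y + e * bump y" for a e x
    proof -
      have b: "bounded_borel (\<lambda>y. a * g y + e * bump y)"
        by (intro bounded_borel_add bounded_borel_mult bounded_borel_const gD bb)
      have "c * J (\<lambda>y. a * g y + e * bump y) * bump x \<le> killed_sg r (\<lambda>y. a * g y + e * bump y) x"
        unfolding J_def using low[OF x b nn] .
      then have "c * (a * J g + e * J bump) * bump x \<le> a * killed_sg r g x + e * (exp (- r) * bump x)"
        unfolding Jaff[OF gD(1) bb] killed_sg_affine[OF r gD(1) bb] killed_sg_bump[OF r x] .
      then have "exp r * (c * (a * J g + e * J bump) * bump x) \<le> exp r * (a * killed_sg r g x + e * (exp (- r) * bump x))"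
        by (intro mult_left_mono) auto
      also have "\<dots> = a * (exp r * killed_sg r g x) + e * bump x"
      proof -
        have "exp r * (e * (exp (- r) * bump x)) = (exp r * exp (- r)) * (e * bump x)" by simp
        then show ?thesis by (simp add: distrib_left mult_ac flip: exp_add)
      qed
      finally show ?thesis unfolding d_def by (simp add: mult_ac)
    qed
    show "bump_band (\<lambda>x. exp r * killed_sg r g x) (lo + d * (J g - lo * J bump)) (hi - d * (hi * J bump - J g))"
      unfolding bump_band_def
    proof (intro conjI allI impI)
      show "bounded_borel (\<lambda>x. exp r * killed_sg r g x)"
        by (intro bounded_borel_mult bounded_borel_const bounded_borel_killed_sg r gD)
      fix x :: real assume x: "\<bar>x\<bar> < 1"
      show "(lo + d * (J g - lo * J bump)) * bump x \<le> exp r * killed_sg r g x"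
        using main[OF x, of 1 "- lo"] gD(2) by (simp add: algebra_simps)
      show "exp r * killed_sg r g x \<le> (hi - d * (hi * J bump - J g)) * bump x"
        using main[OF x, of "- 1" hi] gD(3) by (simp add: algebra_simps)
    qed
    show "(hi - d * (hi * J bump - J g)) - (lo + d * (J g - lo * J bump)) = \<theta> * (hi - lo)"
      unfolding \<theta>_def by (simp add: algebra_simps)
  qed
  then show ?thesis using that r \<theta> by blast
qed

text \<open>The pairing with \<open>bump\<close> is constant along the evolution and compatible with
  every band, so \<open>L\<close> lies in each of the shrinking bands. Contraction acts along
  multiples of \<open>r0\<close>; at all later times the last band is kept.\<close>

lemma killed_sg_convergence:
  assumes g: "bump_band g lo hi" and \<epsilon>: "\<epsilon> > 0"
  shows "\<exists>R>0. \<forall>r\<ge>R. \<forall>x. \<bar>x\<bar> < 1 \<longrightarrow>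
    \<bar>exp r * killed_sg r g x - bump_pairing g / bump_pairing bump * bump x\<bar> \<le> \<epsilon> * bump x"
proof -
  obtain r0 \<theta> where r0: "r0 > 0" and \<theta>: "0 \<le> \<theta>" "\<theta> < 1" and
    contr: "\<And>g lo hi. bump_band g lo hi \<Longrightarrow>
      \<exists>lo' hi'. bump_band (\<lambda>x. exp r0 * killed_sg r0 g x) lo' hi' \<and> hi' - lo' = \<theta> * (hi - lo)"
    using bump_band_contraction by blast
  have gb: "bounded_borel g" by (rule bump_bandD(1)[OF g])
  have comp: "exp q * killed_sg q (\<lambda>x. exp r * killed_sg r g x) x = exp (q + r) * killed_sg (q + r) g x"
    if "q > 0" "r > 0" for q r x
    using killed_sg_cmult[OF that(1) bounded_borel_killed_sg[OF that(2) gb]] killed_sg_add[OF that gb]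
    by (simp add: exp_add)
  have it: "\<exists>lo' hi'. bump_band (\<lambda>x. exp (real (Suc n) * r0) * killed_sg (real (Suc n) * r0) g x) lo' hi' \<and>
      hi' - lo' = \<theta> ^ Suc n * (hi - lo)" for n
  proof (induction n)
    case 0
    show ?case using contr[OF g] by simp
  next
    case (Suc n)
    then obtain lo' hi' where b: "bump_band (\<lambda>x. exp (real (Suc n) * r0) * killed_sg (real (Suc n) * r0) g x) lo' hi'"
      and w: "hi' - lo' = \<theta> ^ Suc n * (hi - lo)" by blast
    have "r0 + real (Suc n) * r0 = real (Suc (Suc n)) * r0" by (simp add: algebra_simps)
    then have "(\<lambda>x. exp r0 * killed_sg r0 (\<lambda>x. exp (real (Suc n) * r0) * killed_sg (real (Suc n) * r0) g x) x)
      = (\<lambda>x. exp (real (Suc (Suc n)) * r0) * killed_sg (real (Suc (Suc n)) * r0) g x)"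
      using comp[OF r0, of "real (Suc n) * r0"] r0 by (simp del: of_nat_Suc)
    then show ?case using contr[OF b] w by (simp add: mult_ac del: of_nat_Suc)
  qed
  have "(\<lambda>n. \<theta> ^ Suc n * (hi - lo)) \<longlonglongrightarrow> 0 * (hi - lo)"
    using \<theta> by (intro tendsto_mult tendsto_const LIMSEQ_Suc LIMSEQ_realpow_zero) auto
  then have "eventually (\<lambda>n. \<theta> ^ Suc n * (hi - lo) < \<epsilon>) sequentially"
    using \<epsilon> by (intro order_tendstoD(2)) auto
  then obtain n where n: "\<theta> ^ Suc n * (hi - lo) < \<epsilon>" unfolding eventually_sequentially by blast
  define s where "s = real (Suc n) * r0"
  have s: "s > 0" unfolding s_def using r0 by simp
  obtain lo' hi' where b: "bump_band (\<lambda>x. exp s * killed_sg s g x) lo' hi'" and w: "hi' - lo' < \<epsilon>"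
    using it[of n] n unfolding s_def by auto
  have H: "bump_pairing bump > 0"
    using bump_gauss_lower(1) by (intro bump_pairing_pos[of _ "1/2"] bounded_borel_bump bump_nonneg) auto
  define L where "L = bump_pairing g / bump_pairing bump"
  have L: "lo' \<le> L" "L \<le> hi'"
    using bump_pairing_band[OF b] H unfolding bump_pairing_evolve[OF s gb] L_def by (auto simp: field_simps)
  \<comment> \<open>The margin 1 makes \<open>r - s\<close> strictly positive, as the semigroup
    facts require.\<close>
  have "\<bar>exp r * killed_sg r g x - L * bump x\<bar> \<le> \<epsilon> * bump x" if r: "r \<ge> s + 1" and x: "\<bar>x\<bar> < 1" for r x
  proof -
    have rs: "r - s > 0" using r by simp
    have "bump_band (\<lambda>x. exp r * killed_sg r g x) lo' hi'"
      using bump_band_evolve[OF rs b] comp[OF rs s] by simp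
    note band = bump_bandD(2,3)[OF this x]
    have "L * bump x \<le> hi' * bump x" "lo' * bump x \<le> L * bump x"
      using L bump_nonneg by (auto intro: mult_right_mono)
    moreover have "(hi' - lo') * bump x \<le> \<epsilon> * bump x" using w bump_nonneg by (intro mult_right_mono) auto
    then have "hi' * bump x - lo' * bump x \<le> \<epsilon> * bump x" by (simp add: algebra_simps)
    ultimately show ?thesis using band by (simp add: abs_le_iff)
  qed
  then show ?thesis unfolding L_def using s by (intro exI[of _ "s + 1"]) auto
qed

end

section \<open>Hitting times and occupation probabilities\<close>

text \<open>A path off the level at time \<open>T\<close> stays off it for a while longer, so the
  infimum of the hitting times exceeds \<open>T\<close> strictly. Strict inequalities for
  \<open>tauX\<close> and \<open>tauZ\<close> can therefore be read off the path up to
  \<open>T\<close>.\<close>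

lemma no_hit_iff_open:
  fixes p :: "real \<Rightarrow> real"
  assumes p: "continuous_on {s..} p" and T: "s \<le> T" and no: "\<forall>t\<in>{s..T}. \<bar>p t\<bar> \<noteq> 1"
  shows "\<exists>d>0. \<forall>t\<ge>s. \<bar>p t\<bar> = 1 \<longrightarrow> T + d \<le> t"
proof -
  have "continuous_on {s..} (\<lambda>t. \<bar>p t\<bar>)" using p by (intro continuous_intros)
  moreover have "0 < \<bar>\<bar>p T\<bar> - 1\<bar>" using no T by auto
  ultimately obtain d where d: "d > 0" "\<And>t. t \<in> {s..} \<Longrightarrow> dist t T < d \<Longrightarrow> dist \<bar>p t\<bar> \<bar>p T\<bar> < \<bar>\<bar>p T\<bar> - 1\<bar>"
    unfolding continuous_on_iff using T by (metis atLeast_iff)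
  have "T + d \<le> t" if "t \<ge> s" "\<bar>p t\<bar> = 1" for t
  proof (rule ccontr)
    assume "\<not> T + d \<le> t"
    moreover have "T < t" using no that by force
    ultimately have "dist t T < d" by (simp add: dist_real_def)
    from d(2)[OF _ this] that show False by (simp add: dist_real_def abs_minus_commute)
  qed
  then show ?thesis using d(1) by blast
qed

text \<open>By the intermediate value theorem. The hitting times speak of \<open>|p| = 1\<close>,
  the killed semigroup of \<open>|p| < 1\<close>; for paths that start inside the two agree.\<close>

lemma no_hit_iff_inside:
  fixes p :: "real \<Rightarrow> real"
  assumes p: "continuous_on {0..r} p" and p0: "\<bar>p 0\<bar> < 1" and r: "0 \<le> r"
  shows "(\<forall>v\<in>{0..r}. \<bar>p v\<bar> \<noteq> 1) \<longleftrightarrow> (\<forall>v\<in>{0..r}. \<bar>p v\<bar> < 1)"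
proof
  assume no: "\<forall>v\<in>{0..r}. \<bar>p v\<bar> \<noteq> 1"
  show "\<forall>v\<in>{0..r}. \<bar>p v\<bar> < 1"
  proof (rule ccontr)
    assume "\<not> ?thesis"
    then obtain v where v: "v \<in> {0..r}" "1 \<le> \<bar>p v\<bar>" by force
    have "continuous_on {0..v} (\<lambda>t. \<bar>p t\<bar>)"
      using v by (intro continuous_on_rabs continuous_on_subset[OF p]) auto
    then obtain z where "0 \<le> z" "z \<le> v" "\<bar>p z\<bar> = 1"
      using IVT'[of "\<lambda>t. \<bar>p t\<bar>" 0 1 v] v p0 by auto
    then show False using no v by auto
  qed
qed force

text \<open>The counterpart of \<open>inner_interval_tendsto\<close> for paths with an arbitrary
  starting point: the closed sets increase to the complement of the level, which gives measurability
  in the starting point on the whole line.\<close>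

lemma no_hit_tendsto:
  fixes p :: "real \<Rightarrow> real"
  assumes p: "continuous_on {0..r} p" and r: "0 \<le> r"
  shows "(\<lambda>m. of_bool (\<forall>v\<in>{0..r}. p v \<in> {y. 1 / real (Suc m) \<le> \<bar>\<bar>y\<bar> - 1\<bar>}) :: real)
    \<longlonglongrightarrow> of_bool (\<forall>v\<in>{0..r}. \<bar>p v\<bar> \<noteq> 1)"
proof (cases "\<forall>v\<in>{0..r}. \<bar>p v\<bar> \<noteq> 1")
  case True
  have "continuous_on {0..r} (\<lambda>v. \<bar>\<bar>p v\<bar> - 1\<bar>)" using p by (intro continuous_intros)
  then obtain z where z: "z \<in> {0..r}" "\<And>v. v \<in> {0..r} \<Longrightarrow> \<bar>\<bar>p z\<bar> - 1\<bar> \<le> \<bar>\<bar>p v\<bar> - 1\<bar>"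
    using continuous_attains_inf[of "{0..r}" "\<lambda>v. \<bar>\<bar>p v\<bar> - 1\<bar>"] r by auto
  have "0 < \<bar>\<bar>p z\<bar> - 1\<bar>" using True z by auto
  then have "eventually (\<lambda>m. 1 / real (Suc m) \<le> \<bar>\<bar>p z\<bar> - 1\<bar>) sequentially" by (rule eventually_grid_small)
  then have "eventually (\<lambda>m. (of_bool (\<forall>v\<in>{0..r}. p v \<in> {y. 1 / real (Suc m) \<le> \<bar>\<bar>y\<bar> - 1\<bar>}) :: real) = 1) sequentially"
  proof eventually_elim
    case (elim m)
    then have "\<forall>v\<in>{0..r}. p v \<in> {y. 1 / real (Suc m) \<le> \<bar>\<bar>y\<bar> - 1\<bar>}" using z(2) by (auto intro: order_trans)
    then show ?case by (rule of_bool_eq_1_iff[THEN iffD2])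
  qed
  then show ?thesis using True by (auto intro: tendsto_eventually)
next
  case False
  then have "\<not> (\<forall>v\<in>{0..r}. p v \<in> {y. 1 / real (Suc m) \<le> \<bar>\<bar>y\<bar> - 1\<bar>})" for m by force
  then show ?thesis using False by (simp only: of_bool_eq tendsto_const)
qed

text \<open>Time is rounded up to multiples of \<open>1 / real (Suc n)\<close>, of which there are
  countably many, and continuity of the paths passes to the limit. \<open>max 0\<close> is there
  because \<open>p\<close> is controlled only at nonnegative times.\<close>

lemma measurable_process_joint:
  fixes p :: "real \<Rightarrow> 'b \<Rightarrow> real"
  assumes m: "\<And>t. t \<ge> 0 \<Longrightarrow> p t \<in> borel_measurable N"
    and c: "\<And>w. w \<in> space N \<Longrightarrow> continuous_on {0..} (\<lambda>t. p t w)"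
  shows "(\<lambda>(t, w). p (max 0 t) w) \<in> borel_measurable (borel \<Otimes>\<^sub>M N)"
proof -
  define a where "a n t = real (nat \<lceil>max 0 t * real (Suc n)\<rceil>) / real (Suc n)" for n and t :: real
  have a0: "0 \<le> a n t" for n t
    unfolding a_def by (intro divide_nonneg_nonneg of_nat_0_le_iff)
  have lim: "(\<lambda>n. a n t) \<longlonglongrightarrow> max 0 t" for t
  proof (rule tendsto_sandwich[of "\<lambda>_. max 0 t" _ _ "\<lambda>n. max 0 t + 1 / real (Suc n)"])
    have c: "max 0 t * real (Suc n) \<le> real (nat \<lceil>max 0 t * real (Suc n)\<rceil>)" for n
      by (rule of_nat_ceiling)
    have "0 \<le> max 0 t * real (Suc n)" for n by simp
    then have d: "real (nat \<lceil>max 0 t * real (Suc n)\<rceil>) \<le> max 0 t * real (Suc n) + 1" for n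
      by (smt (verit, best) of_nat_nat of_int_ceiling_le_add_one zero_le_ceiling)
    show "\<forall>\<^sub>F n in sequentially. max 0 t \<le> a n t"
      unfolding a_def using c by (intro always_eventually allI, subst pos_le_divide_eq) auto
    have "a n t \<le> max 0 t + 1 / real (Suc n)" for n
    proof -
      have "a n t \<le> (max 0 t * real (Suc n) + 1) / real (Suc n)"
        unfolding a_def using d by (intro divide_right_mono) auto
      also have "\<dots> = max 0 t + 1 / real (Suc n)" by (simp add: add_divide_distrib del: of_nat_Suc)
      finally show ?thesis .
    qed
    then show "\<forall>\<^sub>F n in sequentially. a n t \<le> max 0 t + 1 / real (Suc n)" by simp
    have "(\<lambda>n. max 0 t + 1 / real (Suc n)) \<longlonglongrightarrow> max 0 t + 0"
      by (intro tendsto_add tendsto_const LIMSEQ_Suc lim_const_over_n)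
    then show "(\<lambda>n. max 0 t + 1 / real (Suc n)) \<longlonglongrightarrow> max 0 t" by simp
  qed simp
  show ?thesis
  proof (rule borel_measurable_LIMSEQ_real)
    fix n
    have 1: "(\<lambda>z. p (real i / real (Suc n)) (snd z)) \<in> borel_measurable (borel \<Otimes>\<^sub>M N)" for i
      using m[of "real i / real (Suc n)"] by measurable
    have "(\<lambda>z. p (real (nat \<lceil>max 0 (fst z) * real (Suc n)\<rceil>) / real (Suc n)) (snd z)) \<in> borel_measurable (borel \<Otimes>\<^sub>M N)"
      by (rule measurable_compose_countable[OF 1]) measurable
    then show "(\<lambda>z. p (a n (fst z)) (snd z)) \<in> borel_measurable (borel \<Otimes>\<^sub>M N)" unfolding a_def .
  next
    fix z :: "real \<times> 'b" assume "z \<in> space (borel \<Otimes>\<^sub>M N)"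
    then have "snd z \<in> space N" by (auto simp: space_pair_measure)
    have "(\<lambda>n. p (a n (fst z)) (snd z)) \<longlonglongrightarrow> p (max 0 (fst z)) (snd z)"
      by (rule continuous_on_tendsto_compose[OF c[OF \<open>snd z \<in> space N\<close>] lim])
         (simp_all add: a0)
    then show "(\<lambda>n. p (a n (fst z)) (snd z)) \<longlonglongrightarrow> (case z of (t, w) \<Rightarrow> p (max 0 t) w)"
      by (simp add: split_beta)
  qed
qed

text \<open>The layer-cake formula after the substitution \<open>v = exp (- t)\<close>, for which
  \<open>dv / v\<close> becomes \<open>dt\<close>. It concerns a single extended value, so it
  applies path by path, including to paths that never hit.\<close>

lemma nn_integral_log_tail:
  "(\<integral>\<^sup>+v. indicator {0<..<1} v * (ennreal (1 / v) * indicator {v. ennreal (- ln v) < \<tau>} v) \<partial>lborel) = \<tau>" (is "?I \<tau> = \<tau>")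
proof -
  have fin: "?I (ennreal t) = ennreal t" if t: "t \<ge> 0" for t
  proof -
    have e: "exp (- t) \<le> 1" using t by simp
    have "?I (ennreal t) = (\<integral>\<^sup>+v. ennreal (1 / v) * indicator {exp (- t)..1} v \<partial>lborel)"
    proof (rule nn_integral_cong_AE)
      have "AE v in lborel. v \<noteq> exp (- t) \<and> v \<noteq> (1::real)"
        using AE_lborel_singleton[of "exp (- t)"] AE_lborel_singleton[of "1::real"] by eventually_elim simp
      then show "AE v in lborel. indicator {0<..<1} v * (ennreal (1 / v) * indicator {v. ennreal (- ln v) < ennreal t} v)
        = ennreal (1 / v) * indicator {exp (- t)..1} v"
      proof eventually_elim
        case (elim v)
        show ?case
        proof (cases "0 < v \<and> v < 1")
          case True
          then have "ennreal (- ln v) < ennreal t \<longleftrightarrow> - t < ln v" by (auto simp: ennreal_less_iff)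
          also have "\<dots> \<longleftrightarrow> exp (- t) < v" using True by (metis exp_less_mono exp_ln ln_exp ln_less_cancel_iff exp_gt_zero)
          finally show ?thesis using True elim by (auto simp: indicator_def)
        next
          case False
          have "v \<notin> {exp (- t)..1}"
          proof
            assume "v \<in> {exp (- t)..1}"
            then have "exp (- t) \<le> v" "v \<le> 1" by auto
            moreover from this(1) have "0 < v" by (rule less_le_trans[OF exp_gt_zero])
            ultimately show False using False elim by auto
          qed
          moreover have "v \<notin> {0<..<1}" using False by auto
          ultimately show ?thesis by simp
        qed
      qed
    qed
    also have "\<dots> = ennreal (ln 1 - ln (exp (- t)))"
    proof (rule nn_integral_FTC_Icc[OF _ _ _ e])
      show "(ln has_real_derivative 1 / v) (at v)" if "v \<in> {exp (- t)..1}" for v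
      proof -
        have "0 < v" using that less_le_trans[OF exp_gt_zero[of "- t"], of v] by auto
        then show ?thesis by (auto intro!: derivative_eq_intros)
      qed
      show "0 \<le> 1 / v" if "v \<in> {exp (- t)..1}" for v
        using that less_le_trans[OF exp_gt_zero[of "- t"], of v] by auto
    qed measurable
    finally show ?thesis by simp
  qed
  show ?thesis
  proof (cases \<tau>)
    case (real t)
    then show ?thesis using fin by simp
  next
    case top
    have "ennreal (real n) \<le> ?I \<top>" for n
    proof -
      have "ennreal (real n) = ?I (ennreal (real n))" using fin by simp
      also have "\<dots> \<le> ?I \<top>"
        by (intro nn_integral_mono mult_left_mono) (auto simp: indicator_def)
      finally show ?thesis .
    qed
    then have "(SUP n. of_nat n :: ennreal) \<le> ?I \<top>"
      by (intro SUP_least) (simp add: ennreal_of_nat_eq_real_of_nat)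
    then have "?I \<top> = \<top>" by (simp add: ennreal_SUP_of_nat_eq_top top_unique)
    then show ?thesis using top by simp
  qed
qed

text \<open>Brownian scaling. With \<open>c = s + 1\<close> it yields the motion whose
  Ornstein-Uhlenbeck process is the time-changed \<open>X\<close>.\<close>

lemma std_BM_scale:
  assumes BM: "std_BM M W" and c: "c > 0"
  shows "std_BM M (\<lambda>v \<omega>. W (c * v) \<omega> / sqrt c)"
proof -
  interpret brownian M W by (rule brownian.intro[OF BM])
  show ?thesis unfolding std_BM_def
  proof (intro conjI allI impI ballI)
    show "prob_space M" by unfold_locales
    show "(\<lambda>\<omega>. W (c * t) \<omega> / sqrt c) \<in> borel_measurable M" if "0 \<le> t" for t
      using W_measurable[of "c * t"] c that by simp
    show "W (c * 0) \<omega> / sqrt c = 0" if "\<omega> \<in> space M" for \<omega> using W_0[OF that] by simp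
    show "continuous_on {0..} (\<lambda>t. W (c * t) \<omega> / sqrt c)" if "\<omega> \<in> space M" for \<omega>
    proof -
      have "continuous_on {0..} (\<lambda>t. W (c * t) \<omega>)"
        by (rule continuous_on_compose2[OF W_continuous[OF that]]) (use c in \<open>auto intro!: continuous_intros\<close>)
      then show ?thesis using c by (intro continuous_intros) auto
    qed
    show "distributed M lborel (\<lambda>\<omega>. W (c * t) \<omega> / sqrt c - W (c * s) \<omega> / sqrt c) (normal_density 0 (sqrt (t - s)))"
      if "0 \<le> s \<and> s < t" for s t
    proof -
      have st: "0 \<le> c * s" "c * s < c * t" using that c by auto
      have "distributed M lborel (\<lambda>\<omega>. 0 + 1 / sqrt c * (W (c * t) \<omega> - W (c * s) \<omega>))
          (normal_density (0 + 1 / sqrt c * 0) (\<bar>1 / sqrt c\<bar> * sqrt (c * t - c * s)))"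
        by (rule normal_density_affine[OF W_increment[OF st]]) (use st c in auto)
      moreover have "\<bar>1 / sqrt c\<bar> * sqrt (c * t - c * s) = sqrt (t - s)"
        using c that by (simp add: real_sqrt_mult flip: right_diff_distrib)
      ultimately show ?thesis by (simp add: diff_divide_distrib)
    qed
    show "indep_vars (\<lambda>_. borel) (\<lambda>i \<omega>. W (c * ts (Suc i)) \<omega> / sqrt c - W (c * ts i) \<omega> / sqrt c) {..<n}"
      if "0 \<le> ts 0 \<and> (\<forall>i<n. ts i < ts (Suc i))" for ts :: "nat \<Rightarrow> real" and n
    proof -
      have "indep_vars (\<lambda>_. borel) (\<lambda>i \<omega>. W (c * ts (Suc i)) \<omega> - W (c * ts i) \<omega>) {..<n}"
        using W_indep[of "\<lambda>i. c * ts i" n] that c by auto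
      then have "indep_vars (\<lambda>_. borel) (\<lambda>i. (\<lambda>y. y / sqrt c) \<circ> (\<lambda>\<omega>. W (c * ts (Suc i)) \<omega> - W (c * ts i) \<omega>)) {..<n}"
        by (rule indep_vars_compose) auto
      then show ?thesis by (simp add: o_def diff_divide_distrib)
    qed
  qed
qed

text \<open>The limit of the conditional probability at lag \<open>q = - ln v\<close>; the first
  factor is \<open>exp q\<close>. It is meaningful for \<open>0 < v < 1\<close>, where the lag is a
  positive time.\<close>

abbreviation lagged_occupation :: "real set \<Rightarrow> real \<Rightarrow> real" where
  "lagged_occupation S v \<equiv> 1 / v * (K_OU * bump_pairing (\<lambda>y. indicator S y * killed_sg (- ln v) (\<lambda>_. 1) y))"

lemma bump_pairing_1: "K_OU = 1 / bump_pairing (\<lambda>_. 1)"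
proof -
  have "(LINT x:{-1<..<1}|lborel. (1 - x\<^sup>2) * exp (- x\<^sup>2 / 2)) = bump_pairing (\<lambda>_. 1)"
    unfolding bump_pairing_def set_lebesgue_integral_def
    by (rule Bochner_Integration.integral_cong) (auto simp: indicator_def bump_def)
  then show ?thesis unfolding K_OU_def by simp
qed

lemma bump_pairing_1_pos: "bump_pairing (\<lambda>_. 1) > 0"
  by (rule bump_pairing_pos[of _ 1]) auto

lemma nn_integral_alpha_OU:
  assumes f: "bounded_borel f" "\<And>x. \<bar>x\<bar> < 1 \<Longrightarrow> 0 \<le> f x"
  shows "(\<integral>\<^sup>+x. ennreal (f x) \<partial>alpha_OU) = ennreal (K_OU * bump_pairing f)"
proof -
  have [measurable]: "f \<in> borel_measurable borel" using f by (auto intro: bounded_borel_measurable)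
  have K: "K_OU > 0" unfolding bump_pairing_1 using bump_pairing_1_pos by simp
  have "(\<integral>\<^sup>+x. ennreal (f x) \<partial>alpha_OU) =
      (\<integral>\<^sup>+x. ennreal (indicator {-1<..<1} x * K_OU * (1 - x\<^sup>2) * exp (- x\<^sup>2 / 2)) * ennreal (f x) \<partial>lborel)"
    unfolding alpha_OU_def by (rule nn_integral_density) auto
  also have "\<dots> = (\<integral>\<^sup>+x. ennreal (K_OU * (indicator {-1<..<1} x * (f x * (bump x * exp (- x\<^sup>2 / 2))))) \<partial>lborel)"
  proof (rule nn_integral_cong)
    fix x :: real
    show "ennreal (indicator {-1<..<1} x * K_OU * (1 - x\<^sup>2) * exp (- x\<^sup>2 / 2)) * ennreal (f x) =
      ennreal (K_OU * (indicator {-1<..<1} x * (f x * (bump x * exp (- x\<^sup>2 / 2)))))"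
    proof (cases "\<bar>x\<bar> < 1")
      case True
      then have x: "x \<in> {-1<..<1}" by auto
      have "0 \<le> K_OU * (1 - x\<^sup>2) * exp (- x\<^sup>2 / 2)" using K True by (simp add: abs_square_le_1)
      then show ?thesis using x True f(2)[OF True]
        by (simp add: bump_def mult_ac flip: ennreal_mult)
    next
      case False
      then have "x \<notin> {-1<..<1}" by auto
      then show ?thesis by simp
    qed
  qed
  also have "\<dots> = ennreal (\<integral>x. K_OU * (indicator {-1<..<1} x * (f x * (bump x * exp (- x\<^sup>2 / 2)))) \<partial>lborel)"
    using K f by (intro nn_integral_eq_integral integrable_mult_right integrable_bump_pairing AE_I2)
      (auto simp: indicator_def bump_nonneg)
  finally show ?thesis by (simp add: bump_pairing_def)
qed

section \<open>Occupation probabilities and their measurability\<close>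

context brownian
begin

lemma OU_joint_measurable:
  "(\<lambda>(r, x, \<omega>). OUproc W x (max 0 r) \<omega>) \<in> borel_measurable (borel \<Otimes>\<^sub>M (borel \<Otimes>\<^sub>M M))"
proof -
  have "(\<lambda>(r, z). OUproc W (fst z) (max 0 r) (snd z)) \<in> borel_measurable (borel \<Otimes>\<^sub>M (borel \<Otimes>\<^sub>M M))"
  proof (rule measurable_process_joint)
    fix t :: real assume t: "t \<ge> 0"
    have [measurable]: "W (exp t - 1) \<in> borel_measurable M" using t by (intro W_measurable) simp
    show "(\<lambda>z. OUproc W (fst z) t (snd z)) \<in> borel_measurable (borel \<Otimes>\<^sub>M M)"
      unfolding OUproc_def by measurable
  qed (auto simp: space_pair_measure intro: OU_continuous)
  then show ?thesis by (simp add: split_beta')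
qed

lemma OU_pair_measurable:
  assumes "r \<ge> 0" shows "(\<lambda>z. OUproc W (fst z) r (snd z)) \<in> borel_measurable (borel \<Otimes>\<^sub>M M)"
proof -
  have [measurable]: "W (exp r - 1) \<in> borel_measurable M" using assms by (intro W_measurable) simp
  show ?thesis unfolding OUproc_def by measurable
qed

text \<open>Phrased by the level rather than by staying inside, so that it describes
  \<open>tauZ\<close> for every starting point and not only for those in
  \<open>(-1, 1)\<close>.\<close>

definition nohit :: "real \<Rightarrow> real \<Rightarrow> 'a \<Rightarrow> bool" where
  "nohit r x \<omega> \<longleftrightarrow> (\<forall>v\<in>{0..r}. \<bar>OUproc W x v \<omega>\<bar> \<noteq> 1)"

lemma nohit_measurable:
  assumes r: "r \<ge> 0"
  shows "(\<lambda>z. of_bool (nohit r (fst z) (snd z)) :: real) \<in> borel_measurable (borel \<Otimes>\<^sub>M M)"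
proof (cases "r = 0")
  \<comment> \<open>The grid limits are available for \<open>r > 0\<close> only, so time zero is
    treated directly.\<close>
  case True
  note [measurable] = OU_pair_measurable[of 0, OF order_refl]
  have "(\<lambda>z. of_bool (\<bar>OUproc W (fst z) 0 (snd z)\<bar> \<noteq> 1) :: real) \<in> borel_measurable (borel \<Otimes>\<^sub>M M)"
    by measurable
  then show ?thesis unfolding nohit_def True by simp
next
  case False
  then have r: "r > 0" using assms by simp
  let ?C = "\<lambda>m. {y :: real. 1 / real (Suc m) \<le> \<bar>\<bar>y\<bar> - 1\<bar>}"
  have C: "closed (?C m)" for m by (intro closed_Collect_le continuous_intros)
  have conf: "(\<lambda>z. stays (?C m) (fst z) 0 r (snd z) :: real) \<in> borel_measurable (borel \<Otimes>\<^sub>M M)" for m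
  proof (rule borel_measurable_LIMSEQ_real)
    fix N
    have Cs: "?C m \<in> sets borel" using C by auto
    show "(\<lambda>z. \<Prod>i\<in>{0<..Suc N}. indicator (?C m) (OUproc W (fst z) (0 + real i * (r / real (Suc N))) (snd z)) :: real) \<in> borel_measurable (borel \<Otimes>\<^sub>M M)"
      using r Cs by (intro borel_measurable_prod measurable_compose[OF OU_pair_measurable borel_measurable_indicator]) auto
  next
    fix z :: "real \<times> 'a" assume "z \<in> space (borel \<Otimes>\<^sub>M M)"
    then have z: "snd z \<in> space M" by (auto simp: space_pair_measure)
    show "(\<lambda>N. \<Prod>i\<in>{0<..Suc N}. indicator (?C m) (OUproc W (fst z) (0 + real i * (r / real (Suc N))) (snd z)) :: real)
      \<longlonglongrightarrow> stays (?C m) (fst z) 0 r (snd z)"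
      using grid_OU_tendsto[OF C[of m] r z, of 0 "fst z"] by simp
  qed
  show ?thesis unfolding nohit_def
  proof (rule borel_measurable_LIMSEQ_real[OF _ conf])
    fix z :: "real \<times> 'a" assume "z \<in> space (borel \<Otimes>\<^sub>M M)"
    then have z: "snd z \<in> space M" by (auto simp: space_pair_measure)
    show "(\<lambda>m. stays (?C m) (fst z) 0 r (snd z) :: real)
      \<longlonglongrightarrow> of_bool (\<forall>v\<in>{0..r}. \<bar>OUproc W (fst z) v (snd z)\<bar> \<noteq> 1)"
      using r by (intro no_hit_tendsto OU_continuous_on z) auto
  qed
qed

lemma nohit_iff_inside:
  assumes "\<omega> \<in> space M" "\<bar>x\<bar> < 1" "r \<ge> 0"
  shows "nohit r x \<omega> \<longleftrightarrow> (\<forall>v\<in>{0..r}. \<bar>OUproc W x v \<omega>\<bar> < 1)"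
  unfolding nohit_def using assms
  by (intro no_hit_iff_inside OU_continuous_on) (auto simp: OU_0)

lemma tauZ_gt_iff:
  assumes \<omega>: "\<omega> \<in> space M" and r: "r \<ge> 0"
  shows "ennreal r < tauZ W x \<omega> \<longleftrightarrow> nohit r x \<omega>"
proof
  assume gt: "ennreal r < tauZ W x \<omega>"
  show "nohit r x \<omega>" unfolding nohit_def
  proof (intro ballI notI)
    fix v assume v: "v \<in> {0..r}" "\<bar>OUproc W x v \<omega>\<bar> = 1"
    then have "tauZ W x \<omega> \<le> ennreal v" unfolding tauZ_def by (intro Inf_lower) auto
    also have "\<dots> \<le> ennreal r" using v by (intro ennreal_leI) auto
    finally show False using gt by simp
  qed
next
  assume "nohit r x \<omega>"
  then obtain d where d: "d > 0" "\<And>t. t \<ge> 0 \<Longrightarrow> \<bar>OUproc W x t \<omega>\<bar> = 1 \<Longrightarrow> r + d \<le> t"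
    using no_hit_iff_open[OF OU_continuous[OF \<omega>] r, of x] unfolding nohit_def by blast
  have "ennreal r < ennreal (r + d)" using r d by (simp add: ennreal_less_iff)
  also have "\<dots> \<le> tauZ W x \<omega>" unfolding tauZ_def
    by (intro Inf_greatest) (auto intro!: ennreal_leI d(2))
  finally show "ennreal r < tauZ W x \<omega>" .
qed

lemma tauZ_measurable: "(\<lambda>z. tauZ W (fst z) (snd z)) \<in> borel_measurable (borel \<Otimes>\<^sub>M M)"
proof (rule borel_measurableI_greater)
  fix y :: ennreal
  show "{z \<in> space (borel \<Otimes>\<^sub>M M). y < tauZ W (fst z) (snd z)} \<in> sets (borel \<Otimes>\<^sub>M M)"
  proof (cases y)
    case (real r)
    note [measurable] = nohit_measurable[OF real(1)]
    have "{z \<in> space (borel \<Otimes>\<^sub>M M). y < tauZ W (fst z) (snd z)} =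
        {z \<in> space (borel \<Otimes>\<^sub>M M). (of_bool (nohit r (fst z) (snd z)) :: real) = 1}"
      using real tauZ_gt_iff by (auto simp: space_pair_measure)
    also have "\<dots> \<in> sets (borel \<Otimes>\<^sub>M M)" by measurable
    finally show ?thesis .
  qed simp
qed

text \<open>\<open>max 0 \<rho>\<close> makes the expression jointly measurable for all real
  \<open>\<rho>\<close>; in the application \<open>\<rho> = R + ln v\<close> is negative while
  \<open>R\<close> is small. For \<open>S = UNIV\<close> the value is the survival probability,
  whatever \<open>\<rho>\<close> is.\<close>

definition occupation :: "real set \<Rightarrow> real \<Rightarrow> real \<Rightarrow> real \<Rightarrow> real" where
  "occupation S \<rho> r x = (\<integral>\<omega>. indicator S (OUproc W x (max 0 \<rho>) \<omega>) * of_bool (nohit r x \<omega>) \<partial>M)"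

lemma occupation_joint_measurable:
  assumes "r \<ge> 0" "S \<in> sets borel"
  shows "(\<lambda>z. occupation S (fst z) r (snd z)) \<in> borel_measurable (borel \<Otimes>\<^sub>M borel)"
proof -
  note [measurable] = assms(2) nohit_measurable[OF assms(1)]
  have [measurable]: "(\<lambda>w. OUproc W (snd (fst w)) (max 0 (fst (fst w))) (snd w)) \<in> borel_measurable ((borel \<Otimes>\<^sub>M borel) \<Otimes>\<^sub>M M)"
    using measurable_compose[OF _ OU_joint_measurable, of "\<lambda>w. (fst (fst w), snd (fst w), snd w)" "(borel \<Otimes>\<^sub>M borel) \<Otimes>\<^sub>M M"]
    by simp
  have [measurable]: "(\<lambda>w. of_bool (nohit r (snd (fst w)) (snd w)) :: real) \<in> borel_measurable ((borel \<Otimes>\<^sub>M borel) \<Otimes>\<^sub>M M)"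
    using measurable_compose[OF _ nohit_measurable[OF assms(1)], of "\<lambda>w. (snd (fst w), snd w)" "(borel \<Otimes>\<^sub>M borel) \<Otimes>\<^sub>M M"]
    by simp
  have "(\<lambda>(z, \<omega>). indicator S (OUproc W (snd z) (max 0 (fst z)) \<omega>) * of_bool (nohit r (snd z) \<omega>) :: real)
    \<in> borel_measurable ((borel \<Otimes>\<^sub>M borel) \<Otimes>\<^sub>M M)"
    unfolding split_beta' by measurable
  then show ?thesis unfolding occupation_def by (rule borel_measurable_lebesgue_integral)
qed

lemma occupation_measurable:
  assumes "r \<ge> 0" "S \<in> sets borel"
  shows "occupation S \<rho> r \<in> borel_measurable borel"
  using measurable_compose[OF _ occupation_joint_measurable[OF assms], of "\<lambda>x. (\<rho>, x)" borel] by simp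

lemma occupation_bounds:
  assumes r: "r \<ge> 0" and S: "S \<in> sets borel"
  shows "0 \<le> occupation S \<rho> r x" "occupation S \<rho> r x \<le> occupation UNIV \<rho>' r x" "occupation UNIV \<rho>' r x \<le> 1"
proof -
  have nm[measurable]: "(\<lambda>\<omega>. of_bool (nohit r x \<omega>) :: real) \<in> borel_measurable M"
    using measurable_compose[OF _ nohit_measurable[OF r], of "\<lambda>\<omega>. (x, \<omega>)" M] by simp
  have im: "(\<lambda>\<omega>. indicator S (OUproc W x (max 0 \<rho>) \<omega>) :: real) \<in> borel_measurable M"
    using S by (intro measurable_compose[OF OU_measurable borel_measurable_indicator]) auto
  have i1: "integrable M (\<lambda>\<omega>. of_bool (nohit r x \<omega>) :: real)"
    by (rule integrable_bounded_comp[where C=1]) auto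
  have i2: "integrable M (\<lambda>\<omega>. indicator S (OUproc W x (max 0 \<rho>) \<omega>) * of_bool (nohit r x \<omega>) :: real)"
    by (rule integrable_bounded_comp[where C=1, OF borel_measurable_times[OF im nm]]) (auto simp: indicator_def)
  show "0 \<le> occupation S \<rho> r x" unfolding occupation_def by (intro integral_nonneg_AE AE_I2) auto
  show "occupation S \<rho> r x \<le> occupation UNIV \<rho>' r x" unfolding occupation_def
    using i1 i2 by (intro integral_mono) (auto simp: indicator_def)
  have "(\<integral>\<omega>. of_bool (nohit r x \<omega>) \<partial>M) \<le> (\<integral>\<omega>. (1::real) \<partial>M)"
    using i1 by (intro integral_mono) auto
  then show "occupation UNIV \<rho>' r x \<le> 1" unfolding occupation_def by (simp add: prob_space)
qed

text \<open>The Markov property at time \<open>\<rho>\<close>, with the indicator of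
  \<open>S\<close> as intermediate weight and 1 as final one. Starting inside makes the absence of
  hits the same as confinement.\<close>

lemma occupation_eq_killed_sg:
  assumes x: "\<bar>x\<bar> < 1" and S: "S \<in> sets borel" and r: "0 < \<rho>" "\<rho> < r"
  shows "occupation S \<rho> r x = killed_sg \<rho> (\<lambda>y. indicator S y * killed_sg (r - \<rho>) (\<lambda>_. 1) y) x"
proof -
  have "occupation S \<rho> r x = (\<integral>\<omega>. alive x 0 (\<rho> + (r - \<rho>)) \<omega> *
      (indicator S (OUproc W x \<rho> \<omega>) * (\<lambda>_. 1) (OUproc W x (\<rho> + (r - \<rho>)) \<omega>)) \<partial>M)"
    unfolding occupation_def using r x
    by (intro Bochner_Integration.integral_cong) (auto simp: nohit_iff_inside max_def)
  also have "\<dots> = killed_sg \<rho> (\<lambda>y. indicator S y * killed_sg (r - \<rho>) (\<lambda>_. 1) y) x"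
    using r S by (intro killed_markov bounded_borel_indicator) auto
  finally show ?thesis .
qed

lemma occupation_UNIV_eq_killed_sg:
  assumes x: "\<bar>x\<bar> < 1" and r: "0 < r"
  shows "occupation UNIV \<rho> r x = killed_sg r (\<lambda>_. 1) x"
  unfolding occupation_def killed_sg_eq[OF r bounded_borel_const] using r x
  by (intro Bochner_Integration.integral_cong) (auto simp: nohit_iff_inside)

section \<open>Limits of conditional probabilities\<close>

lemma killed_sg_1_nonneg:
  assumes "r > 0" shows "0 \<le> killed_sg r (\<lambda>_. 1) x"
  unfolding killed_sg_eq[OF assms bounded_borel_const] by (intro integral_nonneg_AE AE_I2) auto

text \<open>The constant 1 lies in no band, since it does not vanish at the boundary; after a
  positive time \<open>q\<close> the survival bound puts its image into one.\<close>

lemma survival_band: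
  assumes q: "q > 0" and S: "S \<in> sets borel"
  shows "bump_band (\<lambda>y. indicator S y * killed_sg q (\<lambda>_. 1) y) 0 (6 / q)"
  unfolding bump_band_def
proof (intro conjI allI impI)
  show "bounded_borel (\<lambda>y. indicator S y * killed_sg q (\<lambda>_. 1) y)"
    using S by (intro bounded_borel_indicator_mult bounded_borel_killed_sg q bounded_borel_const)
  fix x :: real assume x: "\<bar>x\<bar> < 1"
  show "0 * bump x \<le> indicator S x * killed_sg q (\<lambda>_. 1) x" using killed_sg_1_nonneg[OF q] by simp
  have "0 \<le> 6 / q * bump x" using q bump_nonneg[of x] by simp
  then show "indicator S x * killed_sg q (\<lambda>_. 1) x \<le> 6 / q * bump x"
    using killed_sg_survival[OF q x] by (auto simp: indicator_def)
qed

text \<open>The error is uniform relative to \<open>bump\<close>, and \<open>bump\<close> is at most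
  1, so the convergence integrates against any probability measure carried by
  \<open>(-1, 1)\<close>.\<close>

lemma integral_killed_sg_tendsto:
  assumes \<mu>: "prob_space \<mu>" "sets \<mu> = sets borel" "AE x in \<mu>. \<bar>x\<bar> < 1" and g: "bump_band g lo hi"
  shows "((\<lambda>r. exp r * (\<integral>x. killed_sg r g x \<partial>\<mu>)) \<longlongrightarrow> bump_pairing g / bump_pairing bump * (\<integral>x. bump x \<partial>\<mu>)) at_top"
proof (rule tendstoI)
  interpret \<mu>: prob_space \<mu> by (rule \<mu>(1))
  have meas: "f \<in> borel_measurable \<mu>" if "f \<in> borel_measurable borel" for f :: "real \<Rightarrow> real"
    using that measurable_cong_sets[OF \<mu>(2) refl] by blast
  have int: "integrable \<mu> f" if b: "bounded_borel f" for f
  proof -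
    obtain C where "\<And>x. \<bar>f x\<bar> \<le> C" using b bounded_borelE by blast
    then show ?thesis using meas[OF bounded_borel_measurable[OF b]] by (intro \<mu>.integrable_const_bound[where B=C]) auto
  qed
  fix e :: real assume e: "e > 0"
  define L where "L = bump_pairing g / bump_pairing bump"
  obtain R where R: "R > 0" "\<And>r x. r \<ge> R \<Longrightarrow> \<bar>x\<bar> < 1 \<Longrightarrow> \<bar>exp r * killed_sg r g x - L * bump x\<bar> \<le> e / 2 * bump x"
    using killed_sg_convergence[OF g half_gt_zero[OF e]] unfolding L_def by blast
  have "dist (exp r * (\<integral>x. killed_sg r g x \<partial>\<mu>)) (L * (\<integral>x. bump x \<partial>\<mu>)) < e" if r: "r \<ge> R" for r
  proof -
    have ik: "integrable \<mu> (killed_sg r g)"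
      using r R by (intro int bounded_borel_killed_sg bump_bandD(1)[OF g]) auto
    note ib = int[OF bounded_borel_bump]
    have "\<bar>exp r * (\<integral>x. killed_sg r g x \<partial>\<mu>) - L * (\<integral>x. bump x \<partial>\<mu>)\<bar> = \<bar>\<integral>x. exp r * killed_sg r g x - L * bump x \<partial>\<mu>\<bar>"
      using ik ib by simp
    also have "\<dots> \<le> (\<integral>x. \<bar>exp r * killed_sg r g x - L * bump x\<bar> \<partial>\<mu>)" by (rule integral_abs_bound)
    also have "\<dots> \<le> (\<integral>x. e / 2 \<partial>\<mu>)"
    proof (rule integral_mono_AE)
      show "integrable \<mu> (\<lambda>x. \<bar>exp r * killed_sg r g x - L * bump x\<bar>)"
        using ik ib by (intro integrable_abs Bochner_Integration.integrable_diff integrable_mult_right)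
      show "AE x in \<mu>. \<bar>exp r * killed_sg r g x - L * bump x\<bar> \<le> e / 2"
        using \<mu>(3)
      proof eventually_elim
        case (elim x)
        have "e / 2 * bump x \<le> e / 2 * 1" using e bump_le_1 by (intro mult_left_mono) auto
        then show ?case using R(2)[OF r elim] by linarith
      qed
    qed simp
    also have "\<dots> < e" using e by (simp add: \<mu>.prob_space)
    finally show ?thesis by (simp add: dist_real_def)
  qed
  then show "\<forall>\<^sub>F r in at_top. dist (exp r * (\<integral>x. killed_sg r g x \<partial>\<mu>)) (bump_pairing g / bump_pairing bump * (\<integral>x. bump x \<partial>\<mu>)) < e"
    unfolding L_def eventually_at_top_linorder by blast
qed

text \<open>Numerator and denominator decay at the same exponential rate and carry the same factor,
  the \<open>\<mu>\<close>-integral of \<open>bump\<close>. It is positive and cancels, which is why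
  the limit forgets the initial law.\<close>

lemma occupation_ratio_tendsto:
  assumes \<mu>: "prob_space \<mu>" "sets \<mu> = sets borel" "AE x in \<mu>. \<bar>x\<bar> < 1"
    and S: "S \<in> sets borel" and v: "0 < v" "v < 1"
  shows "((\<lambda>R. (\<integral>x. occupation S (R + ln v) R x \<partial>\<mu>) / (\<integral>x. occupation UNIV 0 R x \<partial>\<mu>))
    \<longlongrightarrow> lagged_occupation S v) at_top"
proof -
  interpret \<mu>: prob_space \<mu> by (rule \<mu>(1))
  have meas: "f \<in> borel_measurable \<mu>" if "f \<in> borel_measurable borel" for f :: "real \<Rightarrow> real"
    using that measurable_cong_sets[OF \<mu>(2) refl] by blast
  define q where "q = - ln v"
  have q: "q > 0" using v by (simp add: q_def)
  define g where "g y = indicator S y * killed_sg q (\<lambda>_. 1) y" for y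
  \<comment> \<open>One unit of the survival time in the denominator is spent on turning the
    constant 1 into a function that lies in a band.\<close>
  define g1 where "g1 y = indicator UNIV y * killed_sg 1 (\<lambda>_. 1) y" for y :: real
  have g: "bump_band g 0 (6 / q)" unfolding g_def by (rule survival_band[OF q S])
  have g1: "bump_band g1 0 (6 / 1)" unfolding g1_def by (rule survival_band) auto
  define m where "m = (\<integral>x. bump x \<partial>\<mu>)"
  have m: "m > 0"
  proof -
    have bi: "integrable \<mu> bump"
      by (rule \<mu>.integrable_const_bound[where B=1]) (auto simp: bump_nonneg bump_le_1 intro: meas)
    have "m \<ge> 0" unfolding m_def by (intro integral_nonneg_AE AE_I2 bump_nonneg)
    moreover have "m \<noteq> 0"
    proof
      assume "m = 0"
      then have "AE x in \<mu>. bump x = 0"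
        unfolding m_def using integral_nonneg_eq_0_iff_AE[OF bi] bump_nonneg by simp
      then have "AE x in \<mu>. False" using \<mu>(3)
      proof eventually_elim
        case (elim x) then show ?case using bump_pos[of x] by simp
      qed
      then show False by simp
    qed
    ultimately show ?thesis by simp
  qed
  have H: "bump_pairing bump > 0"
    using bump_gauss_lower(1) by (intro bump_pairing_pos[of _ "1/2"] bounded_borel_bump bump_nonneg) auto
  have sh: "filterlim (\<lambda>R. R - c) at_top at_top" for c :: real
    using filterlim_tendsto_add_at_top[OF tendsto_const filterlim_ident, of "- c"] by simp
  have l1: "((\<lambda>R. exp (R - q) * (\<integral>x. killed_sg (R - q) g x \<partial>\<mu>)) \<longlongrightarrow> bump_pairing g / bump_pairing bump * m) at_top"
    unfolding m_def by (rule filterlim_compose[OF integral_killed_sg_tendsto[OF \<mu> g] sh])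
  have l2: "((\<lambda>R. exp (R - 1) * (\<integral>x. killed_sg (R - 1) g1 x \<partial>\<mu>)) \<longlongrightarrow> bump_pairing g1 / bump_pairing bump * m) at_top"
    unfolding m_def by (rule filterlim_compose[OF integral_killed_sg_tendsto[OF \<mu> g1] sh])
  have "exp 1 * bump_pairing g1 = bump_pairing (\<lambda>_. 1)"
    using bump_pairing_evolve[OF _ bounded_borel_const[of 1], of 1] by (simp add: bump_pairing_cmult g1_def[abs_def])
  then have p1: "bump_pairing g1 = exp (- 1) * bump_pairing (\<lambda>_. 1)" by (simp add: exp_minus field_simps)
  have nz: "bump_pairing g1 / bump_pairing bump * m \<noteq> 0" using m H bump_pairing_1_pos by (simp add: p1)
  \<comment> \<open>The factor \<open>exp (q - 1)\<close> balances the shifts \<open>R - q\<close>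
    and \<open>R - 1\<close>. Its part \<open>exp q = 1 / v\<close> is the weight in the limit, and
    \<open>exp (- 1)\<close> cancels against the pairing of \<open>g1\<close>.\<close>
  have "((\<lambda>R. exp (q - 1) * (exp (R - q) * (\<integral>x. killed_sg (R - q) g x \<partial>\<mu>) / (exp (R - 1) * (\<integral>x. killed_sg (R - 1) g1 x \<partial>\<mu>))))
    \<longlongrightarrow> exp (q - 1) * ((bump_pairing g / bump_pairing bump * m) / (bump_pairing g1 / bump_pairing bump * m))) at_top"
    by (intro tendsto_intros l1 l2 nz)
  moreover have "exp (q - 1) * ((bump_pairing g / bump_pairing bump * m) / (bump_pairing g1 / bump_pairing bump * m))
      = 1 / v * (K_OU * bump_pairing g)"
  proof -
    have "exp (q - 1) = exp q * exp (- 1)" by (simp flip: exp_add)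
    moreover have "exp q = 1 / v" unfolding q_def using v by (simp add: exp_minus inverse_eq_divide)
    ultimately show ?thesis using m H bump_pairing_1_pos by (simp add: p1 bump_pairing_1)
  qed
  moreover have "eventually (\<lambda>R. exp (q - 1) * (exp (R - q) * (\<integral>x. killed_sg (R - q) g x \<partial>\<mu>) / (exp (R - 1) * (\<integral>x. killed_sg (R - 1) g1 x \<partial>\<mu>)))
      = (\<integral>x. occupation S (R + ln v) R x \<partial>\<mu>) / (\<integral>x. occupation UNIV 0 R x \<partial>\<mu>)) at_top"
    using eventually_gt_at_top[of "max q 1"]
  proof eventually_elim
    case (elim R)
    have R: "R > q" "R > 1" "R > 0" "R \<ge> 0" using elim q by auto
    have 1: "(\<integral>x. occupation S (R + ln v) R x \<partial>\<mu>) = (\<integral>x. killed_sg (R - q) g x \<partial>\<mu>)"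
    proof (rule integral_cong_AE)
      show "AE x in \<mu>. occupation S (R + ln v) R x = killed_sg (R - q) g x"
        using \<mu>(3)
      proof eventually_elim
        case (elim x)
        have "occupation S (R - q) R x = killed_sg (R - q) (\<lambda>y. indicator S y * killed_sg (R - (R - q)) (\<lambda>_. 1) y) x"
          using R q by (intro occupation_eq_killed_sg elim S) auto
        then show ?case by (simp add: g_def[abs_def] q_def)
      qed
      show "occupation S (R + ln v) R \<in> borel_measurable \<mu>" by (intro meas occupation_measurable R S)
      show "killed_sg (R - q) g \<in> borel_measurable \<mu>"
        using R by (intro meas bounded_borel_measurable bounded_borel_killed_sg bump_bandD(1)[OF g]) simp
    qed
    have 2: "(\<integral>x. occupation UNIV 0 R x \<partial>\<mu>) = (\<integral>x. killed_sg (R - 1) g1 x \<partial>\<mu>)"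
    proof (rule integral_cong_AE)
      show "AE x in \<mu>. occupation UNIV 0 R x = killed_sg (R - 1) g1 x"
        using \<mu>(3)
      proof eventually_elim
        case (elim x)
        have "occupation UNIV 0 R x = killed_sg (R - 1 + 1) (\<lambda>_. 1) x"
          using occupation_UNIV_eq_killed_sg[OF elim] R by simp
        also have "\<dots> = killed_sg (R - 1) (killed_sg 1 (\<lambda>_. 1)) x"
          using R by (intro killed_sg_add) auto
        finally show ?case by (simp add: g1_def[abs_def])
      qed
      show "occupation UNIV 0 R \<in> borel_measurable \<mu>" by (intro meas occupation_measurable R) simp
      show "killed_sg (R - 1) g1 \<in> borel_measurable \<mu>"
        using R by (intro meas bounded_borel_measurable bounded_borel_killed_sg bump_bandD(1)[OF g1]) simp
    qed
    have e: "exp (q - 1) * exp (R - q) = exp (R - 1)" by (simp flip: exp_add)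
    have "exp (q - 1) * (exp (R - q) * a / (exp (R - 1) * b)) = exp (q - 1) * exp (R - q) * a / (exp (R - 1) * b)"
      for a b :: real by (simp only: times_divide_eq_right mult.assoc)
    then show ?case unfolding 1 2 e by simp
  qed
  moreover have "g = (\<lambda>y. indicator S y * killed_sg (- ln v) (\<lambda>_. 1) y)"
    by (simp add: g_def[abs_def] q_def)
  ultimately show ?thesis by (simp only: Lim_transform_eventually)
qed

text \<open>The hitting time is expanded path by path with \<open>nn_integral_log_tail\<close>, and
  Tonelli brings the integral over \<open>v\<close> to the outside. Measurability in
  \<open>v\<close> comes along, as that of a partial integral of a jointly measurable
  function.\<close>

lemma EtauZ_integral:
  assumes S: "S \<in> sets borel" "S \<subseteq> {-1<..<1}"
  shows "(\<lambda>v. indicator {0<..<1} v * ennreal (lagged_occupation S v)) \<in> borel_measurable borel"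
    and "(\<integral>\<^sup>+x\<in>S. EtauZ M W x \<partial>alpha_OU) =
    (\<integral>\<^sup>+v. indicator {0<..<1} v * ennreal (lagged_occupation S v) \<partial>lborel)"
proof -
  have K: "K_OU > 0" unfolding bump_pairing_1 using bump_pairing_1_pos by simp
  have sa: "sets alpha_OU = sets borel" unfolding alpha_OU_def by simp
  note [measurable_cong] = sa
  have [measurable]: "S \<in> sets borel" by (rule S)
  have "emeasure alpha_OU (space alpha_OU) = (\<integral>\<^sup>+x. ennreal 1 \<partial>alpha_OU)" by simp
  also have "\<dots> = ennreal (K_OU * bump_pairing (\<lambda>_. 1))" by (rule nn_integral_alpha_OU) auto
  \<comment> \<open>Finiteness supplies the sigma-finiteness that Tonelli needs.\<close>
  finally interpret A: finite_measure alpha_OU by (intro finite_measureI) simp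
  interpret AM: pair_sigma_finite alpha_OU M by unfold_locales
  interpret LM: pair_sigma_finite M lborel by unfold_locales
  interpret LA: pair_sigma_finite alpha_OU lborel by unfold_locales
  have [measurable]: "(\<lambda>z. tauZ W (fst z) (snd z)) \<in> borel_measurable (borel \<Otimes>\<^sub>M M)" by (rule tauZ_measurable)
  have t3: "(\<lambda>w. tauZ W (fst (fst w)) (snd w)) \<in> borel_measurable ((borel \<Otimes>\<^sub>M lborel) \<Otimes>\<^sub>M M)"
    using measurable_compose[OF _ tauZ_measurable, of "\<lambda>w. (fst (fst w), snd w)" "(borel \<Otimes>\<^sub>M lborel) \<Otimes>\<^sub>M M"] by simp
  define F where "F x v \<omega> = indicator {0<..<1} v * (ennreal (1 / v) * indicator {v. ennreal (- ln v) < tauZ W x \<omega>} v)"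
    for x v :: real and \<omega>
  have F3: "(\<lambda>w. F (fst (fst w)) (snd (fst w)) (snd w)) \<in> borel_measurable ((borel \<Otimes>\<^sub>M lborel) \<Otimes>\<^sub>M M)"
  proof -
    have "(\<lambda>w. indicator {w \<in> space ((borel \<Otimes>\<^sub>M lborel) \<Otimes>\<^sub>M M). ennreal (- ln (snd (fst w))) < tauZ W (fst (fst w)) (snd w)} w :: ennreal)
      \<in> borel_measurable ((borel \<Otimes>\<^sub>M lborel) \<Otimes>\<^sub>M M)"
      using t3 by measurable
    then have [measurable]: "(\<lambda>w. indicator {v. ennreal (- ln v) < tauZ W (fst (fst w)) (snd w)} (snd (fst w)) :: ennreal)
      \<in> borel_measurable ((borel \<Otimes>\<^sub>M lborel) \<Otimes>\<^sub>M M)"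
      by (rule measurable_cong[THEN iffD1, rotated]) (auto simp: indicator_def)
    show ?thesis unfolding F_def by measurable
  qed
  have Fx: "(\<lambda>(\<omega>, v). F x v \<omega>) \<in> borel_measurable (M \<Otimes>\<^sub>M lborel)" for x
    using measurable_compose[OF _ F3, of "\<lambda>z. ((x, snd z), fst z)" "M \<Otimes>\<^sub>M lborel"] by (simp add: split_beta')
  have Fint: "(\<lambda>(x, v). \<integral>\<^sup>+\<omega>. F x v \<omega> \<partial>M) \<in> borel_measurable (borel \<Otimes>\<^sub>M lborel)"
  proof -
    have "(\<lambda>(z, \<omega>). F (fst z) (snd z) \<omega>) \<in> borel_measurable ((borel \<Otimes>\<^sub>M lborel) \<Otimes>\<^sub>M M)"
      using F3 by (simp add: split_beta')
    from borel_measurable_nn_integral[OF this] show ?thesis by (simp add: split_beta')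
  qed
  have E: "EtauZ M W x = (\<integral>\<^sup>+v. (\<integral>\<^sup>+\<omega>. F x v \<omega> \<partial>M) \<partial>lborel)" for x
  proof -
    have "EtauZ M W x = (\<integral>\<^sup>+\<omega>. (\<integral>\<^sup>+v. F x v \<omega> \<partial>lborel) \<partial>M)"
      unfolding EtauZ_def F_def nn_integral_log_tail ..
    also have "\<dots> = (\<integral>\<^sup>+v. (\<integral>\<^sup>+\<omega>. F x v \<omega> \<partial>M) \<partial>lborel)"
      using LM.Fubini[OF Fx[of x]] by simp
    finally show ?thesis .
  qed
  have "(\<lambda>(x, v). (\<integral>\<^sup>+\<omega>. F x v \<omega> \<partial>M) * indicator S x) \<in> borel_measurable (borel \<Otimes>\<^sub>M lborel)"
    using Fint by (simp add: split_beta')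
  then have FS: "(\<lambda>(x, v). (\<integral>\<^sup>+\<omega>. F x v \<omega> \<partial>M) * indicator S x) \<in> borel_measurable (alpha_OU \<Otimes>\<^sub>M lborel)"
    using measurable_cong_sets[OF sets_pair_measure_cong[OF sa refl] refl] by blast
  have ptw: "(\<integral>\<^sup>+x. (\<integral>\<^sup>+\<omega>. F x v \<omega> \<partial>M) * indicator S x \<partial>alpha_OU) =
      indicator {0<..<1} v * ennreal (lagged_occupation S v)" for v :: real
  proof (cases "v \<in> {0<..<1}")
    case True
    then have q: "- ln v > 0" by simp
    note band = survival_band[OF q S(1)]
    have eq: "(\<integral>\<^sup>+\<omega>. F x v \<omega> \<partial>M) * indicator S x = ennreal (1 / v) * ennreal (indicator S x * killed_sg (- ln v) (\<lambda>_. 1) x)" for x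
    proof (cases "x \<in> S")
      case xS: True
      then have "x \<in> {-1<..<1}" using S by blast
      then have x: "\<bar>x\<bar> < 1" by auto
      have m: "(\<lambda>\<omega>. alive x 0 (- ln v) \<omega> :: real) \<in> borel_measurable M"
        using unkilled_measurable[OF q, of 0 x] by simp
      have "(\<integral>\<^sup>+\<omega>. F x v \<omega> \<partial>M) = (\<integral>\<^sup>+\<omega>. ennreal (1 / v) * ennreal (alive x 0 (- ln v) \<omega>) \<partial>M)"
        using True q x tauZ_gt_iff nohit_iff_inside[OF _ x, of _ "- ln v"]
        by (intro nn_integral_cong) (auto simp: F_def indicator_def)
      also have "\<dots> = ennreal (1 / v) * (\<integral>\<^sup>+\<omega>. ennreal (alive x 0 (- ln v) \<omega>) \<partial>M)"
        using m by (intro nn_integral_cmult) auto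
      also have "(\<integral>\<^sup>+\<omega>. ennreal (alive x 0 (- ln v) \<omega>) \<partial>M) = ennreal (killed_sg (- ln v) (\<lambda>_. 1) x)"
        unfolding killed_sg_eq[OF q bounded_borel_const]
        using killed_integrable[OF q bounded_borel_const[of 1], of x] by (subst nn_integral_eq_integral) auto
      finally show ?thesis using xS by simp
    qed simp
    have "(\<integral>\<^sup>+x. (\<integral>\<^sup>+\<omega>. F x v \<omega> \<partial>M) * indicator S x \<partial>alpha_OU) =
        ennreal (1 / v) * (\<integral>\<^sup>+x. ennreal (indicator S x * killed_sg (- ln v) (\<lambda>_. 1) x) \<partial>alpha_OU)"
      unfolding eq using bounded_borel_measurable[OF bump_bandD(1)[OF band]]
      by (intro nn_integral_cmult) (simp cong: measurable_cong_sets)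
    also have "\<dots> = ennreal (1 / v) * ennreal (K_OU * bump_pairing (\<lambda>y. indicator S y * killed_sg (- ln v) (\<lambda>_. 1) y))"
      using bump_bandD(2)[OF band] by (subst nn_integral_alpha_OU[OF bump_bandD(1)[OF band]]) auto
    also have "\<dots> = ennreal (lagged_occupation S v)"
    proof -
      have "0 \<le> bump_pairing (\<lambda>y. indicator S y * killed_sg (- ln v) (\<lambda>_. 1) y)"
        using bump_pairing_band(1)[OF band] by simp
      then show ?thesis using K True by (intro ennreal_mult[symmetric]) auto
    qed
    finally show ?thesis using True by simp
  qed (simp add: F_def)
  show "(\<lambda>v. indicator {0<..<1} v * ennreal (lagged_occupation S v)) \<in> borel_measurable borel"
    using A.borel_measurable_nn_integral[of _ lborel, OF measurable_pair_swap[OF FS, simplified]]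
    unfolding ptw[symmetric] by simp
  have "(\<integral>\<^sup>+x\<in>S. EtauZ M W x \<partial>alpha_OU) = (\<integral>\<^sup>+x. (\<integral>\<^sup>+v. (\<integral>\<^sup>+\<omega>. F x v \<omega> \<partial>M) * indicator S x \<partial>lborel) \<partial>alpha_OU)"
  proof (rule nn_integral_cong)
    fix x
    have "(\<lambda>v. \<integral>\<^sup>+\<omega>. F x v \<omega> \<partial>M) \<in> borel_measurable lborel"
      using measurable_compose[OF _ Fint, of "\<lambda>v. (x, v)" lborel] by simp
    then show "EtauZ M W x * indicator S x = (\<integral>\<^sup>+v. (\<integral>\<^sup>+\<omega>. F x v \<omega> \<partial>M) * indicator S x \<partial>lborel)"
      unfolding E by (simp add: nn_integral_multc)
  qed
  also have "\<dots> = (\<integral>\<^sup>+v. (\<integral>\<^sup>+x. (\<integral>\<^sup>+\<omega>. F x v \<omega> \<partial>M) * indicator S x \<partial>alpha_OU) \<partial>lborel)"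
    using LA.Fubini[OF FS] by simp
  finally show "(\<integral>\<^sup>+x\<in>S. EtauZ M W x \<partial>alpha_OU) =
    (\<integral>\<^sup>+v. indicator {0<..<1} v * ennreal (lagged_occupation S v) \<partial>lborel)"
    unfolding ptw .
qed

end

section \<open>Time averages\<close>

lemma filterlim_log_time:
  fixes s :: real
  assumes "s \<ge> 0" shows "filterlim (\<lambda>t. ln ((t + 1) / (s + 1))) at_top at_top"
  unfolding filterlim_at_top
proof
  fix K :: real
  show "\<forall>\<^sub>F t in at_top. K \<le> ln ((t + 1) / (s + 1))"
    using eventually_ge_at_top[of "(s + 1) * exp K"]
  proof eventually_elim
    case (elim t)
    then have "exp K \<le> (t + 1) / (s + 1)" using assms by (simp add: pos_le_divide_eq mult.commute)
    then show ?case using ln_mono[OF _ exp_gt_zero, of K] by simp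
  qed
qed

context brownian
begin

lemma occupation_eq_measure:
  assumes "\<rho> \<ge> 0"
  shows "occupation S \<rho> r x = measure M {\<omega> \<in> space M. OUproc W x \<rho> \<omega> \<in> S \<and> nohit r x \<omega>}"
proof -
  let ?E = "{\<omega> \<in> space M. OUproc W x \<rho> \<omega> \<in> S \<and> nohit r x \<omega>}"
  have "occupation S \<rho> r x = (\<integral>\<omega>. indicator ?E \<omega> \<partial>M)"
    unfolding occupation_def using assms
    by (intro Bochner_Integration.integral_cong) (auto simp: indicator_def)
  also have "\<dots> = measure M (?E \<inter> space M)" by simp
  also have "?E \<inter> space M = ?E" by blast
  finally show ?thesis .
qed

text \<open>The substitution \<open>u + 1 = (t + 1) v\<close> places the average over the fixed interval \<open>(0, 1)\<close>;
  on the logarithmic time scale of the Ornstein-Uhlenbeck process, \<open>u\<close> then lags \<open>t\<close> by \<open>- ln v\<close>.\<close>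
lemma averaged_occupation_tendsto:
  assumes \<mu>: "prob_space \<mu>" "sets \<mu> = sets borel" "AE x in \<mu>. \<bar>x\<bar> < 1"
    and S: "S \<in> sets borel" and s: "s \<ge> 0"
  defines "D \<equiv> \<lambda>t. \<integral>x. occupation UNIV 0 (ln ((t + 1) / (s + 1))) x \<partial>\<mu>"
  defines "A \<equiv> \<lambda>t u. \<integral>x. occupation S (ln ((u + 1) / (s + 1))) (ln ((t + 1) / (s + 1))) x \<partial>\<mu>"
  defines "\<Phi> \<equiv> \<lambda>v. indicator {0<..<1} v * (lagged_occupation S v)"
  assumes \<Phi>m: "\<Phi> \<in> borel_measurable borel"
  shows "integrable lborel \<Phi>"
    and "((\<lambda>t. 1 / t * (LINT u:{s..t}|lborel. A t u / D t)) \<longlongrightarrow> integral\<^sup>L lborel \<Phi>) at_top"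
proof -
  interpret \<mu>: prob_space \<mu> by (rule \<mu>(1))
  note [measurable_cong] = \<mu>(2)
  define R where "R t = ln ((t + 1) / (s + 1))" for t
  have R0: "R t \<ge> 0" if "t \<ge> s" for t
    unfolding R_def using that s by (intro ln_ge_zero) (simp add: pos_le_divide_eq)
  \<comment> \<open>The average after the substitution, without its factor. Setting it to 0 for
    \<open>t \<le> s\<close> lets one dominating function serve all \<open>t\<close>.\<close>
  define \<Psi> where "\<Psi> t v = (if t > s then indicator {s..t} (- 1 + (t + 1) * v) * (A t (- 1 + (t + 1) * v) / D t) else 0)" for t v
  have meas: "f \<in> borel_measurable \<mu>" if "f \<in> borel_measurable borel" for f :: "real \<Rightarrow> real"
    using that measurable_cong_sets[OF \<mu>(2) refl] by blast
  have int: "integrable \<mu> (occupation S \<rho> (R t))" if "t \<ge> s" "S \<in> sets borel" for S \<rho> t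
  proof -
    note occ = occupation_bounds[OF R0[OF that(1)] that(2)]
    have "norm (occupation S \<rho> (R t) x) \<le> 1" for x
      using occ(1)[of \<rho> x] occ(2)[of \<rho> x 0] occ(3)[of 0 x] by simp
    then show ?thesis
      by (intro \<mu>.integrable_const_bound[where B=1] meas occupation_measurable R0 that AE_I2)
  qed
  \<comment> \<open>\<open>0 \<le> A \<le> D\<close> is enough: if \<open>D\<close> vanishes, the
    quotient is 0 by convention.\<close>
  have ratio: "0 \<le> A t u / D t" "A t u / D t \<le> 1" if t: "t \<ge> s" for t u
  proof -
    have A0: "0 \<le> A t u" unfolding A_def
      by (intro integral_nonneg_AE AE_I2 occupation_bounds(1)[OF R0[OF t, unfolded R_def] S])
    have AD: "A t u \<le> D t"
      unfolding A_def D_def R_def[symmetric]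
      by (intro integral_mono int t S occupation_bounds(2)[OF R0[OF t] S]) simp
    show "0 \<le> A t u / D t" using A0 AD by simp
    show "A t u / D t \<le> 1" using A0 AD by (auto simp: divide_le_eq_1)
  qed
  have Am: "A t \<in> borel_measurable borel" if t: "t \<ge> s" for t
  proof -
    have "(\<lambda>z. occupation S (ln ((fst z + 1) / (s + 1))) (R t) (snd z)) \<in> borel_measurable (borel \<Otimes>\<^sub>M borel)"
      using measurable_compose[OF _ occupation_joint_measurable[OF R0[OF t] S], of "\<lambda>z. (ln ((fst z + 1) / (s + 1)), snd z)" "borel \<Otimes>\<^sub>M borel"]
      by simp
    then have "(\<lambda>(u, x). occupation S (ln ((u + 1) / (s + 1))) (R t) x) \<in> borel_measurable (borel \<Otimes>\<^sub>M \<mu>)"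
      using measurable_cong_sets[OF sets_pair_measure_cong[OF refl \<mu>(2)] refl] by (auto simp: split_beta')
    then show ?thesis unfolding A_def R_def by (rule \<mu>.borel_measurable_lebesgue_integral)
  qed
  have \<Psi>m: "\<Psi> t \<in> borel_measurable lborel" for t
  proof (cases "t > s")
    case True
    note [measurable] = Am[OF less_imp_le[OF True]]
    show ?thesis unfolding \<Psi>_def using True by simp
  qed (simp add: \<Psi>_def[abs_def])
  have bound: "norm (\<Psi> t v) \<le> indicator {0..1} v * 1" for t v
  proof (cases "t > s \<and> - 1 + (t + 1) * v \<in> {s..t}")
    case True
    then have t: "t \<ge> s" "t + 1 > 0" using s by auto
    from True have "s \<le> - 1 + (t + 1) * v" "- 1 + (t + 1) * v \<le> t" by auto
    then have "0 \<le> (t + 1) * v" "(t + 1) * v \<le> (t + 1) * 1" using s by argo+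
    then have "v \<in> {0..1}" using t(2) mult_le_cancel_left_pos[OF t(2), of v 1] by (auto simp: zero_le_mult_iff)
    moreover have "\<bar>A t (- 1 + (t + 1) * v) / D t\<bar> \<le> 1" by (simp only: abs_of_nonneg ratio[OF t(1)])
    ultimately show ?thesis using True by (simp add: \<Psi>_def)
  qed (auto simp: \<Psi>_def)
  \<comment> \<open>At \<open>v = 1\<close> the substituted time is \<open>t\<close> itself and
    never leaves the range, so \<open>\<Psi>\<close> need not tend to the value 0 of
    \<open>\<Phi>\<close>. This single point is a null set.\<close>
  have lim: "((\<lambda>t. \<Psi> t v) \<longlongrightarrow> \<Phi> v) at_top" if v1: "v \<noteq> 1" for v
  proof (cases "0 < v \<and> v < 1")
    case True
    then have v: "0 < v" "v < 1" by auto
    have "((\<lambda>t. (\<integral>x. occupation S (R t + ln v) (R t) x \<partial>\<mu>) / (\<integral>x. occupation UNIV 0 (R t) x \<partial>\<mu>)) \<longlongrightarrow> \<Phi> v) at_top"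
      using filterlim_compose[OF occupation_ratio_tendsto[OF \<mu> S v] filterlim_log_time[OF s]] v
      unfolding R_def \<Phi>_def by simp
    moreover have "\<forall>\<^sub>F t in at_top. (\<integral>x. occupation S (R t + ln v) (R t) x \<partial>\<mu>) / (\<integral>x. occupation UNIV 0 (R t) x \<partial>\<mu>) = \<Psi> t v"
      using eventually_gt_at_top[of "max s ((s + 1) / v)"]
    proof eventually_elim
      case (elim t)
      then have t: "t > s" "t + 1 > 0" "(s + 1) / v < t" using s by auto
      \<comment> \<open>The threshold \<open>(s + 1) / v\<close> is what puts the substituted time
        after \<open>s\<close>.\<close>
      have "s + 1 < t * v" using t(3) v by (simp add: pos_divide_less_eq)
      then have low: "s \<le> - 1 + (t + 1) * v" using v by (simp add: algebra_simps)
      have "(t + 1) * v \<le> (t + 1) * 1" using t v by (intro mult_left_mono) auto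
      then have in_int: "- 1 + (t + 1) * v \<in> {s..t}" using low by simp
      have "ln ((- 1 + (t + 1) * v + 1) / (s + 1)) = ln ((t + 1) / (s + 1) * v)" by simp
      also have "\<dots> = R t + ln v" unfolding R_def using t s v by (intro ln_mult_pos) auto
      finally have "A t (- 1 + (t + 1) * v) = (\<integral>x. occupation S (R t + ln v) (R t) x \<partial>\<mu>)"
        unfolding A_def R_def by simp
      then show ?case using t in_int unfolding \<Psi>_def D_def R_def by simp
    qed
    ultimately show ?thesis by (rule Lim_transform_eventually)
  next
    case False
    have "\<Psi> t v = 0" for t
    proof -
      have "- 1 + (t + 1) * v \<notin> {s..t}" if t: "t > s"
      proof (cases "v \<le> 0")
        case True
        then have "(t + 1) * v \<le> 0" using t s by (intro mult_nonneg_nonpos) auto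
        then show ?thesis using s by auto
      next
        case v: False
        then have "1 < v" using False v1 by auto
        then have "(t + 1) * 1 < (t + 1) * v" using t s by (intro mult_strict_left_mono) auto
        then show ?thesis by auto
      qed
      then show ?thesis by (simp add: \<Psi>_def)
    qed
    moreover have "\<Phi> v = 0" using False by (auto simp: \<Phi>_def)
    ultimately show ?thesis by simp
  qed
  have ae: "AE v in lborel. ((\<lambda>t. \<Psi> t v) \<longlongrightarrow> \<Phi> v) at_top"
    using AE_lborel_singleton[of "1::real"] by eventually_elim (rule lim)
  have wi: "integrable lborel (\<lambda>v::real. indicator {0..1} v * (1::real))"
    by (rule integrable_bounded_borel_interval(1)) simp
  have \<Phi>m': "\<Phi> \<in> borel_measurable lborel" using \<Phi>m by simp
  have main: "((\<lambda>t. integral\<^sup>L lborel (\<Psi> t)) \<longlongrightarrow> integral\<^sup>L lborel \<Phi>) at_top"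
    by (rule integral_dominated_convergence_at_top[OF \<Phi>m' \<Psi>m wi ae]) (auto intro!: always_eventually AE_I2 bound[simplified])
  show "integrable lborel \<Phi>"
    by (rule integrable_dominated_convergence_at_top[OF \<Phi>m' \<Psi>m wi ae]) (auto intro!: always_eventually AE_I2 bound[simplified])
  \<comment> \<open>The substitution produces a factor \<open>t + 1\<close> against the
    normalization \<open>1 / t\<close>; their product \<open>1 + inverse t\<close> tends to
    1.\<close>
  have "((\<lambda>t::real. 1 + inverse t) \<longlongrightarrow> 1 + 0) at_top"
    by (intro tendsto_add tendsto_const tendsto_inverse_0_at_top filterlim_ident)
  then have "((\<lambda>t. (1 + inverse t) * integral\<^sup>L lborel (\<Psi> t)) \<longlongrightarrow> (1 + 0) * integral\<^sup>L lborel \<Phi>) at_top"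
    by (intro tendsto_mult main)
  moreover have "\<forall>\<^sub>F t in at_top. (1 + inverse t) * integral\<^sup>L lborel (\<Psi> t) = 1 / t * (LINT u:{s..t}|lborel. A t u / D t)"
    using eventually_gt_at_top[of s]
  proof eventually_elim
    case (elim t)
    have t: "t > 0" "t + 1 \<noteq> 0" using elim s by auto
    have "(LINT u:{s..t}|lborel. A t u / D t) = (\<integral>u. indicator {s..t} u * (A t u / D t) \<partial>lborel)"
      unfolding set_lebesgue_integral_def by simp
    also have "\<dots> = \<bar>t + 1\<bar> *\<^sub>R (\<integral>v. indicator {s..t} (- 1 + (t + 1) * v) * (A t (- 1 + (t + 1) * v) / D t) \<partial>lborel)"
      by (rule lborel_integral_real_affine) (rule t)
    also have "\<dots> = (t + 1) * integral\<^sup>L lborel (\<Psi> t)" unfolding \<Psi>_def using elim t by simp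
    finally have "1 / t * (LINT u:{s..t}|lborel. A t u / D t) = 1 / t * ((t + 1) * integral\<^sup>L lborel (\<Psi> t))" by simp
    also have "\<dots> = (1 / t * (t + 1)) * integral\<^sup>L lborel (\<Psi> t)" by (simp only: mult.assoc)
    also have "1 / t * (t + 1) = 1 + inverse t" using t by (simp add: field_simps)
    finally show ?case ..
  qed
  ultimately show "((\<lambda>t. 1 / t * (LINT u:{s..t}|lborel. A t u / D t)) \<longlongrightarrow> integral\<^sup>L lborel \<Phi>) at_top"
    by (simp add: Lim_transform_eventually)
qed

lemma limit_density_nonneg:
  assumes "S \<in> sets borel"
  shows "0 \<le> indicator {0<..<1} v * (lagged_occupation S v)"
proof (cases "v \<in> {0<..<1}")
  case True
  then have q: "- ln v > 0" by simp
  have "0 \<le> bump_pairing (\<lambda>y. indicator S y * killed_sg (- ln v) (\<lambda>_. 1) y)"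
    using bump_pairing_band(1)[OF survival_band[OF q assms]] by simp
  moreover have "K_OU > 0" unfolding bump_pairing_1 using bump_pairing_1_pos by simp
  ultimately show ?thesis using True by simp
qed simp

lemma limit_density_measurable:
  assumes S: "S \<in> sets borel" "S \<subseteq> {-1<..<1}"
  shows "(\<lambda>v. indicator {0<..<1} v * (lagged_occupation S v)) \<in> borel_measurable borel"
    (is "?\<Phi> \<in> _")
proof -
  have "?\<Phi> v = enn2real (indicator {0<..<1} v * ennreal (lagged_occupation S v))" for v
    using limit_density_nonneg[OF S(1), of v] by (cases "v \<in> {0<..<1}") auto
  moreover have "(\<lambda>v. enn2real (indicator {0<..<1} v * ennreal (lagged_occupation S v))) \<in> borel_measurable borel"
    using EtauZ_integral(1)[OF S] by measurable
  ultimately show ?thesis by presburger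
qed

end

text \<open>With \<open>exp r = (u + 1) / (s + 1)\<close> the argument \<open>u - s\<close> of
  \<open>W\<close> is \<open>(s + 1) * (exp r - 1)\<close>, which is the Doob clock of the rescaled
  motion; the square roots combine to \<open>exp (- r / 2)\<close>.\<close>

lemma Xproc_eq_OUproc:
  assumes s: "s \<ge> 0" and u: "u \<ge> s"
  shows "Xproc W x s u \<omega> = OUproc (\<lambda>v \<omega>. W ((s + 1) * v) \<omega> / sqrt (s + 1)) x (ln ((u + 1) / (s + 1))) \<omega>"
proof -
  define r where "r = ln ((u + 1) / (s + 1))"
  have er: "exp r = (u + 1) / (s + 1)" unfolding r_def using s u by simp
  have "(exp (r / 2))\<^sup>2 = (u + 1) / (s + 1)" using er by (simp flip: exp_double)
  then have "exp (r / 2) = sqrt ((u + 1) / (s + 1))" by (intro real_sqrt_unique[symmetric]) auto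
  then have e2: "exp (- r / 2) = sqrt (s + 1) / sqrt (u + 1)"
    by (simp add: exp_minus real_sqrt_divide)
  have arg: "(s + 1) * (exp r - 1) = u - s" unfolding er using s by (simp add: field_simps)
  define a where "a = sqrt (s + 1)"
  have "a > 0" using s by (simp add: a_def)
  then have "(x * a + w) / b = a / b * (x + w / a)" for w b :: real
    by (simp add: distrib_left add_divide_distrib)
  then show ?thesis unfolding r_def[symmetric] OUproc_def arg e2 Xproc_def a_def .
qed

text \<open>The time change is an increasing bijection from
  \<open>[0, ln ((t + 1) / (s + 1))]\<close> onto \<open>[s, t]\<close> and so preserves the absence
  of hits; \<open>no_hit_iff_open\<close> connects this with the infimum.\<close>

lemma tauX_gt_iff:
  assumes BM: "std_BM M W" and s: "s \<ge> 0" and t: "t \<ge> s" and \<omega>: "\<omega> \<in> space M"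
  shows "ereal t < tauX W x s \<omega> \<longleftrightarrow>
    (\<forall>v\<in>{0..ln ((t + 1) / (s + 1))}. \<bar>OUproc (\<lambda>v \<omega>. W ((s + 1) * v) \<omega> / sqrt (s + 1)) x v \<omega>\<bar> \<noteq> 1)"
    (is "_ \<longleftrightarrow> (\<forall>v\<in>{0..?R}. \<bar>?Z v\<bar> \<noteq> 1)")
proof -
  interpret brownian M W by (rule brownian.intro[OF BM])
  have cont: "continuous_on {s..} (\<lambda>u. Xproc W x s u \<omega>)"
  proof -
    have "continuous_on {s..} (\<lambda>u. W (u - s) \<omega>)"
      by (rule continuous_on_compose2[OF W_continuous[OF \<omega>]]) (auto intro!: continuous_intros)
    then show ?thesis unfolding Xproc_def using s by (intro continuous_intros) auto
  qed
  have "ereal t < tauX W x s \<omega> \<longleftrightarrow> (\<forall>u\<in>{s..t}. \<bar>Xproc W x s u \<omega>\<bar> \<noteq> 1)"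
  proof
    assume gt: "ereal t < tauX W x s \<omega>"
    show "\<forall>u\<in>{s..t}. \<bar>Xproc W x s u \<omega>\<bar> \<noteq> 1"
    proof (intro ballI notI)
      fix u assume u: "u \<in> {s..t}" "\<bar>Xproc W x s u \<omega>\<bar> = 1"
      then have "tauX W x s \<omega> \<le> ereal u" unfolding tauX_def by (intro Inf_lower) auto
      also have "\<dots> \<le> ereal t" using u by simp
      finally show False using gt by simp
    qed
  next
    assume "\<forall>u\<in>{s..t}. \<bar>Xproc W x s u \<omega>\<bar> \<noteq> 1"
    then obtain d where d: "d > 0" "\<And>u. u \<ge> s \<Longrightarrow> \<bar>Xproc W x s u \<omega>\<bar> = 1 \<Longrightarrow> t + d \<le> u"
      using no_hit_iff_open[OF cont t] by blast
    have "ereal t < ereal (t + d)" using d by simp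
    also have "\<dots> \<le> tauX W x s \<omega>" unfolding tauX_def by (intro Inf_greatest) (auto intro!: d(2))
    finally show "ereal t < tauX W x s \<omega>" .
  qed
  also have "\<dots> \<longleftrightarrow> (\<forall>v\<in>{0..?R}. \<bar>?Z v\<bar> \<noteq> 1)"
  proof
    assume X: "\<forall>u\<in>{s..t}. \<bar>Xproc W x s u \<omega>\<bar> \<noteq> 1"
    show "\<forall>v\<in>{0..?R}. \<bar>?Z v\<bar> \<noteq> 1"
    proof
      fix v assume v: "v \<in> {0..?R}"
      define u where "u = (s + 1) * exp v - 1"
      have "exp v \<le> exp ?R" using v by simp
      also have "\<dots> = (t + 1) / (s + 1)" using s t by simp
      finally have "u \<le> t" unfolding u_def using s by (simp add: pos_le_divide_eq mult.commute)
      have "(s + 1) * 1 \<le> (s + 1) * exp v" using v s by (intro mult_left_mono) auto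
      then have us: "s \<le> u" unfolding u_def by simp
      have lnv: "ln ((u + 1) / (s + 1)) = v" unfolding u_def using s by simp
      have "\<bar>Xproc W x s u \<omega>\<bar> \<noteq> 1" using X us \<open>u \<le> t\<close> by auto
      then show "\<bar>?Z v\<bar> \<noteq> 1" unfolding Xproc_eq_OUproc[OF s us] lnv .
    qed
  next
    assume Z: "\<forall>v\<in>{0..?R}. \<bar>?Z v\<bar> \<noteq> 1"
    show "\<forall>u\<in>{s..t}. \<bar>Xproc W x s u \<omega>\<bar> \<noteq> 1"
    proof
      fix u assume u: "u \<in> {s..t}"
      have "0 \<le> ln ((u + 1) / (s + 1))" using u s by (intro ln_ge_zero) (auto simp: pos_le_divide_eq)
      moreover have "ln ((u + 1) / (s + 1)) \<le> ?R"
        using u s by (intro ln_mono) (auto intro!: divide_right_mono)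
      ultimately show "\<bar>Xproc W x s u \<omega>\<bar> \<noteq> 1"
        using Z Xproc_eq_OUproc[OF s, of u W x \<omega>] u by auto
    qed
  qed
  finally show ?thesis .
qed

text \<open>The limit is taken in \<open>ennreal\<close>, where expected hitting times live. Its
  finiteness comes out of the dominated convergence, the conditional probabilities being at most
  1.\<close>

theorem theorem3:
  fixes M :: "'a measure" and W :: "real \<Rightarrow> 'a \<Rightarrow> real"
    and \<mu> :: "real measure" and s :: real and S :: "real set"
  assumes "std_BM M W"
    and "prob_space \<mu>" and "sets \<mu> = sets borel" and "emeasure \<mu> {-1<..<1} = 1"
    and "s \<ge> 0"
    and "S \<in> sets borel" and "S \<subseteq> {-1<..<1}"
  shows "((\<lambda>t. ennreal (1 / t * (LINT u:{s..t}|lborel.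
              Pmu M \<mu> (\<lambda>x \<omega>. Xproc W x s u \<omega> \<in> S \<and> tauX W x s \<omega> > ereal t)
              / Pmu M \<mu> (\<lambda>x \<omega>. tauX W x s \<omega> > ereal t))))
          \<longlongrightarrow> (\<integral>\<^sup>+x\<in>S. EtauZ M W x \<partial>alpha_OU)) at_top"
proof -
  \<comment> \<open>On the logarithmic time scale \<open>X\<close> is the Ornstein-Uhlenbeck process
    of this rescaled motion, whereas \<open>EtauZ\<close> is built from \<open>W\<close>
    itself.\<close>
  define W' where "W' = (\<lambda>v \<omega>. W ((s + 1) * v) \<omega> / sqrt (s + 1))"
  have s1: "s + 1 > 0" using assms(5) by simp
  interpret B: brownian M W by (rule brownian.intro[OF assms(1)])
  interpret B': brownian M W' unfolding W'_def by (rule brownian.intro[OF std_BM_scale[OF assms(1) s1]])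
  interpret \<mu>: prob_space \<mu> by (rule assms(2))
  have "\<mu>.prob {-1<..<1} = 1" using assms(4) by (simp add: measure_def)
  then have "AE x in \<mu>. x \<in> {-1<..<1}" by (rule \<mu>.AE_prob_1)
  then have ae: "AE x in \<mu>. \<bar>x\<bar> < 1" by eventually_elim auto
  define D where "D t = (\<integral>x. B'.occupation UNIV 0 (ln ((t + 1) / (s + 1))) x \<partial>\<mu>)" for t
  define A where "A t u = (\<integral>x. B'.occupation S (ln ((u + 1) / (s + 1))) (ln ((t + 1) / (s + 1))) x \<partial>\<mu>)" for t u
  define \<Phi> where "\<Phi> v = indicator {0<..<1} v * (lagged_occupation S v)" for v :: real
  \<comment> \<open>\<open>\<Phi>\<close> contains \<open>killed_sg\<close> and no motion, so facts
    about the limit from \<open>B\<close> and facts about the averages from \<open>B'\<close> fit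
    together.\<close>
  note \<Phi>m = B.limit_density_measurable[OF assms(6,7)]
  note avg = B'.averaged_occupation_tendsto[OF assms(2,3) ae assms(6,5) \<Phi>m, folded A_def D_def \<Phi>_def]
  have tau: "ereal t < tauX W x s \<omega> \<longleftrightarrow> B'.nohit (ln ((t + 1) / (s + 1))) x \<omega>"
    if "t \<ge> s" "\<omega> \<in> space M" for t x \<omega>
    unfolding B'.nohit_def using tauX_gt_iff[OF assms(1,5) that] unfolding W'_def .
  have den: "Pmu M \<mu> (\<lambda>x \<omega>. ereal t < tauX W x s \<omega>) = D t" if t: "t \<ge> s" for t
  proof -
    have "{\<omega> \<in> space M. ereal t < tauX W x s \<omega>} =
        {\<omega> \<in> space M. OUproc W' x 0 \<omega> \<in> UNIV \<and> B'.nohit (ln ((t + 1) / (s + 1))) x \<omega>}" for x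
      using tau[OF t] by auto
    then have "measure M {\<omega> \<in> space M. ereal t < tauX W x s \<omega>} = B'.occupation UNIV 0 (ln ((t + 1) / (s + 1))) x" for x
      by (simp only: B'.occupation_eq_measure[OF order_refl])
    then show ?thesis unfolding Pmu_def D_def by simp
  qed
  have num: "Pmu M \<mu> (\<lambda>x \<omega>. Xproc W x s u \<omega> \<in> S \<and> ereal t < tauX W x s \<omega>) = A t u" if t: "u \<in> {s..t}" for t u
  proof -
    have "{\<omega> \<in> space M. Xproc W x s u \<omega> \<in> S \<and> ereal t < tauX W x s \<omega>} =
        {\<omega> \<in> space M. OUproc W' x (ln ((u + 1) / (s + 1))) \<omega> \<in> S \<and> B'.nohit (ln ((t + 1) / (s + 1))) x \<omega>}" for x
      using tau[of t] t Xproc_eq_OUproc[OF assms(5), of u W x] unfolding W'_def by auto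
    moreover have "0 \<le> ln ((u + 1) / (s + 1))" using t s1 by (intro ln_ge_zero) (auto simp: pos_le_divide_eq)
    ultimately have "measure M {\<omega> \<in> space M. Xproc W x s u \<omega> \<in> S \<and> ereal t < tauX W x s \<omega>} =
        B'.occupation S (ln ((u + 1) / (s + 1))) (ln ((t + 1) / (s + 1))) x" for x
      by (simp only: B'.occupation_eq_measure)
    then show ?thesis unfolding Pmu_def A_def by simp
  qed
  have "((\<lambda>t. 1 / t * (LINT u:{s..t}|lborel.
      Pmu M \<mu> (\<lambda>x \<omega>. Xproc W x s u \<omega> \<in> S \<and> ereal t < tauX W x s \<omega>) / Pmu M \<mu> (\<lambda>x \<omega>. ereal t < tauX W x s \<omega>)))
    \<longlongrightarrow> integral\<^sup>L lborel \<Phi>) at_top"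
  proof (rule Lim_transform_eventually[OF avg(2)])
    show "\<forall>\<^sub>F t in at_top. 1 / t * (LINT u:{s..t}|lborel. A t u / D t) = 1 / t * (LINT u:{s..t}|lborel.
      Pmu M \<mu> (\<lambda>x \<omega>. Xproc W x s u \<omega> \<in> S \<and> ereal t < tauX W x s \<omega>) / Pmu M \<mu> (\<lambda>x \<omega>. ereal t < tauX W x s \<omega>))"
      using eventually_ge_at_top[of s]
    proof eventually_elim
      case (elim t)
      show ?case unfolding set_lebesgue_integral_def
        by (intro arg_cong[where f="\<lambda>z. 1 / t * z"] Bochner_Integration.integral_cong)
           (auto simp: indicator_def num den[OF elim])
    qed
  qed
  then have "((\<lambda>t. ennreal (1 / t * (LINT u:{s..t}|lborel.
      Pmu M \<mu> (\<lambda>x \<omega>. Xproc W x s u \<omega> \<in> S \<and> ereal t < tauX W x s \<omega>) / Pmu M \<mu> (\<lambda>x \<omega>. ereal t < tauX W x s \<omega>))))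
    \<longlongrightarrow> ennreal (integral\<^sup>L lborel \<Phi>)) at_top"
    by (rule tendsto_ennrealI)
  moreover have "ennreal (integral\<^sup>L lborel \<Phi>) = (\<integral>\<^sup>+x\<in>S. EtauZ M W x \<partial>alpha_OU)"
  proof -
    have pos: "0 \<le> \<Phi> v" for v unfolding \<Phi>_def by (rule B.limit_density_nonneg[OF assms(6)])
    have "(\<integral>\<^sup>+x\<in>S. EtauZ M W x \<partial>alpha_OU) = (\<integral>\<^sup>+v. ennreal (\<Phi> v) \<partial>lborel)"
      unfolding B.EtauZ_integral(2)[OF assms(6,7)]
      by (rule nn_integral_cong) (auto simp: \<Phi>_def indicator_def)
    also have "\<dots> = ennreal (integral\<^sup>L lborel \<Phi>)"
      using avg(1) pos by (intro nn_integral_eq_integral) auto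
    finally show ?thesis ..
  qed
  ultimately show ?thesis by simp
qed

end
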